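(* For every $\varepsilon>0$, the map $\mathcal{G}$ is a homeomorphism (onto its image in $\mathbb{C}$) when restricted to the set $$Z_\varepsilon:=\{(\underline{s},t): \underline{s}\text{ exponentially bounded},\ t\ge t_{\underline{s}}+\varepsilon\}.$$
   Context: For $\kappa\in\mathbb{C}$, $E_\kappa(z)=\exp(z)+\kappa$ and $I(E_\kappa)=\{z:E_\kappa^n(z)\to\infty\}$. Model. An external address is a sequence $\underline{s}=s_1s_2s_3\dots\in\mathbb{Z}^{\mathbb{N}}$; $\sigma$ is the shift; addresses carry the order topology of the lexicographic order. Let $F(t)=e^t-1$ on $[0,\infty)$, $\mathcal{F}(\underline{s},t)=(\sigma(\underline{s}),F(t)-2\pi|s_2|)$, $T(\underline{s},t)=t$, $Z(\underline{s},t)=t+2\pi i s_1$. Put $\overline{X}=\{(\underline{s},t)\in\mathbb{Z}^{\mathbb{N}}\times[0,\infty): T(\mathcal{F}^n(\underline{s},t))\ge 0\ \forall n\ge 0\}$ and $X=\{(\underline{s},t)\in\overline{X}:T(\mathcal{F}^n(\underline{s},t))\to\infty\}$ (product topology). For each $\underline{s}$ there is $t_{\underline{s}}\in[0,\infty]$ with $\{t:(\underline{s},t)\in\overline{X}\}=[t_{\underline{s}},\infty)$; $(\underline{s},t)\in X$ for $t>t_{\underline{s}}$; $\underline{s}$ is exponentially bounded if $t_{\underline{s}}<\infty$. The map $\mathfrak{g}^\kappa$. Choose $K>2\pi+6$ with $|\kappa|\le K$, let $Q=\max\{\log(4(K+\pi+3)),\pi+2\}$ and $Y=\{(\underline{s},t)\in\overline{X}:T(\mathcal{F}^n(\underline{s},t))\ge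 Q\ \forall n\ge 0\}$. Let $L_k(w)=\operatorname{Log}(w-\kappa)+2\pi i k$ (principal branch), $\mathfrak{g}_0=Z$, $\mathfrak{g}_{k+1}(\underline{s},t)=L_{s_1}(\mathfrak{g}_k(\mathcal{F}(\underline{s},t)))$. On $Y$ the $\mathfrak{g}_k$ converge uniformly to a map $\mathfrak{g}=\mathfrak{g}^\kappa$ with $\mathfrak{g}\circ\mathcal{F}=E_\kappa\circ\mathfrak{g}$. The restriction $\mathfrak{g}|_{Y\cap X}$ extends uniquely to a map with $\mathfrak{g}\circ\mathcal{F}=E_\kappa\circ\mathfrak{g}$ that is continuous in $t$ along each $\{\underline{s}\}\times\{t: (\underline s,t)\in X\}$ and is defined on all of $X$ if $\kappa\notin I(E_\kappa)$; if $\kappa\in I(E_\kappa)$ then there is $(\underline{s}^0,t^0)\in X$ with $\mathfrak{g}(\underline{s}^0,t^0)=\kappa$, and $\mathfrak{g}$ is defined on all of $X$ except the points $(\underline{s},t)$ with $\mathcal{F}^n(\underline{s},t)=(\underline{s}^0,t')$ for some $n\ge1$, $t'\le t^0$. Parameter rays (known result of Förster–Schleicher). For every exponentially bounded $\underline{s}$ and every $t>t_{\underline{s}}$ there is a unique parameter $\kappa=:\mathcal{G}(\underline{s},t)$ with $\mathfrak{g}^\kappa(\underline{s},t)=\kappa$; for fixed $\underline{s}$ it depends continuously on $t$. This defines $\mathcal{G}$. *)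

theory Defs
  imports "HOL-Analysis.Analysis" "HOL-Library.Fun_Lexorder"
begin

(* An address s_1 s_2 s_3 ... is the function s with s 0 = s_1, s 1 = s_2, ... *)
type_synonym address = "nat \<Rightarrow> int"

(* The order topology of the lexicographic order: all open rays form a subbase.  There is no
   least or greatest address, so the rays cover and the topspace is the whole type. *)
definition address_topology :: "address topology" where
  "address_topology =
     topology_generated_by
       (range (\<lambda>a. {s. less_fun s a}) \<union> range (\<lambda>a. {s. less_fun a s}))"

definition shift :: "address \<Rightarrow> address" where
  "shift s = (\<lambda>n. s (Suc n))"

definition E :: "complex \<Rightarrow> complex \<Rightarrow> complex" where
  "E \<kappa> z = exp z + \<kappa>"

definition escaping_set :: "complex \<Rightarrow> complex set" where
  "escaping_set \<kappa> = {z. filterlim (\<lambda>n. (E \<kappa> ^^ n) z) at_infinity sequentially}"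

definition F :: "real \<Rightarrow> real" where
  "F t = exp t - 1"

(* Defined for every real height; X_bar keeps only orbits whose heights are all nonnegative. *)
definition model_map :: "address \<times> real \<Rightarrow> address \<times> real" where
  "model_map = (\<lambda>(s, t). (shift s, F t - 2 * pi * \<bar>real_of_int (s 1)\<bar>))"

definition T :: "address \<times> real \<Rightarrow> real" where
  "T = snd"

definition Z :: "address \<times> real \<Rightarrow> complex" where
  "Z = (\<lambda>(s, t). of_real t + 2 * of_real pi * \<i> * of_int (s 0))"

definition X_bar :: "(address \<times> real) set" where
  "X_bar = {(s, t). 0 \<le> t \<and> (\<forall>n. 0 \<le> T ((model_map ^^ n) (s, t)))}"

definition X :: "(address \<times> real) set" where
  "X = {p \<in> X_bar. filterlim (\<lambda>n. T ((model_map ^^ n) p)) at_top sequentially}"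

(* The infimum of the empty set is \<infinity>. *)
definition t_min :: "address \<Rightarrow> ereal" where
  "t_min s = (INF t \<in> {t. (s, t) \<in> X_bar}. ereal t)"

definition exp_bounded :: "address \<Rightarrow> bool" where
  "exp_bounded s \<longleftrightarrow> t_min s < \<infinity>"

(* An arbitrary admissible constant; the map g defined below does not depend on the choice. *)
definition K_of :: "complex \<Rightarrow> real" where
  "K_of \<kappa> = (SOME K. K > 2 * pi + 6 \<and> norm \<kappa> \<le> K)"

definition Q_of :: "complex \<Rightarrow> real" where
  "Q_of \<kappa> = max (ln (4 * (K_of \<kappa> + pi + 3))) (pi + 2)"

definition Y :: "complex \<Rightarrow> (address \<times> real) set" where
  "Y \<kappa> = {p \<in> X_bar. \<forall>n. T ((model_map ^^ n) p) \<ge> Q_of \<kappa>}"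

definition L :: "complex \<Rightarrow> int \<Rightarrow> complex \<Rightarrow> complex" where
  "L \<kappa> k w = Ln (w - \<kappa>) + 2 * of_real pi * \<i> * of_int k"

primrec g_approx :: "complex \<Rightarrow> nat \<Rightarrow> address \<times> real \<Rightarrow> complex" where
  "g_approx \<kappa> 0 p = Z p"
| "g_approx \<kappa> (Suc k) p = L \<kappa> (fst p 0) (g_approx \<kappa> k (model_map p))"

(* The limit on Y; meaningful only there. *)
definition g_limit :: "complex \<Rightarrow> address \<times> real \<Rightarrow> complex" where
  "g_limit \<kappa> p = lim (\<lambda>k. g_approx \<kappa> k p)"

(* g is the extension of the limit map from Y \<inter> X, as a partial map: None off its domain.
   When \<kappa> escapes, the domain and g are determined jointly, through the point of X
   that g maps to \<kappa>. *)
definition is_g_extension :: "complex \<Rightarrow> (address \<times> real \<rightharpoonup> complex) \<Rightarrow> bool" where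
  "is_g_extension \<kappa> g \<longleftrightarrow>
     (\<forall>p \<in> Y \<kappa> \<inter> X. g p = Some (g_limit \<kappa> p)) \<and>
     (\<forall>p w. g p = Some w \<longrightarrow> g (model_map p) = Some (E \<kappa> w)) \<and>
     (\<forall>s. continuous_on {t. (s, t) \<in> dom g} (\<lambda>t. the (g (s, t)))) \<and>
     (if \<kappa> \<notin> escaping_set \<kappa> then dom g = X
      else \<exists>s0 t0. (s0, t0) \<in> X \<and> g (s0, t0) = Some \<kappa> \<and>
             dom g = X - {p. \<exists>n \<ge> 1. \<exists>t' \<le> t0. (model_map ^^ n) p = (s0, t')})"

definition g_map :: "complex \<Rightarrow> (address \<times> real \<rightharpoonup> complex)" where
  "g_map \<kappa> = (THE g. is_g_extension \<kappa> g)"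

(* Parameter rays, for s exponentially bounded and t > t_min s; there the \<kappa> exists and is
   unique by a theorem of Foerster and Schleicher. *)
definition G :: "address \<times> real \<Rightarrow> complex" where
  "G p = (THE \<kappa>. g_map \<kappa> p = Some \<kappa>)"

definition Z_eps :: "real \<Rightarrow> (address \<times> real) set" where
  "Z_eps \<epsilon> = {(s, t). exp_bounded s \<and> ereal t \<ge> t_min s + ereal \<epsilon>}"

end

theory Submission
  imports Defs "HOL-Complex_Analysis.Complex_Analysis"
begin

text \<open>On the set \<open>Deep d\<close> of points lying at least \<open>d\<close> above the bottom of their fibre, heights grow at a
  uniform rate, so after a fixed number of steps every point enters the region where \<open>g\<close> is a uniform
  limit. Pulling back from there shows that \<open>g\<close> is continuous jointly in the parameter and the model
  point, and holomorphic in the parameter.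

  Parameters \<open>\<kappa>\<close> with \<open>g\<^sup>\<kappa>(s, t) = \<kappa>\<close> are bounded in terms of \<open>t\<close> and the first entry of \<open>s\<close>: an argument
  of Hopf type bounds the winding of the ray through the singular value, so the orbit of a large \<open>\<kappa>\<close>
  either grows too fast for the height \<open>t\<close>, or comes so far to the left that \<open>\<kappa>\<close> cannot escape. By
  Rouche's theorem the number of such parameters is then independent of \<open>t\<close>, and it is 1 for large \<open>t\<close>.

  Boundedness and uniqueness give continuity of \<open>G\<close>. Conversely, if \<open>G p'\<close> is close to \<open>G p\<close>, so are finitely
  many iterates of the singular value. Far along the orbit these determine the entries of the address
  and, by contraction under backward iteration, the height; joint continuity of \<open>g\<close> recovers the
  remaining entries one at a time.\<close>

section \<open>The model in terms of heights\<close>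

text \<open>Both \<open>g_map\<close> and \<open>G\<close> are definite descriptions, so a concrete
  extension \<open>gext\<close> is constructed and shown to be the only one. \<open>Deep d\<close>
  replaces \<open>Z_eps\<close> because the model map sends \<open>Deep d\<close> into
  \<open>Deep (F d)\<close>: claims about it are proved by induction on the number of steps until
  the iterate of \<open>d\<close> under \<open>F\<close> exceeds \<open>QK K\<close>. The obstacle
  in each inductive step is that pulling back means taking a logarithm of g - \<kappa>: a ray may
  run into \<kappa>, and the branch is not the principal one in general. Therefore whole half-lines
  of rays are pulled back at once, and the branch is identified far to the right, where g is the
  limit map. The number of parameters could change with t only if solutions collide, run to
  infinity, or leave the domain of g. Multiplicities deal with the first, the bound on parameters
  with the second, and \<open>good_of_late_value\<close> with the third.\<close>

primrec hgt :: "address \<Rightarrow> nat \<Rightarrow> real \<Rightarrow> real" where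
  "hgt s 0 t = t"
| "hgt s (Suc n) t = F (hgt s n t) - 2 * pi * \<bar>real_of_int (s (Suc n))\<bar>"

lemmas hgt_Suc = hgt.simps(2)
declare hgt_Suc [simp del]

lemma hgt_1: "hgt s 1 t = F t - 2 * pi * \<bar>real_of_int (s 1)\<bar>"
  by (simp add: hgt_Suc)

text \<open>The \<open>n\<close>-th iterate of \<open>shift\<close> in closed form, so that nested
  iterates merge by rewriting.\<close>

definition drp :: "nat \<Rightarrow> address \<Rightarrow> address" where
  "drp n s = (\<lambda>k. s (n + k))"

lemma drp_0 [simp]: "drp 0 s = s"
  by (simp add: drp_def)

lemma drp_apply: "drp n s k = s (n + k)"
  by (simp add: drp_def)

lemma drp_at_0 [simp]: "drp n s 0 = s n"
  by (simp add: drp_def)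

lemma drp_drp [simp]: "drp m (drp n s) = drp (n + m) s"
  by (simp add: drp_def fun_eq_iff add.assoc)

lemma shift_eq_drp: "shift s = drp 1 s"
  by (simp add: shift_def drp_def)

lemma model_map_eq: "model_map (s, t) = (drp 1 s, hgt s 1 t)"
  by (simp add: model_map_def shift_eq_drp hgt_Suc)

lemma model_map_funpow: "(model_map ^^ n) (s, t) = (drp n s, hgt s n t)"
proof (induction n)
  case (Suc n)
  have "drp 1 (drp n s) = drp (Suc n) s" "hgt (drp n s) 1 (hgt s n t) = hgt s (Suc n) t"
    by (simp_all add: hgt_Suc drp_def)
  with Suc show ?case by (simp only: funpow.simps o_apply model_map_eq)
qed simp

lemma hgt_drp: "hgt (drp m s) n (hgt s m t) = hgt s (m + n) t"
  by (induction n) (auto simp: hgt_Suc drp_apply)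

lemma hgt_Suc_drp: "hgt (drp 1 s) n (hgt s 1 t) = hgt s (Suc n) t"
  using hgt_drp[of 1 s n t] by simp

section \<open>Growth of heights along an orbit\<close>

lemma F_mono: "a \<le> b \<Longrightarrow> F a \<le> F b"
  by (simp add: F_def)

lemma F_ge_self: "t \<le> F t"
  using exp_ge_add_one_self[of t] unfolding F_def by linarith

text \<open>Superadditivity of \<open>F\<close> on the nonnegative axis: the difference of
  exponentials is \<open>exp a\<close> times \<open>exp (b - a) - 1\<close>, and
  \<open>exp a\<close> is at least 1.\<close>

lemma F_gap:
  assumes "0 \<le> a" "a \<le> b"
  shows "F (b - a) \<le> F b - F a"
proof -
  have "1 * (exp (b - a) - 1) \<le> exp a * (exp (b - a) - 1)"
    using assms by (intro mult_right_mono) auto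
  also have "\<dots> = exp b - exp a"
    by (simp add: algebra_simps flip: exp_add)
  finally show ?thesis by (simp add: F_def)
qed

lemma F_iter_ge_self: "t \<le> (F ^^ n) t"
proof (induction n)
  case (Suc n)
  then show ?case using F_ge_self[of "(F ^^ n) t"] by simp
qed simp

lemma F_iter_step: "(F ^^ n) t \<le> (F ^^ Suc n) t"
  by (simp add: F_ge_self)

lemma F_iter_le: "m \<le> n \<Longrightarrow> (F ^^ m) t \<le> (F ^^ n) t"
  by (rule lift_Suc_mono_le[of "\<lambda>n. (F ^^ n) t"]) (use F_iter_step in auto)

lemma F_quadratic:
  assumes "0 \<le> t"
  shows "t + t\<^sup>2 / 2 \<le> F t"
  using exp_lower_Taylor_quadratic[OF assms] by (simp add: F_def)

text \<open>The fixed point 0 of \<open>F\<close> has derivative 1, so no exponential growth is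
  available near it. The quadratic term still gains a fixed amount, half the square of
  \<open>d\<close>, at each step.\<close>

lemma F_iter_at_top:
  assumes "0 < d"
  shows "filterlim (\<lambda>n. (F ^^ n) d) at_top sequentially"
proof -
  have step: "(F ^^ n) d + d\<^sup>2 / 2 \<le> (F ^^ Suc n) d" for n
  proof -
    have "d \<le> (F ^^ n) d" by (rule F_iter_ge_self)
    then have "d\<^sup>2 \<le> ((F ^^ n) d)\<^sup>2"
      using assms by (intro power_mono) auto
    then show ?thesis
      using F_quadratic[of "(F ^^ n) d"] \<open>d \<le> (F ^^ n) d\<close> assms unfolding funpow.simps o_def by linarith
  qed
  have "real n * (d\<^sup>2 / 2) \<le> (F ^^ n) d" for n
  proof (induction n)
    case (Suc n)
    have "real (Suc n) * (d\<^sup>2 / 2) = real n * (d\<^sup>2 / 2) + d\<^sup>2 / 2"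
      by (simp add: algebra_simps)
    then show ?case using Suc step[of n] by linarith
  qed (use assms in simp)
  moreover have "filterlim (\<lambda>n. real n * (d\<^sup>2 / 2)) at_top sequentially"
    using assms by (intro filterlim_at_top_mult_tendsto_pos[OF tendsto_const] filterlim_real_sequentially) auto
  ultimately show ?thesis
    by (auto elim!: filterlim_at_top_mono)
qed

lemma X_bar_iff: "(s, t) \<in> X_bar \<longleftrightarrow> (\<forall>n. 0 \<le> hgt s n t)"
  by (auto simp: X_bar_def model_map_funpow T_def dest: spec[of _ 0])

lemma X_iff: "(s, t) \<in> X \<longleftrightarrow> (s, t) \<in> X_bar \<and> filterlim (\<lambda>n. hgt s n t) at_top sequentially"
  by (simp add: X_def model_map_funpow T_def)

text \<open>The entries of the address cancel in a difference of heights, so \<open>F_gap\<close>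
  can be iterated. All growth estimates that are uniform in the address come from here.\<close>

lemma hgt_gap:
  assumes "(s, a) \<in> X_bar" "a \<le> b"
  shows "(F ^^ n) (b - a) \<le> hgt s n b - hgt s n a"
proof (induction n)
  case (Suc n)
  have "0 \<le> (F ^^ n) (b - a)"
    using F_iter_ge_self[of "b - a" n] assms by linarith
  moreover have "0 \<le> hgt s n a" using assms by (simp add: X_bar_iff)
  ultimately have "F ((F ^^ n) (b - a)) \<le> F (hgt s n b - hgt s n a)" "hgt s n a \<le> hgt s n b"
    using Suc by (auto intro: F_mono)
  then show ?case
    using F_gap[of "hgt s n a" "hgt s n b"] \<open>0 \<le> hgt s n a\<close> by (simp add: hgt_Suc)
qed simp

lemma hgt_mono: "(s, a) \<in> X_bar \<Longrightarrow> a \<le> b \<Longrightarrow> hgt s n a \<le> hgt s n b"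
  using hgt_gap[of s a b n] F_iter_ge_self[of "b - a" n] by linarith

lemma hgt_gap_lin: "(s, a) \<in> X_bar \<Longrightarrow> a \<le> b \<Longrightarrow> hgt s n a + (b - a) \<le> hgt s n b"
  using hgt_gap[of s a b n] F_iter_ge_self[of "b - a" n] by linarith

lemma hgt_le_F_iter: "(s, t) \<in> X_bar \<Longrightarrow> hgt s n t \<le> (F ^^ n) t"
proof (induction n)
  case (Suc n)
  then have "F (hgt s n t) \<le> F ((F ^^ n) t)" by (intro F_mono)
  moreover have "0 \<le> 2 * pi * \<bar>real_of_int (s (Suc n))\<bar>" by simp
  ultimately show ?case unfolding hgt_Suc funpow.simps o_def by linarith
qed simp

lemma X_bar_upward: "(s, a) \<in> X_bar \<Longrightarrow> a \<le> b \<Longrightarrow> (s, b) \<in> X_bar"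
  using order_trans[OF _ hgt_mono[of s a b]] by (simp add: X_bar_iff)

lemma X_bar_drp: "(s, t) \<in> X_bar \<Longrightarrow> (drp n s, hgt s n t) \<in> X_bar"
  by (simp add: X_bar_iff hgt_drp)

lemma X_subset_X_bar: "p \<in> X \<Longrightarrow> p \<in> X_bar"
  by (simp add: X_def)

lemma X_upward:
  assumes "(s, a) \<in> X" "a \<le> b"
  shows "(s, b) \<in> X"
proof -
  have a: "(s, a) \<in> X_bar" and l: "filterlim (\<lambda>n. hgt s n a) at_top sequentially"
    using assms by (auto simp: X_iff)
  have "filterlim (\<lambda>n. hgt s n b) at_top sequentially"
    by (rule filterlim_at_top_mono[OF l]) (use hgt_mono[OF a assms(2)] in auto)
  then show ?thesis using X_bar_upward[OF a assms(2)] by (simp add: X_iff)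
qed

lemma X_drp: "(s, t) \<in> X \<Longrightarrow> (drp n s, hgt s n t) \<in> X"
  using X_bar_drp[of s t n] filterlim_compose[OF _ filterlim_add_const_nat_at_top, of "\<lambda>m. hgt s m t" at_top n]
  by (simp add: X_iff hgt_drp add.commute)

lemma continuous_on_hgt [continuous_intros]:
  "continuous_on A f \<Longrightarrow> continuous_on A (\<lambda>x. hgt s n (f x))"
  by (induction n) (auto simp: F_def hgt_Suc intro!: continuous_intros)

section \<open>Points whose heights never fall below a threshold\<close>

definition Tall :: "real \<Rightarrow> address \<Rightarrow> real \<Rightarrow> bool" where
  "Tall q s t \<longleftrightarrow> (\<forall>n. q \<le> hgt s n t)"

lemma Tall_drp: "Tall q s t \<Longrightarrow> Tall q (drp n s) (hgt s n t)"
  by (simp add: Tall_def hgt_drp)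

lemma Tall_0: "Tall q s t \<Longrightarrow> q \<le> t"
  by (auto simp: Tall_def dest: spec[of _ 0])

lemma Tall_X_bar: "Tall q s t \<Longrightarrow> 0 \<le> q \<Longrightarrow> (s, t) \<in> X_bar"
  unfolding Tall_def X_bar_iff using order_trans by blast

lemma Tall_upward: "Tall q s a \<Longrightarrow> 0 \<le> q \<Longrightarrow> a \<le> b \<Longrightarrow> Tall q s b"
  using order_trans[OF _ hgt_mono[OF Tall_X_bar, of q s a b]] by (simp add: Tall_def)

lemma Tall_large:
  assumes "(s, a) \<in> X_bar" "a \<le> b" "a + q \<le> b"
  shows "Tall q s b"
proof -
  have "q \<le> hgt s n b" for n
    using hgt_gap_lin[OF assms(1,2), of n] assms by (auto simp: X_bar_iff dest: spec[of _ n])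
  then show ?thesis by (simp add: Tall_def)
qed

lemma X_eventually_Tall:
  assumes "(s, t) \<in> X"
  obtains N where "\<And>n. n \<ge> N \<Longrightarrow> Tall q (drp n s) (hgt s n t)"
proof -
  from assms have "eventually (\<lambda>n. q \<le> hgt s n t) sequentially"
    by (simp add: X_iff filterlim_at_top)
  then obtain N where "\<And>n. n \<ge> N \<Longrightarrow> q \<le> hgt s n t"
    by (auto simp: eventually_sequentially)
  then show ?thesis by (intro that[of N]) (auto simp: Tall_def hgt_drp)
qed

text \<open>The points at height at least \<open>d\<close> above some point of \<open>X_bar\<close> with the same address.
  On \<open>Deep d\<close> the heights grow at a uniform rate, which fails for the union over \<open>d > 0\<close>.\<close>

definition Deep :: "real \<Rightarrow> (address \<times> real) set" where
  "Deep d = {(s, t). (s, t - d) \<in> X_bar}"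

lemma Deep_iff: "(s, t) \<in> Deep d \<longleftrightarrow> (s, t - d) \<in> X_bar"
  by (simp add: Deep_def)

lemma Deep_X_bar: "(s, t) \<in> Deep d \<Longrightarrow> 0 \<le> d \<Longrightarrow> (s, t) \<in> X_bar"
  using X_bar_upward[of s "t - d" t] by (simp add: Deep_iff)

lemma Deep_upward: "(s, a) \<in> Deep d \<Longrightarrow> a \<le> b \<Longrightarrow> (s, b) \<in> Deep d"
  using X_bar_upward[of s "a - d" "b - d"] by (simp add: Deep_iff)

lemma Deep_hgt:
  assumes "(s, t) \<in> Deep d" "0 \<le> d"
  shows "hgt s n (t - d) + (F ^^ n) d \<le> hgt s n t" "(F ^^ n) d \<le> hgt s n t"
proof -
  have "0 \<le> hgt s n (t - d)" "(F ^^ n) d \<le> hgt s n t - hgt s n (t - d)"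
    using hgt_gap[of s "t - d" t n] assms by (auto simp: Deep_iff X_bar_iff)
  then show "hgt s n (t - d) + (F ^^ n) d \<le> hgt s n t" "(F ^^ n) d \<le> hgt s n t" by linarith+
qed

lemma Deep_Tall:
  assumes "(s, t) \<in> Deep d" "0 \<le> d" "q \<le> (F ^^ n) d"
  shows "Tall q (drp n s) (hgt s n t)"
  unfolding Tall_def hgt_drp
proof
  fix m
  have "q \<le> (F ^^ (n + m)) d" using assms(3) F_iter_le[of n "n + m" d] by simp
  then show "q \<le> hgt s (n + m) t" using Deep_hgt(2)[OF assms(1,2), of "n + m"] by linarith
qed

lemma Deep_X: "(s, t) \<in> Deep d \<Longrightarrow> 0 < d \<Longrightarrow> (s, t) \<in> X"
  using Deep_X_bar[of s t d] Deep_hgt(2)[of s t d]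
    filterlim_at_top_mono[OF F_iter_at_top[of d], of "\<lambda>n. hgt s n t"]
  by (simp add: X_iff)

text \<open>The gap to the comparison point at height \<open>t - d\<close> grows under one step to
  at least \<open>F d\<close>. This drives the inductions that reduce a claim on
  \<open>Deep d\<close> to tall points.\<close>

lemma Deep_drp:
  assumes "(s, t) \<in> Deep d" "0 \<le> d"
  shows "(drp 1 s, hgt s 1 t) \<in> Deep (F d)"
proof -
  have "hgt s 1 (t - d) \<le> hgt s 1 t - F d"
    using Deep_hgt(1)[OF assms, of 1] by simp
  moreover have "(drp 1 s, hgt s 1 (t - d)) \<in> X_bar"
    using assms X_bar_drp by (simp add: Deep_iff)
  ultimately show ?thesis unfolding Deep_iff by (rule X_bar_upward[rotated])
qed

section \<open>The limit map at large heights\<close>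

lemma geometric_convergence:
  fixes f :: "nat \<Rightarrow> 'a::banach"
  assumes "\<And>k. norm (f (Suc k) - f k) \<le> c / 2 ^ k"
  shows "convergent f" "f \<longlonglongrightarrow> l \<Longrightarrow> norm (f k - l) \<le> 2 * c / 2 ^ k"
proof -
  have c: "0 \<le> c" using order_trans[OF norm_ge_zero assms[of 0]] by simp
  have step: "norm (f (k + m) - f k) \<le> 2 * c / 2 ^ k - 2 * c / 2 ^ (k + m)" for k m
  proof (induction m)
    case (Suc m)
    have "norm (f (k + Suc m) - f k) \<le> norm (f (Suc (k + m)) - f (k + m)) + norm (f (k + m) - f k)"
      using norm_triangle_ineq[of "f (Suc (k + m)) - f (k + m)" "f (k + m) - f k"] by simp
    also have "\<dots> \<le> c / 2 ^ (k + m) + (2 * c / 2 ^ k - 2 * c / 2 ^ (k + m))"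
      using assms[of "k + m"] Suc by linarith
    also have "\<dots> = 2 * c / 2 ^ k - 2 * c / 2 ^ (k + Suc m)"
      by (simp add: field_simps)
    finally show ?case .
  qed simp
  have bound: "norm (f (k + m) - f k) \<le> 2 * c / 2 ^ k" for k m
    using step[of k m] c by (smt (verit) divide_nonneg_pos zero_less_power)
  have "(\<lambda>k. 2 * c * (1/2) ^ k) \<longlonglongrightarrow> 2 * c * 0"
    by (intro tendsto_intros LIMSEQ_realpow_zero) auto
  then have lim0: "(\<lambda>k. 2 * c / 2 ^ k) \<longlonglongrightarrow> 0" by (simp add: power_one_over)
  have "Cauchy f"
  proof (rule CauchyI')
    fix e :: real assume "0 < e"
    with lim0 have "\<forall>\<^sub>F k in sequentially. 2 * c / 2 ^ k < e" by (rule order_tendstoD)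
    then obtain M where M: "\<And>k. k \<ge> M \<Longrightarrow> 2 * c / 2 ^ k < e"
      by (auto simp: eventually_sequentially)
    have "norm (f m - f n) < e" if "m \<ge> M" "m < n" for m n
      using bound[of m "n - m"] M[OF that(1)] that by (simp add: norm_minus_commute)
    then show "\<exists>M. \<forall>m\<ge>M. \<forall>n>m. dist (f m) (f n) < e" unfolding dist_norm by blast
  qed
  then show "convergent f" by (simp add: Cauchy_convergent_iff)
  assume l: "f \<longlonglongrightarrow> l"
  have "(\<lambda>m. norm (f (k + m) - f k)) \<longlonglongrightarrow> norm (l - f k)"
    using LIMSEQ_ignore_initial_segment[OF l, of k]
    by (intro tendsto_intros) (simp add: add.commute)
  then have "norm (l - f k) \<le> 2 * c / 2 ^ k"
    by (rule LIMSEQ_le_const2) (use bound in auto)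
  then show "norm (f k - l) \<le> 2 * c / 2 ^ k" by (simp add: norm_minus_commute)
qed

text \<open>\<open>Q_of\<close> with its constant as an argument. \<open>K_of\<close> is chosen
  separately for each \<kappa>, whereas estimates uniform in \<kappa> need one constant for a whole
  disc of parameters.\<close>

definition QK :: "real \<Rightarrow> real" where
  "QK K = max (ln (4 * (K + pi + 3))) (pi + 2)"

lemma QK_pos: "5 < QK K" "0 \<le> QK K"
  using pi_gt3 by (auto simp: QK_def)

lemma exp_QK: "K > 2 * pi + 6 \<Longrightarrow> QK K \<le> t \<Longrightarrow> 4 * (K + pi + 3) \<le> exp t"
proof -
  assume K: "K > 2 * pi + 6" and t: "QK K \<le> t"
  have "4 * (K + pi + 3) = exp (ln (4 * (K + pi + 3)))" using K pi_gt3 by (intro exp_ln[symmetric] mult_pos_pos) linarith+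
  also have "\<dots> \<le> exp t" using t unfolding exp_le_cancel_iff QK_def by linarith
  finally show ?thesis .
qed

text \<open>With b = 2 pi m, the point T + i b has modulus at least (exp t - 1) / sqrt 2, because T
  + |b| = exp t - 1. Passing to \<open>u - \<kappa>\<close> moves it by at most 3 + K, which is at
  most a quarter of exp t. So the modulus changes by a factor below e and the real part is at least
  - exp t / 4, which keeps the argument within 3 pi / 4. The radius 3 reproduces itself since 1 +
  2.4^2 < 9. That 3 pi / 4 lies below pi is what later makes the entries of the address readable
  from imaginary parts.\<close>

lemma log_step:
  fixes T t K :: real and m :: int and \<kappa> u :: complex
  assumes K: "K > 2 * pi + 6" "norm \<kappa> \<le> K" and T: "0 \<le> T"
    and t: "exp t = T + 2 * pi * \<bar>real_of_int m\<bar> + 1" "4 * (K + pi + 3) \<le> exp t"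
    and u: "norm (u - (of_real T + 2 * of_real pi * \<i> * of_int m)) \<le> 3"
  shows "u - \<kappa> \<notin> \<real>\<^sub>\<le>\<^sub>0" "11/25 * exp t \<le> norm (u - \<kappa>)"
    "\<bar>Im (Ln (u - \<kappa>))\<bar> \<le> 3 * pi / 4" "norm (Ln (u - \<kappa>) - of_real t) \<le> 3"
proof -
  define w b e where "w = u - \<kappa>" and "b = 2 * pi * real_of_int m" and "e = exp t"
  have e: "e = T + \<bar>b\<bar> + 1" using t by (simp add: e_def b_def abs_mult)
  have e72: "e > 72" using t K pi_gt3 by (simp add: e_def)
  have uz: "norm (u - Complex T b) \<le> 3"
    using u by (simp add: b_def Complex_eq mult_ac)
  have "norm (w - Complex T b) \<le> 3 + K"
    using norm_triangle_ineq4[of "u - Complex T b" \<kappa>] uz K by (simp add: w_def algebra_simps)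
  also have "\<dots> \<le> e / 4" using t pi_gt3 by (simp add: e_def)
  finally have wz: "norm (w - Complex T b) \<le> e / 4" .
  have "\<bar>Re w - T\<bar> \<le> e / 4" using abs_Re_le_cmod[of "w - Complex T b"] wz by simp
  then have Rew: "- (e / 4) \<le> Re w" and Rew2: "Re w \<le> T + e / 4" using T unfolding abs_le_iff by linarith+
  have "norm (Complex T b) \<le> \<bar>T\<bar> + \<bar>b\<bar>" using cmod_le[of "Complex T b"] by simp
  then have upper: "norm w \<le> 5/4 * e"
    using norm_triangle_ineq[of "w - Complex T b" "Complex T b"] wz e T by simp
  \<comment> \<open>Because \<open>e\<close> exceeds 72, \<open>69/100 * e\<close> is still below (e
    - 1) / sqrt 2; subtracting the deviation \<open>e / 4\<close> then leaves
    \<open>11/25 * e\<close>.\<close>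
  have "(69/100 * e)\<^sup>2 \<le> (e - 1)\<^sup>2 / 2"
  proof -
    have "(69/100 * e) * sqrt 2 \<le> (69/100 * e) * (1415/1000)"
      using e72 by (intro mult_left_mono real_le_lsqrt) (auto simp: power2_eq_square)
    also have "\<dots> \<le> e - 1" using e72 by simp
    finally have "((69/100 * e) * sqrt 2)\<^sup>2 \<le> (e - 1)\<^sup>2"
      using e72 by (intro power_mono) auto
    then show ?thesis unfolding power_mult_distrib by simp
  qed
  also have "(e - 1)\<^sup>2 / 2 \<le> T\<^sup>2 + b\<^sup>2"
  proof -
    have "(T + \<bar>b\<bar>)\<^sup>2 + (T - \<bar>b\<bar>)\<^sup>2 = 2 * (T\<^sup>2 + b\<^sup>2)" by (simp add: power2_eq_square algebra_simps)
    then have "(T + \<bar>b\<bar>)\<^sup>2 \<le> 2 * (T\<^sup>2 + b\<^sup>2)"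
      using zero_le_power2[of "T - \<bar>b\<bar>"] by linarith
    then show ?thesis by (simp add: e)
  qed
  finally have "69/100 * e \<le> sqrt (T\<^sup>2 + b\<^sup>2)" by (rule real_le_rsqrt)
  then have "69/100 * e \<le> norm (Complex T b)" by (simp add: cmod_def)
  then have lower: "11/25 * e \<le> norm w"
    using norm_triangle_ineq2[of "Complex T b" "Complex T b - w"] wz
    by (simp add: norm_minus_commute)
  have w0: "w \<noteq> 0" using lower e72 by auto
  show "u - \<kappa> \<notin> \<real>\<^sub>\<le>\<^sub>0"
  proof
    assume "u - \<kappa> \<in> \<real>\<^sub>\<le>\<^sub>0"
    then have "norm w = \<bar>Re w\<bar>" "Re w \<le> 0"
      by (auto simp: w_def complex_nonpos_Reals_iff cmod_eq_Re)
    then show False using Rew lower e72 by simp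
  qed
  show "11/25 * exp t \<le> norm (u - \<kappa>)" using lower by (simp add: w_def e_def)
  have ReLn: "Re (Ln w) = ln (norm w)" using w0 by simp
  have ImLn: "\<bar>Im (Ln w)\<bar> \<le> 3 * pi / 4"
  proof (rule ccontr)
    assume a: "\<not> ?thesis"
    have "\<bar>Im (Ln w)\<bar> \<le> pi"
      using Im_Ln_le_pi[OF w0] mpi_less_Im_Ln[OF w0] by simp
    then have "cos \<bar>Im (Ln w)\<bar> < cos (3 * pi / 4)"
      using a pi_gt_zero by (intro cos_monotone_0_pi) auto
    moreover have "cos (3 * pi / 4) = - (sqrt 2 / 2)"
      using cos_pi_minus[of "pi/4"] by (simp add: cos_45 field_simps)
    moreover have "7/10 \<le> sqrt 2 / 2" using real_le_rsqrt[of "14/10" 2] by (simp add: power2_eq_square)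
    ultimately have c: "cos (Im (Ln w)) \<le> - 7/10" by simp
    have "Re (exp (Ln w)) = norm w * cos (Im (Ln w))"
      using w0 unfolding Re_exp ReLn by simp
    then have "Re w = norm w * cos (Im (Ln w))" using w0 by simp
    also have "\<dots> \<le> norm w * (-7/10)" using c by (intro mult_left_mono) auto
    finally show False using Rew lower e72 by simp
  qed
  then show "\<bar>Im (Ln (u - \<kappa>))\<bar> \<le> 3 * pi / 4" by (simp add: w_def)
  have "\<bar>Re (Ln w) - t\<bar> \<le> 1"
  proof -
    have e0: "exp (-1) \<le> (11/25::real)" "(5/4::real) \<le> exp 1"
      using exp_ge_add_one_self[of "1::real"] exp_lower_Taylor_quadratic[of "1::real"]
      by (auto simp: exp_minus field_simps)
    have "exp (t - 1) = e * exp (-1)" "exp (t + 1) = e * exp 1"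
      by (simp_all add: e_def flip: exp_add)
    moreover have "e * exp (-1) \<le> e * (11/25)" "e * (5/4) \<le> e * exp 1"
      using e72 by (intro mult_left_mono e0; simp)+
    ultimately have "exp (t - 1) \<le> norm w" "norm w \<le> exp (t + 1)"
      using lower upper by linarith+
    moreover from this have "ln (norm w) \<le> ln (exp (t + 1))"
      using w0 by (intro ln_mono) auto
    ultimately have "t - 1 \<le> ln (norm w)" "ln (norm w) \<le> t + 1"
      using w0 by (simp_all add: ln_ge_iff)
    then show ?thesis unfolding ReLn by simp
  qed
  moreover have "\<bar>Im (Ln w)\<bar> \<le> 24/10" using ImLn pi_approx by simp
  ultimately have "(Re (Ln w) - t)\<^sup>2 \<le> 1\<^sup>2" "(Im (Ln w))\<^sup>2 \<le> (24/10)\<^sup>2"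
    unfolding abs_le_square_iff[symmetric] by simp_all
  then have "norm (Ln w - of_real t) \<le> 3"
    unfolding cmod_def by (intro real_le_lsqrt) (auto simp: power2_eq_square)
  then show "norm (Ln (u - \<kappa>) - of_real t) \<le> 3" by (simp add: w_def)
qed

text \<open>The derivative of the logarithm is the inverse of \<open>w - \<kappa>\<close>, and by
  \<open>log_step\<close> its modulus is at most 1/2 on the convex disc of radius 3.\<close>

lemma log_step_contract:
  fixes T t K :: real and m :: int and \<kappa> u v :: complex
  assumes K: "K > 2 * pi + 6" "norm \<kappa> \<le> K" and T: "0 \<le> T"
    and t: "exp t = T + 2 * pi * \<bar>real_of_int m\<bar> + 1" "4 * (K + pi + 3) \<le> exp t"
    and u: "norm (u - (of_real T + 2 * of_real pi * \<i> * of_int m)) \<le> 3"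
    and v: "norm (v - (of_real T + 2 * of_real pi * \<i> * of_int m)) \<le> 3"
  shows "norm (Ln (u - \<kappa>) - Ln (v - \<kappa>)) \<le> norm (u - v) / 2"
proof -
  define c where "c = of_real T + 2 * of_real pi * \<i> * of_int m"
  have w: "w - \<kappa> \<notin> \<real>\<^sub>\<le>\<^sub>0" "2 \<le> norm (w - \<kappa>)" if "w \<in> cball c 3" for w
    using log_step[OF K T t, of w] that t K pi_gt3
    by (auto simp: c_def dist_norm norm_minus_commute)
  have "norm (Ln (u - \<kappa>) - Ln (v - \<kappa>)) \<le> 1/2 * norm (u - v)"
  proof (rule field_differentiable_bound[where S = "cball c 3" and f' = "\<lambda>w. inverse (w - \<kappa>)"])
    fix w assume "w \<in> cball c 3"
    note w = w[OF this]
    then show "((\<lambda>w. Ln (w - \<kappa>)) has_field_derivative inverse (w - \<kappa>)) (at w within cball c 3)"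
      by (auto intro!: derivative_eq_intros)
    show "norm (inverse (w - \<kappa>)) \<le> 1/2" using le_imp_inverse_le[OF w(2)] by (simp add: norm_inverse)
  qed (use u v in \<open>auto simp: c_def dist_norm norm_minus_commute\<close>)
  then show ?thesis by simp
qed

lemma Z_eq: "Z (s, t) = of_real t + 2 * of_real pi * \<i> * of_int (s 0)"
  by (simp add: Z_def)

lemma g_approx_Suc:
  "g_approx \<kappa> (Suc k) (s, t) =
     Ln (g_approx \<kappa> k (drp 1 s, hgt s 1 t) - \<kappa>) + 2 * of_real pi * \<i> * of_int (s 0)"
  by (simp add: L_def model_map_eq)

abbreviation glim :: "complex \<Rightarrow> address \<Rightarrow> real \<Rightarrow> complex" where
  "glim \<kappa> s t \<equiv> g_limit \<kappa> (s, t)"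

lemma exp_hgt: "exp (hgt s n t) = hgt s (Suc n) t + 2 * pi * \<bar>real_of_int (s (Suc n))\<bar> + 1"
  by (simp add: hgt_Suc F_def)

lemma exp_hgt_1: "exp t = hgt s 1 t + 2 * pi * \<bar>real_of_int (s 1)\<bar> + 1"
  using exp_hgt[of s 0 t] by simp

lemma Tall_step:
  assumes "K > 2 * pi + 6" "Tall (QK K) s t"
  shows "Tall (QK K) (drp 1 s) (hgt s 1 t)" "0 \<le> hgt s 1 t" "4 * (K + pi + 3) \<le> exp t"
  using assms Tall_drp[of "QK K" s t 1] exp_QK[of K t] QK_pos[of K]
  by (auto simp: Tall_def dest: spec[of _ 0] spec[of _ 1])

context
  fixes K :: real and \<kappa> :: complex
  assumes K: "K > 2 * pi + 6" "norm \<kappa> \<le> K"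
begin

lemma approx_Z: "Tall (QK K) s t \<Longrightarrow> norm (g_approx \<kappa> k (s, t) - Z (s, t)) \<le> 3"
proof (induction k arbitrary: s t)
  case (Suc k)
  note step = Tall_step[OF K(1) Suc.prems]
  show ?case
    using log_step(4)[OF K step(2) exp_hgt_1 step(3)] Suc.IH[OF step(1)]
    by (simp add: g_approx_Suc Z_eq del: g_approx.simps)
qed simp

lemma approx_diff:
  "Tall (QK K) s t \<Longrightarrow> norm (g_approx \<kappa> (Suc k) (s, t) - g_approx \<kappa> k (s, t)) \<le> 3 / 2 ^ k"
proof (induction k arbitrary: s t)
  case 0
  then show ?case using approx_Z[of s t 1] by simp
next
  case (Suc k)
  note step = Tall_step[OF K(1) Suc.prems]
  have "norm (g_approx \<kappa> (Suc (Suc k)) (s, t) - g_approx \<kappa> (Suc k) (s, t))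
    \<le> norm (g_approx \<kappa> (Suc k) (drp 1 s, hgt s 1 t) - g_approx \<kappa> k (drp 1 s, hgt s 1 t)) / 2"
    using log_step_contract[OF K step(2) exp_hgt_1 step(3)] approx_Z[OF step(1)]
    unfolding g_approx_Suc[of _ "Suc k"] g_approx_Suc[of _ k s t] by (simp add: Z_eq del: g_approx.simps)
  also have "\<dots> \<le> (3 / 2 ^ k) / 2" using Suc.IH[OF step(1)] by (intro divide_right_mono) auto
  finally show ?case by simp
qed

lemma glim_tendsto: "Tall (QK K) s t \<Longrightarrow> (\<lambda>k. g_approx \<kappa> k (s, t)) \<longlonglongrightarrow> glim \<kappa> s t"
  using geometric_convergence(1)[of "\<lambda>k. g_approx \<kappa> k (s, t)" 3, OF approx_diff]
  by (simp add: g_limit_def convergent_LIMSEQ_iff)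

text \<open>The rate depends only on \<open>k\<close>, neither on the parameter nor on the model
  point; \<open>glim_tendsto_joint\<close> and \<open>glim_holomorphic\<close> both rest on this
  uniformity.\<close>

lemma glim_err: "Tall (QK K) s t \<Longrightarrow> norm (g_approx \<kappa> k (s, t) - glim \<kappa> s t) \<le> 6 / 2 ^ k"
  using geometric_convergence(2)[of "\<lambda>k. g_approx \<kappa> k (s, t)" 3, OF approx_diff glim_tendsto] by simp

lemma glim_Z: "Tall (QK K) s t \<Longrightarrow> norm (glim \<kappa> s t - Z (s, t)) \<le> 3"
  by (rule LIMSEQ_le_const2[OF tendsto_norm[OF tendsto_diff[OF glim_tendsto tendsto_const]]])
    (use approx_Z in auto)

lemma glim_slit: "Tall (QK K) s t \<Longrightarrow> glim \<kappa> (drp 1 s) (hgt s 1 t) - \<kappa> \<notin> \<real>\<^sub>\<le>\<^sub>0"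
  using Tall_step[OF K(1)] glim_Z[of "drp 1 s" "hgt s 1 t"]
  by (intro log_step(1)[OF K _ exp_hgt_1]) (auto simp: Z_eq)

lemma glim_eq:
  assumes "Tall (QK K) s t"
  shows "glim \<kappa> s t = Ln (glim \<kappa> (drp 1 s) (hgt s 1 t) - \<kappa>) + 2 * of_real pi * \<i> * of_int (s 0)"
proof (rule LIMSEQ_unique)
  show "(\<lambda>k. g_approx \<kappa> (Suc k) (s, t)) \<longlonglongrightarrow> glim \<kappa> s t"
    using glim_tendsto[OF assms] by (rule LIMSEQ_Suc)
  show "(\<lambda>k. g_approx \<kappa> (Suc k) (s, t)) \<longlonglongrightarrow>
      Ln (glim \<kappa> (drp 1 s) (hgt s 1 t) - \<kappa>) + 2 * of_real pi * \<i> * of_int (s 0)"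
    unfolding g_approx_Suc
    by (intro tendsto_intros glim_tendsto Tall_step(1)[OF K(1)] glim_slit assms)
qed

lemma glim_exp:
  assumes "Tall (QK K) s t"
  shows "exp (glim \<kappa> s t) = glim \<kappa> (drp 1 s) (hgt s 1 t) - \<kappa>"
proof -
  have "glim \<kappa> (drp 1 s) (hgt s 1 t) - \<kappa> \<noteq> 0" using glim_slit[OF assms] by auto
  moreover have "exp (2 * of_real pi * \<i> * of_int (s 0)) = 1"
    using exp_integer_2pi[of "of_int (s 0)"] by (simp add: mult_ac)
  ultimately show ?thesis unfolding glim_eq[OF assms] by (simp add: exp_add)
qed

lemma glim_Im:
  assumes "Tall (QK K) s t"
  shows "\<bar>Im (glim \<kappa> s t) - 2 * pi * real_of_int (s 0)\<bar> \<le> 3 * pi / 4"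
  using log_step(3)[OF K Tall_step(2)[OF K(1) assms] exp_hgt_1 Tall_step(3)[OF K(1) assms]]
    glim_Z[OF Tall_step(1)[OF K(1) assms]]
  by (simp add: glim_eq[OF assms] Z_eq)

lemma glim_Re:
  assumes "Tall (QK K) s t"
  shows "\<bar>Re (glim \<kappa> s t) - t\<bar> \<le> 3"
  using order_trans[OF abs_Re_le_cmod glim_Z[OF assms]] by (simp add: Z_eq)

end

text \<open>Neither the heights nor the shifted address see the entry \<open>s 0\<close>; it enters
  only through the last summand of \<open>glim_eq\<close>.\<close>

lemma glim_entry:
  assumes "K > 2 * pi + 6" "norm \<kappa> \<le> K" "Tall (QK K) s t"
  shows "glim \<kappa> (s(0 := m)) t = glim \<kappa> s t + 2 * of_real pi * \<i> * of_int (m - s 0)"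
proof -
  have h: "hgt (s(0 := m)) n t = hgt s n t" for n
    by (induction n) (auto simp: hgt_Suc)
  have d: "drp 1 (s(0 := m)) = drp 1 s" by (simp add: drp_def fun_eq_iff)
  have "Tall (QK K) (s(0 := m)) t" using assms(3) by (simp add: Tall_def h)
  from glim_eq[OF assms(1,2) this] glim_eq[OF assms] show ?thesis
    unfolding d h by (simp add: algebra_simps)
qed

text \<open>The type of addresses carries the product topology of discrete spaces, so convergence
  means that each entry is eventually constant. It is stated for filters because the continuity
  arguments below work with filters throughout.\<close>

lemma tendsto_address_iff:
  fixes f :: "'a \<Rightarrow> address"
  shows "(f \<longlongrightarrow> s) Fl \<longleftrightarrow> (\<forall>k. \<forall>\<^sub>F i in Fl. f i k = s k)"
proof
  assume f: "(f \<longlongrightarrow> s) Fl"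
  have "((\<lambda>i. f i k) \<longlongrightarrow> s k) Fl" for k
    by (rule continuous_on_tendsto_compose[OF continuous_on_product_coordinates f]) auto
  then show "\<forall>k. \<forall>\<^sub>F i in Fl. f i k = s k" by (simp add: tendsto_discrete)
next
  assume k: "\<forall>k. \<forall>\<^sub>F i in Fl. f i k = s k"
  show "(f \<longlongrightarrow> s) Fl"
  proof (rule topological_tendstoI)
    fix S assume S: "open S" "s \<in> S"
    have "\<exists>U. s \<in> (\<Pi>\<^sub>E i\<in>UNIV. U i) \<and> (\<forall>i. openin euclidean (U i)) \<and>
        finite {i. U i \<noteq> topspace euclidean} \<and> (\<Pi>\<^sub>E i\<in>UNIV. U i) \<subseteq> S"
      by (rule product_topology_open_contains_basis) (use S in \<open>auto simp: open_fun_def\<close>)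
    then obtain U where U: "s \<in> Pi\<^sub>E UNIV U" "finite {i. U i \<noteq> UNIV}" "Pi\<^sub>E UNIV U \<subseteq> S"
      by auto
    have "\<forall>\<^sub>F i in Fl. \<forall>k\<in>{k. U k \<noteq> UNIV}. f i k = s k"
      using k U(2) by (intro eventually_ball_finite) auto
    then show "\<forall>\<^sub>F i in Fl. f i \<in> S"
    proof eventually_elim
      case (elim i)
      have "f i k \<in> U k" for k using elim U(1) by (cases "U k = UNIV") auto
      then show ?case using U(3) by auto
    qed
  qed
qed

lemma tendsto_drp [tendsto_intros]: "(f \<longlongrightarrow> s) Fl \<Longrightarrow> ((\<lambda>i. drp n (f i)) \<longlongrightarrow> drp n s) Fl"
  by (simp add: tendsto_address_iff drp_apply)

lemma tendsto_hgt [tendsto_intros]: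
  assumes "(sf \<longlongrightarrow> s) Fl" "(tf \<longlongrightarrow> t) Fl"
  shows "((\<lambda>i. hgt (sf i) n (tf i)) \<longlongrightarrow> hgt s n t) Fl"
proof (induction n)
  case (Suc n)
  have "\<forall>\<^sub>F i in Fl. s (Suc n) = sf i (Suc n)"
    by (rule eventually_mono[of "\<lambda>i. sf i (Suc n) = s (Suc n)"])
      (use assms in \<open>auto simp: tendsto_address_iff\<close>)
  then have "((\<lambda>i. real_of_int (sf i (Suc n))) \<longlongrightarrow> real_of_int (s (Suc n))) Fl"
    by (rule tendsto_eventually[OF eventually_mono]) auto
  then show ?case using Suc by (auto simp: hgt_Suc F_def intro!: tendsto_intros)
qed (use assms in simp)

lemma approx_tendsto:
  assumes "K > 2 * pi + 6" "(kf \<longlongrightarrow> \<kappa>) Fl" "norm \<kappa> \<le> K"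
  shows "(sf \<longlongrightarrow> s) Fl \<Longrightarrow> (tf \<longlongrightarrow> t) Fl \<Longrightarrow> Tall (QK K) s t \<Longrightarrow>
    ((\<lambda>i. g_approx (kf i) k (sf i, tf i)) \<longlongrightarrow> g_approx \<kappa> k (s, t)) Fl"
proof (induction k arbitrary: sf tf s t)
  have entry: "((\<lambda>i. of_int (sf i 0) :: complex) \<longlongrightarrow> of_int (s 0)) Fl"
    if "(sf \<longlongrightarrow> s) Fl" for sf :: "'a \<Rightarrow> address" and s
    by (rule tendsto_eventually, rule eventually_mono[of "\<lambda>i. sf i 0 = s 0"])
      (use that in \<open>auto simp: tendsto_address_iff\<close>)
  {
    case 0
    then show ?case unfolding g_approx.simps Z_eq by (intro tendsto_intros entry)
  next
    case (Suc k)
    note step = Tall_step[OF assms(1) Suc.prems(3)]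
    have "g_approx \<kappa> k (drp 1 s, hgt s 1 t) - \<kappa> \<notin> \<real>\<^sub>\<le>\<^sub>0"
      using approx_Z[OF assms(1,3) step(1)]
      by (intro log_step(1)[OF assms(1,3) step(2) exp_hgt_1 step(3)]) (simp add: Z_eq)
    then show ?case unfolding g_approx_Suc
      by (intro tendsto_intros entry Suc assms step(1))
  }
qed

lemma glim_tendsto_joint:
  assumes K: "K > 2 * pi + 6" and kf: "(kf \<longlongrightarrow> \<kappa>) Fl" "norm \<kappa> \<le> K" "\<forall>\<^sub>F i in Fl. norm (kf i) \<le> K"
    and "(sf \<longlongrightarrow> s) Fl" "(tf \<longlongrightarrow> t) Fl" "Tall (QK K) s t" "\<forall>\<^sub>F i in Fl. Tall (QK K) (sf i) (tf i)"
  shows "((\<lambda>i. glim (kf i) (sf i) (tf i)) \<longlongrightarrow> glim \<kappa> s t) Fl"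
proof (rule tendstoI)
  fix e :: real assume e: "0 < e"
  have "(\<lambda>k. 6 * (1/2) ^ k) \<longlonglongrightarrow> 6 * (0::real)"
    by (intro tendsto_intros LIMSEQ_realpow_zero) auto
  then have "\<forall>\<^sub>F k in sequentially. 6 * (1/2) ^ k < e / 3"
    by (rule order_tendstoD) (use e in auto)
  then obtain k where k: "6 / 2 ^ k < e / 3"
    by (auto simp: power_one_over eventually_sequentially)
  have "\<forall>\<^sub>F i in Fl. dist (g_approx (kf i) k (sf i, tf i)) (g_approx \<kappa> k (s, t)) < e / 3"
    using approx_tendsto[OF K kf(1,2) assms(5-7)] e unfolding tendsto_iff by (meson divide_pos_pos zero_less_numeral)
  then show "\<forall>\<^sub>F i in Fl. dist (glim (kf i) (sf i) (tf i)) (glim \<kappa> s t) < e"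
    using kf(3) assms(8)
  proof eventually_elim
    case (elim i)
    have "dist (g_approx (kf i) k (sf i, tf i)) (glim (kf i) (sf i) (tf i)) < e / 3"
      "dist (g_approx \<kappa> k (s, t)) (glim \<kappa> s t) < e / 3"
      using glim_err[OF K elim(2,3), of k] glim_err[OF K kf(2) assms(7), of k] k by (auto simp: dist_norm)
    with elim(1) show ?case
      using dist_triangle3[of "glim (kf i) (sf i) (tf i)" "g_approx \<kappa> k (s, t)" "g_approx (kf i) k (sf i, tf i)"]
        dist_triangle[of "glim (kf i) (sf i) (tf i)" "glim \<kappa> s t" "g_approx \<kappa> k (s, t)"] by linarith
  qed
qed

lemma glim_holomorphic:
  assumes K: "K > 2 * pi + 6" and "Tall (QK K) s t"
  shows "(\<lambda>\<kappa>. glim \<kappa> s t) holomorphic_on ball 0 K"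
proof -
  have "\<not> trivial_limit sequentially" by simp
  have hol: "(\<lambda>\<kappa>. g_approx \<kappa> k (s, t)) holomorphic_on cball 0 K" if "Tall (QK K) s t" for k s t
    using that
  proof (induction k arbitrary: s t)
    case (Suc k)
    note step = Tall_step[OF K Suc.prems]
    have "g_approx \<kappa> k (drp 1 s, hgt s 1 t) - \<kappa> \<notin> \<real>\<^sub>\<le>\<^sub>0" if "norm \<kappa> \<le> K" for \<kappa>
      using approx_Z[OF K that step(1)]
      by (intro log_step(1)[OF K that step(2) exp_hgt_1 step(3)]) (simp add: Z_eq)
    then show ?case unfolding g_approx_Suc
      by (intro holomorphic_intros Suc.IH[OF step(1)]) auto
  qed simp
  have "uniform_limit (cball 0 K) (\<lambda>k \<kappa>. g_approx \<kappa> k (s, t)) (\<lambda>\<kappa>. glim \<kappa> s t) sequentially"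
  proof (rule uniform_limitI)
    fix e :: real assume e: "0 < e"
    have "(\<lambda>k. 6 * (1/2) ^ k) \<longlonglongrightarrow> 6 * (0::real)"
      by (intro tendsto_intros LIMSEQ_realpow_zero) auto
    then have "\<forall>\<^sub>F k in sequentially. 6 * (1/2) ^ k < e"
      by (rule order_tendstoD) (use e in auto)
    then show "\<forall>\<^sub>F k in sequentially. \<forall>\<kappa>\<in>cball 0 K. dist (g_approx \<kappa> k (s, t)) (glim \<kappa> s t) < e"
    proof eventually_elim
      case (elim k)
      then have "6 / 2 ^ k < e" by (simp add: power_one_over)
      then have "norm (g_approx \<kappa> k (s, t) - glim \<kappa> s t) < e" if "norm \<kappa> \<le> K" for \<kappa>
        using glim_err[OF K that assms(2), of k] by linarith
      then show ?case by (simp add: dist_norm)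
    qed
  qed
  from holomorphic_uniform_limit[OF _ this] show ?thesis
    using hol[OF assms(2)] holomorphic_on_imp_continuous_on holomorphic_on_subset[OF _ ball_subset_cball]
    by (metis (mono_tags, lifting) always_eventually sequentially_bot)
qed

section \<open>Dynamic rays\<close>

lemma exp_2pi_int: "exp (2 * of_real pi * \<i> * of_int m :: complex) = 1"
  using exp_integer_2pi[of "of_int m"] by (simp add: mult_ac)

text \<open>The difference of the two lifts is continuous and takes values in the integer multiples
  of 2 pi i, which are at least 2 pi apart.\<close>

lemma exp_lifts:
  fixes f g :: "'a::topological_space \<Rightarrow> complex"
  assumes "connected S" "continuous_on S f" "continuous_on S g" "\<And>x. x \<in> S \<Longrightarrow> exp (f x) = exp (g x)"
  obtains m :: int where "\<And>x. x \<in> S \<Longrightarrow> f x = g x + 2 * of_real pi * \<i> * of_int m"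
proof -
  have int: "\<exists>m::int. f x = g x + 2 * of_real pi * \<i> * of_int m" if "x \<in> S" for x
  proof -
    obtain m :: int where "f x = g x + of_real (of_int (2 * m) * pi) * \<i>"
      using assms(4)[OF \<open>x \<in> S\<close>] unfolding exp_eq by blast
    then show ?thesis by (intro exI[of _ m]) (simp add: mult_ac)
  qed
  have "(\<lambda>x. f x - g x) constant_on S"
  proof (rule continuous_discrete_range_constant[OF assms(1)])
    show "continuous_on S (\<lambda>x. f x - g x)" by (intro continuous_intros assms)
    fix x assume "x \<in> S"
    have "2 * pi \<le> norm ((f y - g y) - (f x - g x))" if "y \<in> S" "f y - g y \<noteq> f x - g x" for y
    proof -
      obtain m n where mn: "f x = g x + 2 * of_real pi * \<i> * of_int m" "f y = g y + 2 * of_real pi * \<i> * of_int n"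
        using int \<open>x \<in> S\<close> \<open>y \<in> S\<close> by blast
      have "(f y - g y) - (f x - g x) = 2 * of_real pi * \<i> * of_int (n - m)"
        by (simp add: mn algebra_simps)
      moreover have "n \<noteq> m" using that mn by auto
      then have "1 \<le> \<bar>real_of_int (n - m)\<bar>" by linarith
      then have "2 * pi * 1 \<le> 2 * pi * \<bar>real_of_int (n - m)\<bar>" by (intro mult_left_mono) auto
      ultimately show ?thesis by (simp add: norm_mult del: of_int_diff)
    qed
    then show "\<exists>e>0. \<forall>y. y \<in> S \<and> f y - g y \<noteq> f x - g x \<longrightarrow> e \<le> norm ((f y - g y) - (f x - g x))"
      by (intro exI[of _ "2 * pi"]) auto
  qed
  then obtain c where c: "\<And>x. x \<in> S \<Longrightarrow> f x - g x = c" by (auto simp: constant_on_def)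
  show ?thesis
  proof (cases "S = {}")
    case True
    then show ?thesis using that by auto
  next
    case False
    then obtain x where x: "x \<in> S" by auto
    obtain m where m: "f x = g x + 2 * of_real pi * \<i> * of_int m" using int[OF x] by blast
    show ?thesis by (rule that[of m]) (use c[OF x] c m in \<open>auto simp: algebra_simps\<close>)
  qed
qed

lemma exp_lift_unique:
  fixes f g :: "'a::topological_space \<Rightarrow> complex"
  assumes "connected S" "continuous_on S f" "continuous_on S g" "\<And>x. x \<in> S \<Longrightarrow> exp (f x) = exp (g x)"
    "b \<in> S" "f b = g b" "x \<in> S"
  shows "f x = g x"
proof -
  obtain m :: int where m: "\<And>x. x \<in> S \<Longrightarrow> f x = g x + 2 * of_real pi * \<i> * of_int m"
    using exp_lifts[OF assms(1-4)] by blast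
  from m[OF assms(5)] assms(6) have "m = 0" by simp
  with m[OF assms(7)] show ?thesis by simp
qed

lemma K_of: "K_of \<kappa> > 2 * pi + 6" "norm \<kappa> \<le> K_of \<kappa>"
proof -
  have "\<exists>K. K > 2 * pi + 6 \<and> norm \<kappa> \<le> K"
    by (intro exI[of _ "max (2 * pi + 7) (norm \<kappa>)"]) auto
  from someI_ex[OF this] show "K_of \<kappa> > 2 * pi + 6" "norm \<kappa> \<le> K_of \<kappa>"
    by (auto simp: K_of_def)
qed

lemma Q_of_eq: "Q_of \<kappa> = QK (K_of \<kappa>)"
  by (simp add: Q_of_def QK_def)

text \<open>\<open>\<gamma> n x\<close> is the value of \<open>g\<close> at the \<open>n\<close>-th iterate of the model point \<open>(s, x)\<close>,
  so a ray records a whole tail of a dynamic ray with all its forward images.\<close>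

definition ray :: "complex \<Rightarrow> address \<Rightarrow> real \<Rightarrow> (nat \<Rightarrow> real \<Rightarrow> complex) \<Rightarrow> bool" where
  "ray \<kappa> s t \<gamma> \<longleftrightarrow> (s, t) \<in> X \<and> (\<forall>n. continuous_on {t..} (\<gamma> n)) \<and>
     (\<forall>n. \<forall>x\<ge>t. exp (\<gamma> n x) = \<gamma> (Suc n) x - \<kappa>) \<and>
     (\<exists>N. \<forall>n\<ge>N. \<forall>x\<ge>t. \<gamma> n x = glim \<kappa> (drp n s) (hgt s n x)) \<and>
     (\<forall>n. \<exists>b. \<forall>x\<ge>b. \<gamma> n x = glim \<kappa> (drp n s) (hgt s n x))"

lemma rayD:
  assumes "ray \<kappa> s t \<gamma>"
  shows "(s, t) \<in> X" "continuous_on {t..} (\<gamma> n)" "x \<ge> t \<Longrightarrow> exp (\<gamma> n x) = \<gamma> (Suc n) x - \<kappa>"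
    "\<exists>N. \<forall>n\<ge>N. \<forall>x\<ge>t. \<gamma> n x = glim \<kappa> (drp n s) (hgt s n x)"
    "\<exists>b. \<forall>x\<ge>b. \<gamma> n x = glim \<kappa> (drp n s) (hgt s n x)"
  using assms by (auto simp: ray_def)

lemma ray_Suc: "ray \<kappa> s t \<gamma> \<Longrightarrow> x \<ge> t \<Longrightarrow> \<gamma> (Suc n) x = E \<kappa> (\<gamma> n x)"
  by (simp add: rayD(3) E_def)

lemma ray_funpow: "ray \<kappa> s t \<gamma> \<Longrightarrow> x \<ge> t \<Longrightarrow> \<gamma> (m + n) x = (E \<kappa> ^^ m) (\<gamma> n x)"
  by (induction m) (simp_all add: ray_Suc)

lemma ray_restrict: "ray \<kappa> s t \<gamma> \<Longrightarrow> t \<le> t' \<Longrightarrow> ray \<kappa> s t' \<gamma>"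
proof -
  assume r: "ray \<kappa> s t \<gamma>" and tt: "t \<le> t'"
  then have ge: "x \<ge> t" if "x \<ge> t'" for x using that by simp
  have "continuous_on {t'..} (\<gamma> n)" for n
    by (rule continuous_on_subset[OF rayD(2)[OF r]]) (use tt in auto)
  moreover obtain N where "\<And>n x. n \<ge> N \<Longrightarrow> x \<ge> t \<Longrightarrow> \<gamma> n x = glim \<kappa> (drp n s) (hgt s n x)"
    using rayD(4)[OF r] by blast
  then have "\<exists>N. \<forall>n\<ge>N. \<forall>x\<ge>t'. \<gamma> n x = glim \<kappa> (drp n s) (hgt s n x)"
    using ge by blast
  ultimately show "ray \<kappa> s t' \<gamma>"
    unfolding ray_def using X_upward[OF rayD(1)[OF r] tt] rayD(3)[OF r ge] rayD(5)[OF r] by blast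
qed

text \<open>Both rays equal the limit map at all late levels. Going down one level, the two curves
  are lifts of the same curve under \<open>exp\<close> and agree far to the right, so they agree on
  the whole half-line.\<close>

lemma ray_unique:
  assumes "ray \<kappa> s t \<gamma>" "ray \<kappa> s t \<gamma>'" "x \<ge> t"
  shows "\<gamma> n x = \<gamma>' n x"
proof -
  obtain N1 N2 where "\<And>n x. n \<ge> N1 \<Longrightarrow> x \<ge> t \<Longrightarrow> \<gamma> n x = glim \<kappa> (drp n s) (hgt s n x)"
    "\<And>n x. n \<ge> N2 \<Longrightarrow> x \<ge> t \<Longrightarrow> \<gamma>' n x = glim \<kappa> (drp n s) (hgt s n x)"
    using rayD(4)[OF assms(1)] rayD(4)[OF assms(2)] by blast
  then have N: "\<gamma> n x = \<gamma>' n x" if "n \<ge> max N1 N2" "x \<ge> t" for n x using that by simp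
  have "\<forall>x\<ge>t. \<gamma> n x = \<gamma>' n x" if "n \<le> max N1 N2"
    using that
  proof (induction rule: inc_induct)
    case (step n)
    obtain b1 b2 where b: "\<And>x. x \<ge> b1 \<Longrightarrow> \<gamma> n x = glim \<kappa> (drp n s) (hgt s n x)"
      "\<And>x. x \<ge> b2 \<Longrightarrow> \<gamma>' n x = glim \<kappa> (drp n s) (hgt s n x)"
      using rayD(5)[OF assms(1)] rayD(5)[OF assms(2)] by blast
    show ?case
    proof (intro allI impI)
      fix x assume "t \<le> x"
      show "\<gamma> n x = \<gamma>' n x"
        by (rule exp_lift_unique[of "{t..}" _ _ "Max {t, b1, b2}"])
          (use assms b step \<open>t \<le> x\<close> in \<open>auto simp: rayD(2,3)\<close>)
    qed
  qed (use N in auto)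
  then show ?thesis using N[of n x] assms(3) by (cases "n \<le> max N1 N2") (blast, linarith)
qed

text \<open>The candidate for \<open>g_map\<close>. By \<open>ray_unique\<close> the chosen ray does
  not influence the value.\<close>

definition gext :: "complex \<Rightarrow> (address \<times> real \<rightharpoonup> complex)" where
  "gext \<kappa> = (\<lambda>(s, t). if \<exists>\<gamma>. ray \<kappa> s t \<gamma> then Some ((SOME \<gamma>. ray \<kappa> s t \<gamma>) 0 t) else None)"

lemma gext_eq: "ray \<kappa> s t \<gamma> \<Longrightarrow> gext \<kappa> (s, t) = Some (\<gamma> 0 t)"
  using ray_unique[OF someI[of "ray \<kappa> s t"], of \<gamma> \<gamma> t 0] by (auto simp: gext_def)

lemma gext_Some_iff: "gext \<kappa> (s, t) = Some w \<longleftrightarrow> (\<exists>\<gamma>. ray \<kappa> s t \<gamma> \<and> \<gamma> 0 t = w)"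
proof
  assume w: "gext \<kappa> (s, t) = Some w"
  then obtain \<gamma> where "ray \<kappa> s t \<gamma>" by (auto simp: gext_def split: if_splits)
  with w gext_eq[OF this] show "\<exists>\<gamma>. ray \<kappa> s t \<gamma> \<and> \<gamma> 0 t = w" by auto
qed (auto simp: gext_eq)

lemma gext_X: "gext \<kappa> (s, t) = Some w \<Longrightarrow> (s, t) \<in> X"
  by (auto simp: gext_Some_iff rayD(1))

lemma ray_glim:
  assumes K: "K > 2 * pi + 6" "norm \<kappa> \<le> K" and T: "Tall (QK K) s t" and X: "(s, t) \<in> X"
  shows "ray \<kappa> s t (\<lambda>n x. glim \<kappa> (drp n s) (hgt s n x))"
proof -
  have tall: "Tall (QK K) (drp n s) (hgt s n x)" if "x \<ge> t" for n x
    using T that QK_pos(2) by (intro Tall_drp Tall_upward[OF T])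
  have "continuous_on {t..} (\<lambda>x. glim \<kappa> (drp n s) (hgt s n x))" for n
    unfolding continuous_on_def
  proof
    fix x assume x: "x \<in> {t..}"
    show "((\<lambda>x. glim \<kappa> (drp n s) (hgt s n x)) \<longlongrightarrow> glim \<kappa> (drp n s) (hgt s n x)) (at x within {t..})"
      by (rule glim_tendsto_joint[OF K(1)])
        (use K tall x in \<open>auto intro!: tendsto_intros tall simp: eventually_at_filter\<close>)
  qed
  moreover have "exp (glim \<kappa> (drp n s) (hgt s n x)) = glim \<kappa> (drp (Suc n) s) (hgt s (Suc n) x) - \<kappa>"
    if "x \<ge> t" for n x
    using glim_exp[OF K tall[OF that, of n]] hgt_drp[of n s 1 x] by simp
  ultimately show ?thesis using X by (auto simp: ray_def)
qed

lemma gext_glim: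
  assumes "K > 2 * pi + 6" "norm \<kappa> \<le> K" "Tall (QK K) s t" "(s, t) \<in> X"
  shows "gext \<kappa> (s, t) = Some (glim \<kappa> s t)"
  using gext_eq[OF ray_glim[OF assms]] by simp

lemma hgt_1_inverse:
  assumes "hgt s 1 t \<le> y"
  defines "x \<equiv> ln (1 + y + 2 * pi * \<bar>real_of_int (s 1)\<bar>)"
  shows "t \<le> x" "hgt s 1 x = y"
proof -
  have e: "exp t \<le> 1 + y + 2 * pi * \<bar>real_of_int (s 1)\<bar>"
    using assms(1) exp_hgt_1[of t s] by linarith
  then have "exp x = 1 + y + 2 * pi * \<bar>real_of_int (s 1)\<bar>"
    unfolding x_def using exp_gt_zero[of t] by (intro exp_ln) linarith
  then show "t \<le> x" "hgt s 1 x = y"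
    using e exp_hgt_1[of x s] exp_le_cancel_iff[of t x] by linarith+
qed

text \<open>The remaining levels have to be reparametrised by the height of the image point; the
  logarithm in \<gamma>' is the inverse of the height map given by
  \<open>hgt_1_inverse\<close>.\<close>

lemma ray_step:
  assumes "ray \<kappa> s t \<gamma>"
  defines "\<gamma>' \<equiv> (\<lambda>n y. \<gamma> (Suc n) (ln (1 + y + 2 * pi * \<bar>real_of_int (s 1)\<bar>)))"
  shows "ray \<kappa> (drp 1 s) (hgt s 1 t) \<gamma>'" "x \<ge> t \<Longrightarrow> \<gamma>' n (hgt s 1 x) = \<gamma> (Suc n) x"
proof -
  have inv: "ln (1 + hgt s 1 x + 2 * pi * \<bar>real_of_int (s 1)\<bar>) = x" for x
  proof -
    have "1 + hgt s 1 x + 2 * pi * \<bar>real_of_int (s 1)\<bar> = exp x" using exp_hgt_1[of x s] by simp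
    then show ?thesis by (simp only: ln_exp)
  qed
  then show "x \<ge> t \<Longrightarrow> \<gamma>' n (hgt s 1 x) = \<gamma> (Suc n) x" by (simp add: \<gamma>'_def)
  have X: "(drp 1 s, hgt s 1 t) \<in> X" using X_drp[OF rayD(1)[OF assms(1)]] .
  have lev: "hgt (drp 1 s) n (hgt s 1 x) = hgt s (Suc n) x" "drp n (drp 1 s) = drp (Suc n) s" for n x
    using hgt_Suc_drp[of s n x] by auto
  have "continuous_on {hgt s 1 t..} (\<gamma>' n)" for n
    unfolding \<gamma>'_def
  proof (rule continuous_on_compose2[OF rayD(2)[OF assms(1)]])
    have "1 + y + 2 * pi * \<bar>real_of_int (s 1)\<bar> > 0" if "y \<ge> hgt s 1 t" for y
      using that exp_hgt_1[of t s] exp_gt_zero[of t] by linarith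
    then show "continuous_on {hgt s 1 t..} (\<lambda>y. ln (1 + y + 2 * pi * \<bar>real_of_int (s 1)\<bar>))"
      by (force intro!: continuous_intros)
  qed (use hgt_1_inverse(1) in auto)
  moreover have "exp (\<gamma>' n y) = \<gamma>' (Suc n) y - \<kappa>" if "y \<ge> hgt s 1 t" for n y
    using rayD(3)[OF assms(1) hgt_1_inverse(1)[OF that]] by (simp add: \<gamma>'_def)
  moreover obtain N where N: "\<And>n x. n \<ge> N \<Longrightarrow> x \<ge> t \<Longrightarrow> \<gamma> n x = glim \<kappa> (drp n s) (hgt s n x)"
    using rayD(4)[OF assms(1)] by blast
  moreover have sub: "\<gamma>' n y = glim \<kappa> (drp n (drp 1 s)) (hgt (drp 1 s) n y)"
    if "y \<ge> hgt s 1 t" "x = ln (1 + y + 2 * pi * \<bar>real_of_int (s 1)\<bar>)"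
      "\<gamma> (Suc n) x = glim \<kappa> (drp (Suc n) s) (hgt s (Suc n) x)" for n x y
  proof -
    have "hgt (drp 1 s) n y = hgt s (Suc n) x"
      using lev(1)[of n x] hgt_1_inverse(2)[OF that(1)] that(2) by simp
    then show ?thesis using that(2,3) lev(2)[of n] by (simp add: \<gamma>'_def)
  qed
  then have "\<forall>n\<ge>N. \<forall>y\<ge>hgt s 1 t. \<gamma>' n y = glim \<kappa> (drp n (drp 1 s)) (hgt (drp 1 s) n y)"
    using N hgt_1_inverse(1) by auto
  moreover have "\<exists>b. \<forall>y\<ge>b. \<gamma>' n y = glim \<kappa> (drp n (drp 1 s)) (hgt (drp 1 s) n y)" for n
  proof -
    obtain b where b: "\<And>x. x \<ge> b \<Longrightarrow> \<gamma> (Suc n) x = glim \<kappa> (drp (Suc n) s) (hgt s (Suc n) x)"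
      using rayD(5)[OF assms(1)] by blast
    have "\<gamma>' n y = glim \<kappa> (drp n (drp 1 s)) (hgt (drp 1 s) n y)"
      if "y \<ge> max (hgt s 1 t) (hgt s 1 b)" for y
      using that b hgt_1_inverse(1)[of s b y] by (intro sub) auto
    then show ?thesis by blast
  qed
  ultimately show "ray \<kappa> (drp 1 s) (hgt s 1 t) \<gamma>'"
    using X unfolding ray_def by blast
qed

lemma ray_drp:
  assumes "ray \<kappa> s t \<gamma>"
  obtains \<gamma>' where "ray \<kappa> (drp n s) (hgt s n t) \<gamma>'" "\<And>m x. x \<ge> t \<Longrightarrow> \<gamma>' m (hgt s n x) = \<gamma> (n + m) x"
proof -
  have "\<exists>\<gamma>'. ray \<kappa> (drp n s) (hgt s n t) \<gamma>' \<and> (\<forall>m. \<forall>x\<ge>t. \<gamma>' m (hgt s n x) = \<gamma> (n + m) x)"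
  proof (induction n)
    case 0
    then show ?case using assms by auto
  next
    case (Suc n)
    then obtain \<gamma>' where g: "ray \<kappa> (drp n s) (hgt s n t) \<gamma>'" "\<And>m x. x \<ge> t \<Longrightarrow> \<gamma>' m (hgt s n x) = \<gamma> (n + m) x"
      by blast
    have b: "(s, t) \<in> X_bar" using rayD(1)[OF assms] by (rule X_subset_X_bar)
    have eq: "hgt (drp n s) 1 (hgt s n x) = hgt s (Suc n) x" "drp 1 (drp n s) = drp (Suc n) s" for x
      using hgt_drp[of n s 1 x] by auto
    show ?case
    proof (intro exI conjI allI impI)
      show "ray \<kappa> (drp (Suc n) s) (hgt s (Suc n) t)
          (\<lambda>m y. \<gamma>' (Suc m) (ln (1 + y + 2 * pi * \<bar>real_of_int (drp n s 1)\<bar>)))"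
        using ray_step(1)[OF g(1)] unfolding eq .
      fix m x assume x: "t \<le> x"
      show "\<gamma>' (Suc m) (ln (1 + hgt s (Suc n) x + 2 * pi * \<bar>real_of_int (drp n s 1)\<bar>)) = \<gamma> (Suc n + m) x"
        using ray_step(2)[OF g(1) hgt_mono[OF b x]] g(2)[OF x, of "Suc m"] unfolding eq by simp
    qed
  qed
  then show ?thesis using that by blast
qed

lemma ray_level: "ray \<kappa> s t \<gamma> \<Longrightarrow> x \<ge> t \<Longrightarrow> gext \<kappa> (drp n s, hgt s n x) = Some (\<gamma> n x)"
  using ray_drp[OF ray_restrict, of \<kappa> s t \<gamma> x n] gext_eq by (metis add.right_neutral order_refl)

lemma ray_eq_glim:
  assumes "K > 2 * pi + 6" "norm \<kappa> \<le> K" "ray \<kappa> s t \<gamma>" "x \<ge> t" "Tall (QK K) (drp n s) (hgt s n x)"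
  shows "\<gamma> n x = glim \<kappa> (drp n s) (hgt s n x)"
  using ray_level[OF assms(3,4), of n] gext_glim[OF assms(1,2,5)]
    X_drp[OF X_upward[OF rayD(1)[OF assms(3)] assms(4)], of n] by simp

lemma ray_Tall_large:
  assumes "ray \<kappa> s t \<gamma>" "x \<ge> t + \<bar>q\<bar>"
  shows "Tall q (drp n s) (hgt s n x)"
  using assms by (intro Tall_drp Tall_large[OF X_subset_X_bar[OF rayD(1)[OF assms(1)]]]) auto

lemma gext_step:
  assumes "gext \<kappa> (s, t) = Some w"
  shows "gext \<kappa> (drp 1 s, hgt s 1 t) = Some (E \<kappa> w)"
proof -
  obtain \<gamma> where g: "ray \<kappa> s t \<gamma>" "\<gamma> 0 t = w" using assms by (auto simp: gext_Some_iff)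
  show ?thesis using ray_level[OF g(1) order_refl, of 1] ray_Suc[OF g(1) order_refl, of 0] g(2) by simp
qed

lemma gext_iter:
  assumes "gext \<kappa> (s, t) = Some w"
  shows "gext \<kappa> (drp n s, hgt s n t) = Some ((E \<kappa> ^^ n) w)"
proof -
  obtain \<gamma> where g: "ray \<kappa> s t \<gamma>" "\<gamma> 0 t = w" using assms by (auto simp: gext_Some_iff)
  show ?thesis using ray_level[OF g(1) order_refl, of n] ray_funpow[OF g(1) order_refl, of n 0] g(2) by simp
qed

text \<open>A half-line is contractible, so a curve that avoids \<kappa> can be pulled back by a
  continuous logarithm. Meeting \<kappa> is thus the only obstruction to extending a ray by one
  level backwards.\<close>

lemma ray_lift:
  assumes X: "(s, t) \<in> X" and g': "ray \<kappa> (drp 1 s) (hgt s 1 t) \<gamma>'"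
    and avoid: "\<And>y. y \<ge> hgt s 1 t \<Longrightarrow> \<gamma>' 0 y \<noteq> \<kappa>"
  obtains \<gamma> where "ray \<kappa> s t \<gamma>" "\<And>n x. x \<ge> t \<Longrightarrow> \<gamma> (Suc n) x = \<gamma>' n (hgt s 1 x)"
proof -
  note K = K_of[of \<kappa>]
  have Xb: "(s, t) \<in> X_bar" using X by (rule X_subset_X_bar)
  have lev: "hgt (drp 1 s) n (hgt s 1 x) = hgt s (Suc n) x" "drp n (drp 1 s) = drp (Suc n) s" for n x
    using hgt_Suc_drp[of s n x] by auto
  have mono: "x \<ge> t \<Longrightarrow> hgt s 1 x \<ge> hgt s 1 t" for x using hgt_mono[OF Xb] .
  have cont: "continuous_on {t..} (\<lambda>x. \<gamma>' n (hgt s 1 x))" for n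
    by (rule continuous_on_compose2[OF rayD(2)[OF g', of n]]) (use mono in \<open>auto intro!: continuous_intros\<close>)
  have "continuous_on {t..} (\<lambda>x. \<gamma>' 0 (hgt s 1 x) - \<kappa>)" by (intro continuous_intros cont)
  moreover have "contractible {t..}" by (simp add: convex_imp_contractible)
  ultimately obtain f where f: "continuous_on {t..} f"
    "\<And>x. x \<in> {t..} \<Longrightarrow> \<gamma>' 0 (hgt s 1 x) - \<kappa> = exp (f x)"
    using continuous_logarithm_on_contractible[of "{t..}" "\<lambda>x. \<gamma>' 0 (hgt s 1 x) - \<kappa>"] avoid mono
    by (metis atLeast_iff right_minus_eq)
  define b where "b = t + \<bar>QK (K_of \<kappa>)\<bar>"
  have b: "b \<ge> t" by (simp add: b_def)
  have tall: "Tall (QK (K_of \<kappa>)) s x" if "x \<ge> b" for x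
    using that by (intro Tall_large[OF Xb]) (auto simp: b_def)
  have lim: "\<gamma>' 0 (hgt s 1 x) = glim \<kappa> (drp 1 s) (hgt s 1 x)" if "x \<ge> b" for x
    using ray_eq_glim[OF K g' mono, of x 0] Tall_drp[OF tall[OF that], of 1] that b by simp
  have cg: "continuous_on {b..} (\<lambda>x. glim \<kappa> s x)"
    using rayD(2)[OF ray_glim[OF K tall[OF order_refl] X_upward[OF X b]], of 0] by simp
  obtain m :: int where m: "\<And>x. x \<in> {b..} \<Longrightarrow> f x = glim \<kappa> s x + 2 * of_real pi * \<i> * of_int m"
  proof (rule exp_lifts[of "{b..}" f "glim \<kappa> s"])
    show "exp (f x) = exp (glim \<kappa> s x)" if "x \<in> {b..}" for x
      using f(2)[of x] lim[of x] glim_exp[OF K tall] that b by auto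
  qed (use cg b in \<open>auto intro: continuous_on_subset[OF f(1)]\<close>)
  \<comment> \<open>The integer \<open>m\<close> corrects the branch, so that level 0 agrees with
    the limit map far to the right.\<close>
  define \<gamma> where "\<gamma> = (\<lambda>n x. case n of 0 \<Rightarrow> f x - 2 * of_real pi * \<i> * of_int m | Suc k \<Rightarrow> \<gamma>' k (hgt s 1 x))"
  note e1 = exp_2pi_int[of m]
  obtain N where N: "\<And>n y. n \<ge> N \<Longrightarrow> y \<ge> hgt s 1 t \<Longrightarrow> \<gamma>' n y = glim \<kappa> (drp n (drp 1 s)) (hgt (drp 1 s) n y)"
    using rayD(4)[OF g'] by blast
  have "ray \<kappa> s t \<gamma>"
    unfolding ray_def
  proof (intro conjI allI impI)
    show "continuous_on {t..} (\<gamma> n)" for n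
      by (cases n) (use cont in \<open>auto simp: \<gamma>_def intro!: continuous_intros f\<close>)
    show "exp (\<gamma> n x) = \<gamma> (Suc n) x - \<kappa>" if "t \<le> x" for n x
      using f(2)[of x] that e1 rayD(3)[OF g' mono[OF that]] by (cases n) (auto simp: \<gamma>_def exp_diff)
    have "\<gamma> n x = glim \<kappa> (drp n s) (hgt s n x)" if n: "n \<ge> Suc N" and x: "x \<ge> t" for n x
    proof -
      obtain k where k: "n = Suc k" using n by (cases n) auto
      have "\<gamma>' k (hgt s 1 x) = glim \<kappa> (drp k (drp 1 s)) (hgt (drp 1 s) k (hgt s 1 x))"
        using n by (intro N mono x) (simp add: k)
      then show ?thesis unfolding lev by (simp add: \<gamma>_def k)
    qed
    then show "\<exists>N. \<forall>n\<ge>N. \<forall>x\<ge>t. \<gamma> n x = glim \<kappa> (drp n s) (hgt s n x)" by blast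
    show "\<exists>b. \<forall>x\<ge>b. \<gamma> n x = glim \<kappa> (drp n s) (hgt s n x)" for n
    proof (cases n)
      case 0
      then show ?thesis using m by (intro exI[of _ b]) (auto simp: \<gamma>_def)
    next
      case (Suc k)
      have "\<gamma> n x = glim \<kappa> (drp n s) (hgt s n x)" if "x \<ge> b" for x
      proof -
        have "\<gamma>' k (hgt s 1 x) = glim \<kappa> (drp k (drp 1 s)) (hgt (drp 1 s) k (hgt s 1 x))"
          using that b by (intro ray_eq_glim[OF K g'] mono Tall_drp tall) auto
        then show ?thesis unfolding lev by (simp add: \<gamma>_def Suc)
      qed
      then show ?thesis by blast
    qed
  qed (rule X)
  then show ?thesis using that by (simp add: \<gamma>_def)
qed

lemma hgt_entry: "hgt (s(0 := m)) n t = hgt s n t"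
  by (induction n) (auto simp: hgt_Suc)

lemma drp_entry: "n > 0 \<Longrightarrow> drp n (s(0 := m)) = drp n s"
  by (simp add: drp_def fun_eq_iff)

text \<open>The analogue of \<open>glim_entry\<close> for a whole ray: only level 0 moves, and
  \<open>exp\<close> does not notice the translation.\<close>

lemma ray_entry:
  assumes "ray \<kappa> s t \<gamma>"
  shows "ray \<kappa> (s(0 := m)) t (\<gamma>(0 := \<lambda>x. \<gamma> 0 x + 2 * of_real pi * \<i> * of_int (m - s 0)))" (is "ray _ ?s _ ?g")
  unfolding ray_def hgt_entry
proof (intro conjI allI impI)
  note K = K_of[of \<kappa>]
  show "(?s, t) \<in> X" using rayD(1)[OF assms] by (simp add: X_iff X_bar_iff hgt_entry)
  show "continuous_on {t..} (?g n)" for n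
    by (cases n) (auto intro!: continuous_intros rayD(2)[OF assms])
  show "exp (?g n x) = ?g (Suc n) x - \<kappa>" if "t \<le> x" for n x
    using rayD(3)[OF assms that] by (cases n) (simp_all add: exp_add exp_2pi_int del: of_int_diff)
  obtain N where N: "\<And>n x. n \<ge> N \<Longrightarrow> x \<ge> t \<Longrightarrow> \<gamma> n x = glim \<kappa> (drp n s) (hgt s n x)"
    using rayD(4)[OF assms] by blast
  then show "\<exists>N. \<forall>n\<ge>N. \<forall>x\<ge>t. ?g n x = glim \<kappa> (drp n ?s) (hgt s n x)"
    by (intro exI[of _ "Suc N"]) (auto simp: drp_entry)
  show "\<exists>b. \<forall>x\<ge>b. ?g n x = glim \<kappa> (drp n ?s) (hgt s n x)" for n
  proof (cases n)
    case 0
    have "?g 0 x = glim \<kappa> ?s x" if "x \<ge> t + \<bar>QK (K_of \<kappa>)\<bar>" for x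
      using ray_eq_glim[OF K assms, of x 0] ray_Tall_large[OF assms that, of 0] that
        glim_entry[OF K, of s x m] by simp
    then show ?thesis using 0 by auto
  next
    case (Suc k)
    then show ?thesis using rayD(5)[OF assms, of n] by (auto simp: drp_entry)
  qed
qed

lemma gext_entry:
  assumes "gext \<kappa> (s, t) = Some w"
  shows "gext \<kappa> (s(0 := m), t) = Some (w + 2 * of_real pi * \<i> * of_int (m - s 0))"
proof -
  obtain \<gamma> where g: "ray \<kappa> s t \<gamma>" "\<gamma> 0 t = w" using assms by (auto simp: gext_Some_iff)
  show ?thesis using gext_eq[OF ray_entry[OF g(1), of m]] g(2) by simp
qed

section \<open>Injectivity and escaping points\<close>

text \<open>By \<open>hgt_gap\<close>, heights over the same address that start apart drift apart
  without bound.\<close>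

lemma hgt_separation:
  assumes "(s, a) \<in> X_bar" "(s, b) \<in> X_bar" "\<And>n. \<bar>hgt s n a - hgt s n b\<bar> \<le> c"
  shows "a = b"
proof -
  have *: False if "(s, a) \<in> X_bar" "a < b" "\<And>n. \<bar>hgt s n a - hgt s n b\<bar> \<le> c" for a b
  proof -
    have "eventually (\<lambda>n. c + 1 \<le> (F ^^ n) (b - a)) sequentially"
      using F_iter_at_top[of "b - a"] that(2) by (simp add: filterlim_at_top)
    then obtain n where "c + 1 \<le> (F ^^ n) (b - a)" by (auto simp: eventually_sequentially)
    then show False using hgt_gap[OF that(1), of b n] that(2) that(3)[of n] by linarith
  qed
  show ?thesis
    using *[of a b] *[of b a] assms by (cases a b rule: linorder_cases) (auto simp: abs_minus_commute)
qed

text \<open>Equal values stay equal along the orbits. At each level the imaginary part determines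
  the entry, because two errors of at most 3 pi / 4 add up to less than 2 pi, and the real part
  determines the height up to 6; \<open>hgt_separation\<close> then gives equal heights.\<close>

lemma glim_inj:
  assumes K: "K > 2 * pi + 6" "norm \<kappa> \<le> K" and T: "Tall (QK K) s t" "Tall (QK K) s' t'"
    and eq: "glim \<kappa> s t = glim \<kappa> s' t'"
  shows "s = s'" "t = t'"
proof -
  have eqn: "glim \<kappa> (drp n s) (hgt s n t) = glim \<kappa> (drp n s') (hgt s' n t')" for n
  proof (induction n)
    case (Suc n)
    show ?case
      using glim_exp[OF K Tall_drp[OF T(1)], of n] glim_exp[OF K Tall_drp[OF T(2)], of n] Suc
        hgt_drp[of n s 1 t] hgt_drp[of n s' 1 t'] by simp
  qed (use eq in simp)
  have "s n = s' n" for n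
  proof -
    have "\<bar>2 * pi * real_of_int (s n) - 2 * pi * real_of_int (s' n)\<bar> \<le> 3 * pi / 4 + 3 * pi / 4"
      using glim_Im[OF K Tall_drp[OF T(1)], of n] glim_Im[OF K Tall_drp[OF T(2)], of n]
      unfolding eqn[of n] drp_at_0 by linarith
    then have "(2 * pi) * \<bar>real_of_int (s n) - real_of_int (s' n)\<bar> \<le> (2 * pi) * (3 / 4)"
      by (simp add: abs_mult flip: right_diff_distrib)
    then have "\<bar>real_of_int (s n) - real_of_int (s' n)\<bar> \<le> 3 / 4"
      using pi_gt_zero by (subst (asm) mult_le_cancel_left_pos) auto
    then show ?thesis by linarith
  qed
  then show s: "s = s'" by auto
  have "\<bar>hgt s n t - hgt s n t'\<bar> \<le> 6" for n
    using glim_Re[OF K Tall_drp[OF T(1)], of n] glim_Re[OF K Tall_drp[OF T(2)], of n]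
    unfolding eqn[of n] unfolding s by linarith
  then show "t = t'"
    using hgt_separation[of s t t' 6] Tall_X_bar[OF T(1) QK_pos(2)] Tall_X_bar[OF T(2) QK_pos(2)] s by simp
qed

text \<open>After enough steps both points are tall and \<open>glim_inj\<close> applies. On the way
  back, the tail of the address and the next height determine the present height, and a different
  first entry would move the value by a nonzero multiple of 2 pi i.\<close>

lemma gext_inj:
  assumes "gext \<kappa> (s, t) = Some w" "gext \<kappa> (s', t') = Some w"
  shows "s = s' \<and> t = t'"
proof -
  note K = K_of[of \<kappa>]
  have step: "s = s' \<and> t = t'"
    if "gext \<kappa> (s, t) = Some w" "gext \<kappa> (s', t') = Some w" "drp 1 s = drp 1 s'" "hgt s 1 t = hgt s' 1 t'"
    for s s' t t' w
  proof -
    have tail: "s (Suc k) = s' (Suc k)" for k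
      using fun_cong[OF that(3), of k] by (simp add: drp_apply)
    then have "s 1 = s' 1" using tail[of 0] by simp
    then have "exp t = exp t'" using exp_hgt_1[of t s] exp_hgt_1[of t' s'] that(4) by simp
    then have t: "t = t'" by simp
    have s': "s(0 := s' 0) = s'" using tail by (auto simp: fun_eq_iff gr0_conv_Suc)
    have "w + 2 * of_real pi * \<i> * of_int (s' 0 - s 0) = w"
      using gext_entry[OF that(1), of "s' 0"] that(2) unfolding s' t by simp
    then have "s' 0 = s 0" by simp
    with s' t show ?thesis by (metis fun_upd_triv)
  qed
  have "s = s' \<and> t = t'"
    if "gext \<kappa> (s, t) = Some w" "gext \<kappa> (s', t') = Some w" "drp n s = drp n s'" "hgt s n t = hgt s' n t'"
    for n s s' t t' w
    using that
  proof (induction n arbitrary: s s' t t' w)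
    case (Suc n)
    have "drp 1 s = drp 1 s' \<and> hgt s 1 t = hgt s' 1 t'"
      by (rule Suc.IH[OF gext_step[OF Suc.prems(1)] gext_step[OF Suc.prems(2)]])
        (use Suc.prems(3,4) in \<open>simp_all only: drp_drp hgt_Suc_drp plus_1_eq_Suc\<close>)
    then show ?case using step[OF Suc.prems(1,2)] by blast
  qed auto
  moreover obtain N1 N2 where N: "\<And>n. n \<ge> N1 \<Longrightarrow> Tall (QK (K_of \<kappa>)) (drp n s) (hgt s n t)"
    "\<And>n. n \<ge> N2 \<Longrightarrow> Tall (QK (K_of \<kappa>)) (drp n s') (hgt s' n t')"
    using X_eventually_Tall[OF gext_X[OF assms(1)], of "QK (K_of \<kappa>)"]
      X_eventually_Tall[OF gext_X[OF assms(2)], of "QK (K_of \<kappa>)"] by metis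
  define n where "n = max N1 N2"
  have T: "Tall (QK (K_of \<kappa>)) (drp n s) (hgt s n t)" "Tall (QK (K_of \<kappa>)) (drp n s') (hgt s' n t')"
    using N by (simp_all add: n_def)
  have "glim \<kappa> (drp n s) (hgt s n t) = glim \<kappa> (drp n s') (hgt s' n t')"
    using gext_glim[OF K T(1) X_drp[OF gext_X[OF assms(1)]]] gext_glim[OF K T(2) X_drp[OF gext_X[OF assms(2)]]]
      gext_iter[OF assms(1), of n] gext_iter[OF assms(2), of n] by simp
  ultimately show ?thesis using glim_inj[OF K T] assms by blast
qed

lemma gext_escaping:
  assumes "gext \<kappa> (s, t) = Some w"
  shows "w \<in> escaping_set \<kappa>"
proof -
  note K = K_of[of \<kappa>]
  have X: "(s, t) \<in> X" using gext_X[OF assms] .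
  obtain N where N: "\<And>n. n \<ge> N \<Longrightarrow> Tall (QK (K_of \<kappa>)) (drp n s) (hgt s n t)"
    using X_eventually_Tall[OF X] by blast
  have "hgt s n t - 3 \<le> norm ((E \<kappa> ^^ n) w)" if "n \<ge> N" for n
  proof -
    have "(E \<kappa> ^^ n) w = glim \<kappa> (drp n s) (hgt s n t)"
      using gext_iter[OF assms, of n] gext_glim[OF K N[OF that] X_drp[OF X]] by simp
    then show ?thesis
      using glim_Re[OF K N[OF that]] complex_Re_le_cmod[of "(E \<kappa> ^^ n) w"] by (simp add: abs_le_iff)
  qed
  then have "\<forall>\<^sub>F n in sequentially. hgt s n t - 3 \<le> norm ((E \<kappa> ^^ n) w)"
    by (auto simp: eventually_sequentially)
  moreover have "filterlim (\<lambda>n. hgt s n t - 3) at_top sequentially"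
    using X filterlim_tendsto_add_at_top[OF tendsto_const[of "-3"], of "\<lambda>n. hgt s n t" sequentially]
    by (simp add: X_iff)
  ultimately have "filterlim (\<lambda>n. norm ((E \<kappa> ^^ n) w)) at_top sequentially"
    by (rule filterlim_at_top_mono[rotated])
  then show ?thesis by (simp add: escaping_set_def filterlim_at_infinity_conv_norm_at_top)
qed

section \<open>Escaping orbits eventually lie on rays\<close>

lemma ln_contract:
  fixes x y :: real
  assumes "2 \<le> x" "2 \<le> y"
  shows "\<bar>ln x - ln y\<bar> \<le> \<bar>x - y\<bar> / 2"
proof -
  have *: "ln x - ln y \<le> \<bar>x - y\<bar> / 2" if "2 \<le> x" "2 \<le> y" for x y :: real
  proof -
    have "ln x - ln y \<le> (x - y) / y" using that by (intro ln_diff_le) auto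
    also have "\<dots> \<le> \<bar>x - y\<bar> / y" using that by (intro divide_right_mono) auto
    also have "\<dots> \<le> \<bar>x - y\<bar> / 2" using that by (intro divide_left_mono) auto
    finally show ?thesis .
  qed
  show ?thesis using *[OF assms] *[OF assms(2,1)] by (intro abs_leI) (simp_all add: abs_minus_commute)
qed

lemma half_plane_contract:
  assumes "Re (u - \<kappa>) \<ge> 2" "Re (v - \<kappa>) \<ge> 2"
  shows "norm (Ln (u - \<kappa>) - Ln (v - \<kappa>)) \<le> norm (u - v) / 2"
proof -
  have "norm (Ln (u - \<kappa>) - Ln (v - \<kappa>)) \<le> 1/2 * norm ((u - \<kappa>) - (v - \<kappa>))"
  proof (rule field_differentiable_bound[where S = "{w. Re w \<ge> 2}" and f' = inverse])
    show "convex {w. Re w \<ge> 2}" by (rule convex_halfspace_Re_ge)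
    fix w :: complex assume w: "w \<in> {w. Re w \<ge> 2}"
    then have "w \<notin> \<real>\<^sub>\<le>\<^sub>0" by (auto simp: complex_nonpos_Reals_iff)
    then show "(Ln has_field_derivative inverse w) (at w within {w. Re w \<ge> 2})"
      by (rule has_field_derivative_at_within[OF has_field_derivative_Ln])
    have "2 \<le> norm w" using w complex_Re_le_cmod[of w] by simp
    then show "norm (inverse w) \<le> 1/2" using le_imp_inverse_le[of 2 "norm w"] by (simp add: norm_inverse)
  qed (use assms in auto)
  then show ?thesis by simp
qed

text \<open>The address of a point whose orbit stays far to the right is read off from the imaginary
  parts; its height is the limit of the heights obtained by pulling back the real parts.\<close>

lemma right_orbit_on_ray:
  assumes K: "K > 2 * pi + 6" "norm \<kappa> \<le> K"
    and right: "\<And>n. Re ((E \<kappa> ^^ n) z) \<ge> 5 * K + 20 + QK K"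
    and esc: "z \<in> escaping_set \<kappa>"
  obtains s t where "(s, t) \<in> X" "Tall (QK K) s t" "glim \<kappa> s t = z"
proof -
  define v where "v n = (E \<kappa> ^^ n) z" for n
  have vRe: "Re (v n) \<ge> 5 * K + 20 + QK K" for n using right by (simp add: v_def)
  have vSuc: "v (Suc n) - \<kappa> = exp (v n)" for n by (simp add: v_def E_def)
  \<comment> \<open>The ceiling picks the integer that brings the imaginary part into the interval
    (-pi, pi], the range of imaginary parts of \<open>Ln\<close>, including its closed end.\<close>
  define s where "s n = \<lceil>(Im (v n) - pi) / (2 * pi)\<rceil>" for n
  have s_bound: "- pi < Im (v n) - 2 * pi * s n" "Im (v n) - 2 * pi * s n \<le> pi" for n
  proof -
    have "(Im (v n) - pi) / (2 * pi) \<le> s n" "s n < (Im (v n) - pi) / (2 * pi) + 1"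
      unfolding s_def by linarith+
    then show "- pi < Im (v n) - 2 * pi * s n" "Im (v n) - 2 * pi * s n \<le> pi"
      using pi_gt_zero by (simp_all add: field_simps)
  qed
  have vLn: "v n = Ln (v (Suc n) - \<kappa>) + 2 * of_real pi * \<i> * of_int (s n)" for n
  proof -
    have "exp (v n - 2 * of_real pi * \<i> * of_int (s n)) = v (Suc n) - \<kappa>"
      by (simp add: exp_diff exp_2pi_int vSuc)
    then have "Ln (v (Suc n) - \<kappa>) = v n - 2 * of_real pi * \<i> * of_int (s n)"
      by (rule Ln_unique) (use s_bound[of n] in auto)
    then show ?thesis by simp
  qed
  \<comment> \<open>The threshold for the real parts is chosen to give this bound, which absorbs the
    errors of size K and pi in the two estimates of \<open>D\<close> within a factor e.\<close>
  have r_ge: "exp (Re (v n)) \<ge> 4 * K + 20" for n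
  proof -
    have "exp (Re (v n)) = norm (v (Suc n) - \<kappa>)" by (simp add: vSuc)
    moreover have "Re (v (Suc n)) - Re \<kappa> \<le> norm (v (Suc n) - \<kappa>)"
      using complex_Re_le_cmod[of "v (Suc n) - \<kappa>"] by simp
    ultimately show ?thesis using vRe[of "Suc n"] complex_Re_le_cmod[of \<kappa>] K QK_pos(2)[of K] by linarith
  qed
  \<comment> \<open>If \<open>x\<close> is the height at level \<open>Suc n\<close>, then
    \<open>D x n\<close> is the exponential of the height at level \<open>n\<close>; its logarithm
    is therefore one backward step for heights.\<close>
  define D where "D x n = 1 + x + 2 * pi * \<bar>real_of_int (s (Suc n))\<bar>" for x n
  have D: "2 \<le> D x n" "exp (Re (v n) - 1) \<le> D x n" "D x n \<le> exp (Re (v n) + 1)"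
    if x: "\<bar>x - Re (v (Suc n))\<bar> \<le> 1" for x n
  proof -
    define r where "r = exp (Re (v n))"
    have r: "r \<ge> 4 * K + 20" using r_ge by (simp add: r_def)
    have "norm (v (Suc n) - \<kappa>) = r" by (simp add: vSuc r_def)
    then have nv: "r - K \<le> norm (v (Suc n))" "norm (v (Suc n)) \<le> r + K"
      using norm_triangle_ineq[of "v (Suc n) - \<kappa>" \<kappa>] norm_triangle_ineq4[of "v (Suc n)" \<kappa>] K
      by (simp_all)
    have Im: "\<bar>2 * pi * \<bar>real_of_int (s (Suc n))\<bar> - \<bar>Im (v (Suc n))\<bar>\<bar> \<le> pi"
    proof -
      have "2 * pi * \<bar>real_of_int (s (Suc n))\<bar> = \<bar>2 * pi * real_of_int (s (Suc n))\<bar>"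
        by (simp add: abs_mult)
      then show ?thesis using s_bound[of "Suc n"] by linarith
    qed
    have "norm (v (Suc n)) \<le> Re (v (Suc n)) + \<bar>Im (v (Suc n))\<bar>"
      using cmod_le[of "v (Suc n)"] vRe[of "Suc n"] K QK_pos(2)[of K] pi_gt3 by simp
    then have lo: "r - K - pi \<le> D x n" using x Im nv unfolding D_def by linarith
    have "Re (v (Suc n)) \<le> norm (v (Suc n))" "\<bar>Im (v (Suc n))\<bar> \<le> norm (v (Suc n))"
      by (rule complex_Re_le_cmod abs_Im_le_cmod)+
    then have up: "D x n \<le> 2 * r + 2 * K + pi + 2" using x Im nv unfolding D_def by linarith
    show "2 \<le> D x n" using lo r K pi_gt3 by linarith
    have e: "exp 1 \<ge> (5/2 :: real)" using exp_lower_Taylor_quadratic[of "1::real"] by simp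
    have "exp (Re (v n) - 1) * exp 1 = r" "exp (Re (v n) + 1) = r * exp 1"
      by (simp_all add: r_def exp_add exp_diff)
    moreover have "exp (Re (v n) - 1) * (5/2) \<le> exp (Re (v n) - 1) * exp 1" "r * (5/2) \<le> r * exp 1"
      using e by (intro mult_left_mono; simp add: r_def)+
    ultimately show "exp (Re (v n) - 1) \<le> D x n" "D x n \<le> exp (Re (v n) + 1)"
      using lo up r K pi_less_4 by linarith+
  qed
  \<comment> \<open>\<open>bk k n\<close> starts from the real part of \<open>v (n + k)\<close> and
    takes \<open>k\<close> backward steps. It never moves further than 1 from
    \<open>Re (v n)\<close>, and the backward steps contract by 1/2, so it converges in
    \<open>k\<close>.\<close>
  define bk where "bk = rec_nat (\<lambda>n. Re (v n)) (\<lambda>k f n. ln (D (f (Suc n)) n))"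
  have bk0: "bk 0 n = Re (v n)" and bkS: "bk (Suc k) n = ln (D (bk k (Suc n)) n)" for k n
    by (simp_all add: bk_def)
  have bk1: "\<bar>bk k n - Re (v n)\<bar> \<le> 1" for k n
  proof (induction k arbitrary: n)
    case (Suc k)
    note d = D[OF Suc[of "Suc n"]]
    have "ln (exp (Re (v n) - 1)) \<le> ln (D (bk k (Suc n)) n)" "ln (D (bk k (Suc n)) n) \<le> ln (exp (Re (v n) + 1))"
      using d by (intro ln_mono; auto)+
    then show ?case by (simp add: bkS abs_le_iff)
  qed (simp add: bk0)
  have bk2: "norm (bk (Suc k) n - bk k n) \<le> 1 / 2 ^ k" for k n
  proof (induction k arbitrary: n)
    case 0
    then show ?case using bk1[of 1 n] by (simp add: bk0)
  next
    case (Suc k)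
    have "norm (bk (Suc (Suc k)) n - bk (Suc k) n) \<le> \<bar>bk (Suc k) (Suc n) - bk k (Suc n)\<bar> / 2"
    proof -
      have "D a n - D b n = a - b" for a b by (simp add: D_def)
      then show ?thesis
        using ln_contract[OF D(1)[OF bk1[of "Suc k" "Suc n"]] D(1)[OF bk1[of k "Suc n"]]]
        unfolding bkS[of "Suc k"] bkS[of k n] by simp
    qed
    then show ?case using Suc[of "Suc n"] by simp
  qed
  define \<tau> where "\<tau> n = lim (\<lambda>k. bk k n)" for n
  have lim: "(\<lambda>k. bk k n) \<longlonglongrightarrow> \<tau> n" for n
    using geometric_convergence(1)[of "\<lambda>k. bk k n" 1, OF bk2] by (simp add: \<tau>_def convergent_LIMSEQ_iff)
  have tau1: "\<bar>\<tau> n - Re (v n)\<bar> \<le> 1" for n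
    by (rule LIMSEQ_le_const2[OF tendsto_rabs[OF tendsto_diff[OF lim tendsto_const]]]) (use bk1 in auto)
  have tau_eq: "\<tau> n = ln (D (\<tau> (Suc n)) n)" for n
  proof (rule LIMSEQ_unique)
    show "(\<lambda>k. bk (Suc k) n) \<longlonglongrightarrow> \<tau> n" using lim by (rule LIMSEQ_Suc)
    show "(\<lambda>k. bk (Suc k) n) \<longlonglongrightarrow> ln (D (\<tau> (Suc n)) n)"
      unfolding bkS D_def using D(1)[OF tau1[of "Suc n"]]
      by (intro tendsto_intros lim) (auto simp: D_def)
  qed
  have hgt_tau: "hgt s n (\<tau> 0) = \<tau> n" for n
  proof (induction n)
    case (Suc n)
    have "exp (\<tau> n) = D (\<tau> (Suc n)) n"
      using tau_eq[of n] D(1)[OF tau1[of "Suc n"]] by (metis exp_ln less_le_trans zero_less_numeral)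
    then show ?case by (simp add: hgt_Suc Suc F_def D_def)
  qed simp
  have tall: "Tall (QK K) s (\<tau> 0)"
    unfolding Tall_def hgt_tau
  proof
    fix n
    show "QK K \<le> \<tau> n" using tau1[of n] vRe[of n] K pi_gt3 by linarith
  qed
  have vinf: "filterlim (\<lambda>n. norm (v n - \<kappa>)) at_top sequentially"
  proof (rule filterlim_at_top_mono)
    have "filterlim (\<lambda>n. norm (v n)) at_top sequentially"
      using esc by (simp add: escaping_set_def filterlim_at_infinity_conv_norm_at_top v_def)
    from filterlim_tendsto_add_at_top[OF tendsto_const[of "- norm \<kappa>"] this]
    show "filterlim (\<lambda>n. - norm \<kappa> + norm (v n)) at_top sequentially" .
    show "\<forall>\<^sub>F n in sequentially. - norm \<kappa> + norm (v n) \<le> norm (v n - \<kappa>)"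
      using norm_triangle_ineq2 by (auto intro!: always_eventually)
  qed
  have "filterlim (\<lambda>n. ln (norm (v (Suc n) - \<kappa>))) at_top sequentially"
    using filterlim_compose[OF ln_at_top vinf] by (subst filterlim_sequentially_Suc)
  then have "filterlim (\<lambda>n. -1 + Re (v n)) at_top sequentially"
    by (intro filterlim_tendsto_add_at_top[OF tendsto_const]) (simp add: vSuc)
  then have "filterlim \<tau> at_top sequentially"
    by (rule filterlim_at_top_mono) (use tau1 in \<open>auto intro!: always_eventually simp: abs_le_iff algebra_simps\<close>)
  then have X: "(s, \<tau> 0) \<in> X"
    using Tall_X_bar[OF tall QK_pos(2)] by (simp add: X_iff hgt_tau)
  \<comment> \<open>The distance between the limit map and the given orbit at level
    \<open>n\<close>. It is at most 10 at every level and at least halves with each backward step,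
    so it vanishes at level 0.\<close>
  define d where "d n = norm (glim \<kappa> (drp n s) (\<tau> n) - v n)" for n
  have talln: "Tall (QK K) (drp n s) (\<tau> n)" for n using Tall_drp[OF tall, of n] by (simp add: hgt_tau)
  have tau_drp: "hgt (drp n s) 1 (\<tau> n) = \<tau> (Suc n)" for n
    using hgt_drp[of n s 1 "\<tau> 0"] by (simp add: hgt_tau)
  have d_le: "d n \<le> 10" for n
  proof -
    have "\<bar>Re (glim \<kappa> (drp n s) (\<tau> n) - v n)\<bar> \<le> 4"
      using glim_Re[OF K talln[of n]] tau1[of n] by simp
    moreover have "\<bar>Im (glim \<kappa> (drp n s) (\<tau> n) - v n)\<bar> \<le> 3 * pi / 4 + pi"
      using glim_Im[OF K talln[of n]] s_bound[of n] unfolding minus_complex.sel drp_at_0 by linarith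
    ultimately have "d n \<le> 4 + (3 * pi / 4 + pi)"
      unfolding d_def using cmod_le[of "glim \<kappa> (drp n s) (\<tau> n) - v n"] by linarith
    then show ?thesis using pi_approx by simp
  qed
  have d_step: "d n \<le> d (Suc n) / 2" for n
  proof -
    have "Re \<kappa> \<le> K" using K(2) complex_Re_le_cmod[of \<kappa>] by simp
    then have "Re (v (Suc n) - \<kappa>) \<ge> 2" "Re (glim \<kappa> (drp (Suc n) s) (\<tau> (Suc n)) - \<kappa>) \<ge> 2"
      using vRe[of "Suc n"] glim_Re[OF K talln[of "Suc n"]] tau1[of "Suc n"] K(1) QK_pos(2)[of K] pi_gt3
      by (auto simp: abs_le_iff)
    from half_plane_contract[OF this(2,1)] show ?thesis
      unfolding d_def using vLn[of n] glim_eq[OF K talln[of n]] tau_drp[of n]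
      by (simp add: algebra_simps)
  qed
  have "d 0 \<le> 10 / 2 ^ k" for k
  proof -
    have "d 0 \<le> d k / 2 ^ k"
    proof (induction k)
      case (Suc k)
      have "d k / 2 ^ k \<le> (d (Suc k) / 2) / 2 ^ k" using d_step by (intro divide_right_mono) auto
      with Suc show ?case by (simp add: field_simps)
    qed simp
    also have "\<dots> \<le> 10 / 2 ^ k" using d_le by (intro divide_right_mono) auto
    finally show ?thesis .
  qed
  moreover have "(\<lambda>k. 10 * (1/2) ^ k) \<longlonglongrightarrow> 10 * (0::real)"
    by (intro tendsto_intros LIMSEQ_realpow_zero) auto
  ultimately have "d 0 \<le> 0"
    by (intro LIMSEQ_le_const[of "\<lambda>k. 10 * (1/2) ^ k" 0]) (auto simp: power_one_over)
  then have "glim \<kappa> s (\<tau> 0) = z" by (simp add: d_def v_def)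
  with X tall that show ?thesis by blast
qed

text \<open>The next modulus is at most \<open>exp\<close> of the present real part plus the modulus
  of \<kappa>, so moduli tending to infinity force the real parts to become large;
  \<open>right_orbit_on_ray\<close> applies to the tail of the orbit.\<close>

lemma escaping_eventually_on_ray:
  assumes "z \<in> escaping_set \<kappa>"
  obtains n s t where "gext \<kappa> (s, t) = Some ((E \<kappa> ^^ n) z)"
proof -
  note K = K_of[of \<kappa>]
  define A where "A = 5 * K_of \<kappa> + 20 + QK (K_of \<kappa>)"
  have vinf: "filterlim (\<lambda>n. norm ((E \<kappa> ^^ n) z)) at_top sequentially"
    using assms by (simp add: escaping_set_def filterlim_at_infinity_conv_norm_at_top)
  then obtain N where N: "\<And>n. n \<ge> N \<Longrightarrow> exp A + norm \<kappa> \<le> norm ((E \<kappa> ^^ n) z)"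
    unfolding filterlim_at_top eventually_sequentially by blast
  have "A \<le> Re ((E \<kappa> ^^ n) z)" if "n \<ge> N" for n
  proof -
    have "exp A + norm \<kappa> \<le> norm ((E \<kappa> ^^ Suc n) z)" by (rule N) (use that in simp)
    also have "\<dots> \<le> exp (Re ((E \<kappa> ^^ n) z)) + norm \<kappa>"
      using norm_triangle_ineq[of "exp ((E \<kappa> ^^ n) z)" \<kappa>] by (simp add: E_def)
    finally show ?thesis by simp
  qed
  then have right: "Re ((E \<kappa> ^^ n) ((E \<kappa> ^^ N) z)) \<ge> A" for n
    by (simp flip: funpow_add[unfolded o_def, THEN fun_cong] add: o_def)
  have "(E \<kappa> ^^ N) z \<in> escaping_set \<kappa>"
    using filterlim_compose[OF vinf filterlim_add_const_nat_at_top[of N]]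
    by (simp add: escaping_set_def filterlim_at_infinity_conv_norm_at_top funpow_add)
  from right_orbit_on_ray[OF K right[unfolded A_def] this]
  obtain s t where "(s, t) \<in> X" "Tall (QK (K_of \<kappa>)) s t" "glim \<kappa> s t = (E \<kappa> ^^ N) z" by blast
  then show ?thesis using that gext_glim[OF K] by metis
qed

lemma X_prepend:
  assumes "(s, t) \<in> X"
  obtains s' t' where "(s', t') \<in> X" "drp 1 s' = s" "hgt s' 1 t' = t"
proof -
  define s' where "s' = case_nat (0::int) s"
  define t' where "t' = ln (1 + t + 2 * pi * \<bar>real_of_int (s 0)\<bar>)"
  have t0: "0 \<le> t" using X_subset_X_bar[OF assms] by (auto simp: X_bar_iff dest: spec[of _ 0])
  have "1 \<le> 1 + t + 2 * pi * \<bar>real_of_int (s 0)\<bar>" using t0 by simp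
  then have e: "exp t' = 1 + t + 2 * pi * \<bar>real_of_int (s 0)\<bar>" "0 \<le> t'" by (simp_all add: t'_def)
  have d: "drp 1 s' = s" by (simp add: s'_def drp_def)
  have h: "hgt s' 1 t' = t" unfolding hgt_1 by (simp add: F_def e(1) s'_def)
  have hS: "hgt s' (Suc n) t' = hgt s n t" for n using hgt_Suc_drp[of s' n t'] d h by simp
  have "0 \<le> hgt s' n t'" for n
    using X_subset_X_bar[OF assms] e(2) by (cases n) (auto simp: hS X_bar_iff)
  moreover have "filterlim (\<lambda>n. hgt s' n t') at_top sequentially"
    using assms by (subst filterlim_sequentially_Suc[symmetric]) (simp add: hS X_iff)
  ultimately have "(s', t') \<in> X" by (simp add: X_iff X_bar_iff)
  with d h that show ?thesis by blast
qed

text \<open>Descent along the orbit of \<kappa>: if the ray above the point on iterate n + 1 meets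
  \<kappa>, that meeting point is as wanted. Otherwise the ray can be pulled back, and a suitable
  first entry selects the preimage that passes through iterate n.\<close>

lemma escaping_parameter_on_ray:
  assumes "\<kappa> \<in> escaping_set \<kappa>"
  obtains s t where "gext \<kappa> (s, t) = Some \<kappa>"
proof -
  have "\<exists>s t. gext \<kappa> (s, t) = Some \<kappa>" if "gext \<kappa> (s, t) = Some ((E \<kappa> ^^ n) \<kappa>)" for n s t
    using that
  proof (induction n arbitrary: s t)
    case (Suc n)
    obtain \<gamma>' where g': "ray \<kappa> s t \<gamma>'" "\<gamma>' 0 t = (E \<kappa> ^^ Suc n) \<kappa>"
      using Suc.prems by (auto simp: gext_Some_iff)
    show ?case
    proof (cases "\<exists>y\<ge>t. \<gamma>' 0 y = \<kappa>")
      case True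
      then show ?thesis using ray_level[OF g'(1), of _ 0] by auto
    next
      case False
      obtain s1 t1 where st: "(s1, t1) \<in> X" "drp 1 s1 = s" "hgt s1 1 t1 = t"
        using X_prepend[OF rayD(1)[OF g'(1)]] by blast
      obtain \<gamma> where g: "ray \<kappa> s1 t1 \<gamma>" "\<And>n x. x \<ge> t1 \<Longrightarrow> \<gamma> (Suc n) x = \<gamma>' n (hgt s1 1 x)"
        using ray_lift[OF st(1), of \<kappa> \<gamma>'] g'(1) False unfolding st(2,3) by blast
      have "exp (\<gamma> 0 t1) = exp ((E \<kappa> ^^ n) \<kappa>)"
        using rayD(3)[OF g(1) order_refl, of 0] g(2)[OF order_refl, of 0] g'(2) unfolding st(3) by (simp add: E_def)
      then obtain m :: int where m: "\<gamma> 0 t1 = (E \<kappa> ^^ n) \<kappa> + of_real (of_int (2 * m) * pi) * \<i>"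
        unfolding exp_eq by blast
      have "gext \<kappa> (s1(0 := s1 0 - m), t1) = Some ((E \<kappa> ^^ n) \<kappa>)"
        using gext_entry[OF gext_eq[OF g(1)], of "s1 0 - m"] by (simp add: m algebra_simps)
      from Suc.IH[OF this] show ?thesis .
    qed
  qed auto
  with escaping_eventually_on_ray[OF assms] that show ?thesis by metis
qed

section \<open>The domain of the extension and its uniqueness\<close>

lemma hgt_surj:
  assumes "(s, t) \<in> X_bar" "hgt s n t \<le> y"
  obtains x where "x \<ge> t" "hgt s n x = y"
proof -
  define b where "b = t + (y - hgt s n t)"
  have "t \<le> b" using assms(2) by (simp add: b_def)
  moreover have "y \<le> hgt s n b" using hgt_gap_lin[OF assms(1) \<open>t \<le> b\<close>, of n] by (simp add: b_def)
  ultimately have "\<exists>x\<ge>t. x \<le> b \<and> hgt s n x = y"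
    using assms(2) continuous_on_hgt[OF continuous_on_id] by (intro IVT')
  then show ?thesis using that by blast
qed

text \<open>\<kappa> is the omitted value of \<open>E \<kappa>\<close>, so no level above 0 of a ray
  can meet it. Conversely, if no later level meets \<kappa>, \<open>ray_lift\<close> carries the
  limit map back from a level where the point is tall.\<close>

lemma gext_None_iff:
  assumes "(s, t) \<in> X"
  shows "gext \<kappa> (s, t) = None \<longleftrightarrow> (\<exists>n\<ge>1. \<exists>x\<ge>t. gext \<kappa> (drp n s, hgt s n x) = Some \<kappa>)"
proof
  assume "\<exists>n\<ge>1. \<exists>x\<ge>t. gext \<kappa> (drp n s, hgt s n x) = Some \<kappa>"
  then obtain n x where nx: "n \<ge> 1" "x \<ge> t" "gext \<kappa> (drp n s, hgt s n x) = Some \<kappa>" by blast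
  then obtain k where k: "n = Suc k" by (cases n) auto
  show "gext \<kappa> (s, t) = None"
  proof (rule ccontr)
    assume "gext \<kappa> (s, t) \<noteq> None"
    then obtain \<gamma> where g: "ray \<kappa> s t \<gamma>" by (auto simp: gext_Some_iff)
    have "exp (\<gamma> k x) = 0" using rayD(3)[OF g nx(2), of k] ray_level[OF g nx(2), of n] nx(3) k by simp
    then show False by simp
  qed
next
  assume none: "gext \<kappa> (s, t) = None"
  note K = K_of[of \<kappa>]
  have Xb: "(s, t) \<in> X_bar" using assms by (rule X_subset_X_bar)
  show "\<exists>n\<ge>1. \<exists>x\<ge>t. gext \<kappa> (drp n s, hgt s n x) = Some \<kappa>"
  proof (rule ccontr)
    assume no: "\<not> ?thesis"
    obtain N where N: "\<And>n. n \<ge> N \<Longrightarrow> Tall (QK (K_of \<kappa>)) (drp n s) (hgt s n t)"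
      using X_eventually_Tall[OF assms] by blast
    have "\<exists>\<gamma>. ray \<kappa> (drp n s) (hgt s n t) \<gamma>" if "n \<le> N" for n
      using that
    proof (induction rule: inc_induct)
      case base
      then show ?case using ray_glim[OF K N X_drp[OF assms]] by blast
    next
      case (step n)
      have eq: "drp 1 (drp n s) = drp (Suc n) s" "hgt (drp n s) 1 (hgt s n t) = hgt s (Suc n) t"
        using hgt_drp[of n s 1 t] by auto
      from step obtain \<gamma>' where g': "ray \<kappa> (drp (Suc n) s) (hgt s (Suc n) t) \<gamma>'" by blast
      have "\<gamma>' 0 y \<noteq> \<kappa>" if y: "y \<ge> hgt s (Suc n) t" for y
      proof
        assume "\<gamma>' 0 y = \<kappa>"
        then have "gext \<kappa> (drp (Suc n) s, y) = Some \<kappa>" using ray_level[OF g' y, of 0] by simp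
        moreover obtain x where "x \<ge> t" "hgt s (Suc n) x = y" using hgt_surj[OF Xb y] by blast
        ultimately show False using no by (metis One_nat_def Suc_le_mono le0)
      qed
      then show ?case using ray_lift[OF X_drp[OF assms], of \<kappa> n \<gamma>'] g' unfolding eq by blast
    qed
    from this[of 0] none show False by (auto simp: gext_eq)
  qed
qed

lemma gext_upward:
  assumes "gext \<kappa> (s, t) \<noteq> None" "t \<le> x"
  shows "gext \<kappa> (s, x) \<noteq> None"
proof -
  obtain \<gamma> where "ray \<kappa> s t \<gamma>" using assms by (auto simp: gext_Some_iff)
  from ray_level[OF this assms(2), of 0] show ?thesis by simp
qed

lemma Y_iff: "(s, t) \<in> Y \<kappa> \<longleftrightarrow> Tall (QK (K_of \<kappa>)) s t"
  using Tall_X_bar[OF _ QK_pos(2)] by (auto simp: Y_def model_map_funpow T_def Q_of_eq Tall_def)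

lemma is_g_extension_gext: "is_g_extension \<kappa> (gext \<kappa>)"
  unfolding is_g_extension_def
proof (intro conjI allI ballI impI)
  fix p assume "p \<in> Y \<kappa> \<inter> X"
  then show "gext \<kappa> p = Some (g_limit \<kappa> p)"
    using gext_glim[OF K_of] by (cases p) (auto simp: Y_iff)
next
  fix p w assume "gext \<kappa> p = Some w"
  then show "gext \<kappa> (model_map p) = Some (E \<kappa> w)"
    using gext_step by (cases p) (simp add: model_map_eq)
next
  fix s
  show "continuous_on {t. (s, t) \<in> dom (gext \<kappa>)} (\<lambda>t. the (gext \<kappa> (s, t)))" (is "continuous_on ?D ?f")
    unfolding continuous_on_eq_continuous_within
  proof
    fix t assume t: "t \<in> ?D"
    show "continuous (at t within ?D) ?f"
    \<comment> \<open>The domain is upward closed in each fibre. At a point with a lower neighbour,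
      a ray started below gives two-sided continuity; otherwise the point is the minimum and its own
      ray suffices.\<close>
    proof (cases "\<exists>t'\<in>?D. t' < t")
      case True
      then obtain t' where t': "t' \<in> ?D" "t' < t" by blast
      then obtain \<gamma> where g: "ray \<kappa> s t' \<gamma>" by (auto simp: gext_Some_iff)
      have "continuous_on {t'<..} (\<gamma> 0)" by (rule continuous_on_subset[OF rayD(2)[OF g]]) auto
      moreover have "?f x = \<gamma> 0 x" if "x \<in> {t'<..}" for x using ray_level[OF g, of x 0] that by simp
      ultimately have "continuous_on {t'<..} ?f" by (rule continuous_on_eq[OF _ sym])
      then have "continuous (at t) ?f" using t' by (simp add: continuous_on_eq_continuous_at)
      then show ?thesis by (rule continuous_at_imp_continuous_at_within)
    next
      case False
      have D: "?D = {t..}"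
      proof (intro set_eqI iffI)
        fix x assume "x \<in> {t..}"
        then show "x \<in> ?D" using gext_upward[of \<kappa> s t x] t by (simp add: domIff)
      next
        fix x assume "x \<in> ?D"
        then show "x \<in> {t..}" using False by (meson atLeast_iff not_less)
      qed
      obtain \<gamma> where g: "ray \<kappa> s t \<gamma>" using t by (auto simp: gext_Some_iff)
      have "?f x = \<gamma> 0 x" if "x \<in> {t..}" for x using ray_level[OF g, of x 0] that by simp
      then have "continuous_on {t..} ?f" by (rule continuous_on_eq[OF rayD(2)[OF g, of 0] sym])
      then show ?thesis unfolding D by (simp add: continuous_on_eq_continuous_within)
    qed
  qed
next
  show "if \<kappa> \<notin> escaping_set \<kappa> then dom (gext \<kappa>) = X
    else \<exists>s0 t0. (s0, t0) \<in> X \<and> gext \<kappa> (s0, t0) = Some \<kappa> \<and>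
      dom (gext \<kappa>) = X - {p. \<exists>n\<ge>1. \<exists>t'\<le>t0. (model_map ^^ n) p = (s0, t')}"
  proof (cases "\<kappa> \<in> escaping_set \<kappa>")
    case False
    then have "gext \<kappa> (s, t) \<noteq> None" if "(s, t) \<in> X" for s t
      using gext_None_iff[OF that] gext_escaping by blast
    then have "dom (gext \<kappa>) = X" using gext_X by (auto simp: dom_def)
    then show ?thesis using False by simp
  next
    case True
    obtain s0 t0 where st: "gext \<kappa> (s0, t0) = Some \<kappa>" using escaping_parameter_on_ray[OF True] .
    \<comment> \<open>By injectivity, (s0, t0) is the only point with value \<kappa>. Since heights
      over an address take all larger values, level \<open>n\<close> meets \<kappa> at or above
      \<open>t\<close> exactly if \<open>drp n s\<close> is s0 and the height there is at most
      t0.\<close>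
    have key: "gext \<kappa> (s, t) = None \<longleftrightarrow> (\<exists>n\<ge>1. \<exists>t'\<le>t0. (model_map ^^ n) (s, t) = (s0, t'))"
      if X: "(s, t) \<in> X" for s t
    proof -
      have Xb: "(s, t) \<in> X_bar" using X by (rule X_subset_X_bar)
      have "(\<exists>x\<ge>t. gext \<kappa> (drp n s, hgt s n x) = Some \<kappa>) \<longleftrightarrow> drp n s = s0 \<and> hgt s n t \<le> t0" for n
      proof
        assume "\<exists>x\<ge>t. gext \<kappa> (drp n s, hgt s n x) = Some \<kappa>"
        then obtain x where "x \<ge> t" "gext \<kappa> (drp n s, hgt s n x) = Some \<kappa>" by blast
        with gext_inj[OF this(2) st] hgt_mono[OF Xb, of x n] show "drp n s = s0 \<and> hgt s n t \<le> t0" by auto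
      next
        assume a: "drp n s = s0 \<and> hgt s n t \<le> t0"
        then obtain x where "x \<ge> t" "hgt s n x = t0" using hgt_surj[OF Xb] by blast
        then show "\<exists>x\<ge>t. gext \<kappa> (drp n s, hgt s n x) = Some \<kappa>" using a st by blast
      qed
      then show ?thesis unfolding gext_None_iff[OF X] model_map_funpow by auto
    qed
    have "dom (gext \<kappa>) = X - {p. \<exists>n\<ge>1. \<exists>t'\<le>t0. (model_map ^^ n) p = (s0, t')}"
    proof (rule set_eqI)
      fix p :: "address \<times> real"
      obtain a b where p: "p = (a, b)" by (cases p)
      show "p \<in> dom (gext \<kappa>) \<longleftrightarrow> p \<in> X - {p. \<exists>n\<ge>1. \<exists>t'\<le>t0. (model_map ^^ n) p = (s0, t')}"
      proof (cases "(a, b) \<in> X")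
        case True
        then show ?thesis using key[OF True] by (simp add: domIff p)
      next
        case False
        then show ?thesis using gext_X[of \<kappa> a b] by (auto simp: p)
      qed
    qed
    then show ?thesis using True st gext_X[OF st] by auto
  qed
qed

text \<open>The domain of any extension is upward closed and forward invariant, so the values along
  a half-line and its images form a ray, and the extension agrees with \<open>gext\<close> on its
  domain. In the escaping case the point with value \<kappa> is then the same for both by
  injectivity, so the domains agree too.\<close>

lemma is_g_extension_unique:
  assumes g: "is_g_extension \<kappa> g"
  shows "g = gext \<kappa>"
proof -
  note K = K_of[of \<kappa>]
  have lim: "g (s, t) = Some (glim \<kappa> s t)" if "Tall (QK (K_of \<kappa>)) s t" "(s, t) \<in> X" for s t
    using g that by (auto simp: is_g_extension_def Y_iff)
  have step: "g (drp 1 s, hgt s 1 t) = Some (E \<kappa> w)" if "g (s, t) = Some w" for s t w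
    using g that unfolding is_g_extension_def by (metis model_map_eq)
  have cont: "continuous_on {t. (s, t) \<in> dom g} (\<lambda>t. the (g (s, t)))" for s
    using g unfolding is_g_extension_def by blast
  have domain: "if \<kappa> \<notin> escaping_set \<kappa> then dom g = X
      else \<exists>s0 t0. (s0, t0) \<in> X \<and> g (s0, t0) = Some \<kappa> \<and>
        dom g = X - {p. \<exists>n\<ge>1. \<exists>t'\<le>t0. (model_map ^^ n) p = (s0, t')}"
    using g unfolding is_g_extension_def by blast
  have sub: "dom g \<subseteq> X" using domain by (auto split: if_splits)
  have up: "(s, x) \<in> dom g" if st: "(s, t) \<in> dom g" and x: "t \<le> x" for s t x
  proof -
    have X: "(s, t) \<in> X" "(s, x) \<in> X" using sub st X_upward[OF _ x] by blast+
    have mono: "hgt s n t \<le> hgt s n x" for n by (rule hgt_mono[OF X_subset_X_bar[OF X(1)] x])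
    show ?thesis
    proof (cases "\<kappa> \<in> escaping_set \<kappa>")
      case False
      then show ?thesis using domain X by simp
    next
      case True
      then obtain s0 t0 where d: "dom g = X - {p. \<exists>n\<ge>1. \<exists>t'\<le>t0. (model_map ^^ n) p = (s0, t')}"
        using domain by auto
      show ?thesis using st X mono unfolding d by (auto simp: model_map_funpow intro: order_trans)
    qed
  qed
  have iter: "(drp n s, hgt s n t) \<in> dom g" if "(s, t) \<in> dom g" for n s t
  proof (induction n)
    case (Suc n)
    then show ?case using step[of "drp n s" "hgt s n t"] hgt_drp[of n s 1 t] by auto
  qed (use that in simp)
  have extends: "gext \<kappa> (s, t) = g (s, t)" if d: "(s, t) \<in> dom g" for s t
  proof -
    define \<gamma> where "\<gamma> n x = the (g (drp n s, hgt s n x))" for n x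
    have X: "(s, t) \<in> X" using sub d by blast
    have Xb: "(s, t) \<in> X_bar" using X by (rule X_subset_X_bar)
    have dn: "(drp n s, hgt s n x) \<in> dom g" if "x \<ge> t" for n x using iter[OF up[OF d that]] .
    have "ray \<kappa> s t \<gamma>"
      unfolding ray_def
    proof (intro conjI allI impI)
      show "continuous_on {t..} (\<gamma> n)" for n
        unfolding \<gamma>_def
        by (rule continuous_on_compose2[OF cont[of "drp n s"]]) (use dn in \<open>auto intro!: continuous_intros\<close>)
      show "exp (\<gamma> n x) = \<gamma> (Suc n) x - \<kappa>" if tx: "t \<le> x" for n x
      proof -
        obtain w where w: "g (drp n s, hgt s n x) = Some w" using dn[OF tx] by blast
        show ?thesis using step[OF w] hgt_drp[of n s 1 x] w by (simp add: \<gamma>_def E_def)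
      qed
      have talls: "\<gamma> n x = glim \<kappa> (drp n s) (hgt s n x)"
        if "x \<ge> t" "Tall (QK (K_of \<kappa>)) (drp n s) (hgt s n x)" for n x
        using lim[OF that(2) X_drp[OF X_upward[OF X that(1)]]] by (simp add: \<gamma>_def)
      obtain N where N: "\<And>n. n \<ge> N \<Longrightarrow> Tall (QK (K_of \<kappa>)) (drp n s) (hgt s n t)"
        using X_eventually_Tall[OF X] by blast
      show "\<exists>N. \<forall>n\<ge>N. \<forall>x\<ge>t. \<gamma> n x = glim \<kappa> (drp n s) (hgt s n x)"
        using talls Tall_upward[OF N QK_pos(2) hgt_mono[OF Xb]] by blast
      have "\<gamma> n x = glim \<kappa> (drp n s) (hgt s n x)" if "x \<ge> t + \<bar>QK (K_of \<kappa>)\<bar>" for n x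
        by (rule talls) (use that in \<open>auto intro!: Tall_drp Tall_large[OF Xb]\<close>)
      then show "\<exists>b. \<forall>x\<ge>b. \<gamma> n x = glim \<kappa> (drp n s) (hgt s n x)" for n by blast
    qed (rule X)
    from gext_eq[OF this] show ?thesis using d by (auto simp: \<gamma>_def)
  qed
  note gext = is_g_extension_gext[of \<kappa>]
  have "dom g = dom (gext \<kappa>)"
  proof (cases "\<kappa> \<in> escaping_set \<kappa>")
    case False
    then show ?thesis using domain gext unfolding is_g_extension_def by simp
  next
    case True
    then obtain s0 t0 where 0: "g (s0, t0) = Some \<kappa>"
        "dom g = X - {p. \<exists>n\<ge>1. \<exists>t'\<le>t0. (model_map ^^ n) p = (s0, t')}"
      using domain by auto
    obtain s1 t1 where 1: "gext \<kappa> (s1, t1) = Some \<kappa>"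
        "dom (gext \<kappa>) = X - {p. \<exists>n\<ge>1. \<exists>t'\<le>t1. (model_map ^^ n) p = (s1, t')}"
      using True gext unfolding is_g_extension_def by auto
    have "gext \<kappa> (s0, t0) = Some \<kappa>" using extends[of s0 t0] 0(1) by auto
    from gext_inj[OF this 1(1)] show ?thesis using 0(2) 1(2) by simp
  qed
  then show ?thesis
    using extends by (intro ext) (metis domIff old.prod.exhaust)
qed

lemma g_map_eq: "g_map \<kappa> = gext \<kappa>"
  unfolding g_map_def using is_g_extension_gext is_g_extension_unique by (rule the_equality)

section \<open>Continuity and holomorphy in the parameter\<close>

text \<open>Unlike \<open>at a within S\<close>, this filter sees the point \<open>a\<close> itself.\<close>

abbreviation nbh :: "'a::topological_space \<Rightarrow> 'a set \<Rightarrow> 'a filter" where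
  "nbh a S \<equiv> inf (nhds a) (principal S)"

text \<open>The tube lemma: finitely many product neighbourhoods cover the compact set, and their
  first factors are intersected. The restriction to \<open>S\<close> and \<open>D\<close> is carried
  along because continuity of g is only available relative to \<open>Deep d\<close>.\<close>

lemma tube_eventually:
  fixes a :: "'a::topological_space" and C :: "'b::topological_space set"
  assumes "compact C" "C \<subseteq> D" and Q: "\<And>x. x \<in> C \<Longrightarrow> eventually Q (nbh (a, x) (S \<times> D))"
  shows "\<forall>\<^sub>F l in nbh a S. \<forall>x\<in>C. Q (l, x)"
proof -
  have "\<exists>U V. open U \<and> open V \<and> a \<in> U \<and> x \<in> V \<and> (\<forall>l\<in>U. \<forall>y\<in>V. l \<in> S \<longrightarrow> y \<in> D \<longrightarrow> Q (l, y))"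
    if "x \<in> C" for x
  proof -
    have "eventually (\<lambda>p. p \<in> S \<times> D \<longrightarrow> Q p) (nhds (a, x))"
      using Q[OF that] by (simp add: eventually_inf_principal)
    then obtain W where W: "open W" "(a, x) \<in> W" "\<And>p. p \<in> W \<Longrightarrow> p \<in> S \<times> D \<longrightarrow> Q p"
      by (auto simp: eventually_nhds)
    obtain U V where "open U" "open V" "(a, x) \<in> U \<times> V" "U \<times> V \<subseteq> W"
      using open_prod_elim[OF W(1,2)] by blast
    then show ?thesis using W(3) by (intro exI[of _ U] exI[of _ V]) auto
  qed
  then obtain U V where UV: "\<And>x. x \<in> C \<Longrightarrow> open (U x) \<and> open (V x) \<and> a \<in> U x \<and> x \<in> V x \<and>
      (\<forall>l\<in>U x. \<forall>y\<in>V x. l \<in> S \<longrightarrow> y \<in> D \<longrightarrow> Q (l, y))"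
    by metis
  obtain C' where C': "C' \<subseteq> C" "finite C'" "C \<subseteq> (\<Union>x\<in>C'. V x)"
    using compactE_image[OF assms(1), of C V] UV by (metis UN_I subsetI)
  have "\<forall>\<^sub>F l in nhds a. l \<in> (\<Inter>x\<in>C'. U x)"
    by (rule eventually_nhds_in_open) (use C' UV in auto)
  then show ?thesis
    unfolding eventually_inf_principal
  proof eventually_elim
    case (elim l)
    show ?case
    proof (intro impI ballI)
      fix y assume "l \<in> S" "y \<in> C"
      then obtain x where "x \<in> C'" "y \<in> V x" using C'(3) by blast
      then show "Q (l, y)" using UV[of x] C'(1) elim \<open>l \<in> S\<close> \<open>y \<in> C\<close> assms(2) by blast
    qed
  qed
qed

definition val :: "complex \<times> address \<times> real \<Rightarrow> complex" where
  "val = (\<lambda>(\<kappa>, s, t). the (gext \<kappa> (s, t)))"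

definition good :: "complex \<times> address \<times> real \<Rightarrow> bool" where
  "good = (\<lambda>(\<kappa>, s, t). gext \<kappa> (s, t) \<noteq> None)"

lemma good_iff: "good (\<kappa>, s, t) \<longleftrightarrow> (\<exists>\<gamma>. ray \<kappa> s t \<gamma>)"
  by (auto simp: good_def gext_Some_iff)

lemma gext_val: "good (\<kappa>, s, t) \<Longrightarrow> gext \<kappa> (s, t) = Some (val (\<kappa>, s, t))"
  by (auto simp: good_def val_def)

lemma val_eqI: "gext \<kappa> (s, t) = Some w \<Longrightarrow> good (\<kappa>, s, t) \<and> val (\<kappa>, s, t) = w"
  by (auto simp: good_def val_def)

lemma tendsto_nbh_components:
  "(fst \<longlongrightarrow> a) (nbh (a, b, c) S)" "((\<lambda>l. fst (snd l)) \<longlongrightarrow> b) (nbh (a, b, c) S)"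
  "((\<lambda>l. snd (snd l)) \<longlongrightarrow> c) (nbh (a, b, c) S)"
proof -
  have id: "((\<lambda>l. l) \<longlongrightarrow> (a, b, c)) (nbh (a, b, c) S)"
    by (intro filterlim_mono[OF filterlim_ident]) auto
  show "(fst \<longlongrightarrow> a) (nbh (a, b, c) S)" "((\<lambda>l. fst (snd l)) \<longlongrightarrow> b) (nbh (a, b, c) S)"
    "((\<lambda>l. snd (snd l)) \<longlongrightarrow> c) (nbh (a, b, c) S)"
    using tendsto_fst[OF id] tendsto_fst[OF tendsto_snd[OF id]] tendsto_snd[OF tendsto_snd[OF id]] by simp_all
qed

text \<open>Definedness nearby is part of the notion, since a ray close to an unblocked one must be
  shown to be unblocked. The argument \<open>d\<close> is explicit because the induction passes from
  \<open>d\<close> to \<open>F d\<close>.\<close>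

definition val_cont :: "real \<Rightarrow> complex \<Rightarrow> address \<Rightarrow> real \<Rightarrow> bool" where
  "val_cont d \<kappa> s t \<longleftrightarrow> eventually good (nbh (\<kappa>, s, t) (UNIV \<times> Deep d)) \<and>
     (val \<longlongrightarrow> val (\<kappa>, s, t)) (nbh (\<kappa>, s, t) (UNIV \<times> Deep d))"

lemma Deep_gext_glim:
  assumes "K > 2 * pi + 6" "norm \<kappa> \<le> K" "QK K \<le> d" "(s, t) \<in> Deep d"
  shows "Tall (QK K) s t" "gext \<kappa> (s, t) = Some (glim \<kappa> s t)"
proof -
  have d: "0 < d" using assms(3) QK_pos(1)[of K] by linarith
  show T: "Tall (QK K) s t" using Deep_Tall[OF assms(4), of "QK K" 0] d assms(3) by simp
  show "gext \<kappa> (s, t) = Some (glim \<kappa> s t)"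
    by (rule gext_glim[OF assms(1,2) T Deep_X[OF assms(4) d]])
qed

lemma val_cont_base:
  assumes K: "K > 2 * pi + 6" "norm \<kappa> < K" and d: "QK K \<le> d" and st: "(s, t) \<in> Deep d"
  shows "val_cont d \<kappa> s t"
proof -
  let ?Fl = "nbh (\<kappa>, s, t) (UNIV \<times> Deep d)"
  have "\<forall>\<^sub>F l in ?Fl. norm (fst l) < K"
    by (rule order_tendstoD(2)[OF tendsto_norm[OF tendsto_nbh_components(1)] K(2)])
  moreover have "\<forall>\<^sub>F l in ?Fl. snd l \<in> Deep d"
    by (simp add: eventually_inf_principal mem_Times_iff)
  ultimately have ev: "\<forall>\<^sub>F l in ?Fl. norm (fst l) \<le> K \<and> Tall (QK K) (fst (snd l)) (snd (snd l)) \<and>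
      good l \<and> glim (fst l) (fst (snd l)) (snd (snd l)) = val l"
  proof eventually_elim
    case (elim l)
    obtain k a b where l: "l = (k, a, b)" by (metis prod_cases3)
    show ?case using Deep_gext_glim[OF K(1) _ d, of k a b] elim val_eqI[of k a b] by (auto simp: l)
  qed
  have "((\<lambda>l. glim (fst l) (fst (snd l)) (snd (snd l))) \<longlongrightarrow> glim \<kappa> s t) ?Fl"
    by (rule glim_tendsto_joint[OF K(1) tendsto_nbh_components(1) _ _ tendsto_nbh_components(2,3)])
      (use K d Deep_gext_glim(1)[OF K(1) _ d st, of \<kappa>] ev in \<open>auto elim: eventually_mono\<close>)
  moreover have "glim \<kappa> s t = val (\<kappa>, s, t)"
    using Deep_gext_glim(2)[OF K(1) _ d st, of \<kappa>] K val_eqI by force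
  ultimately have "(val \<longlongrightarrow> val (\<kappa>, s, t)) ?Fl"
    using Lim_transform_eventually[of "\<lambda>l. glim (fst l) (fst (snd l)) (snd (snd l))" _ ?Fl val]
      eventually_mono[OF ev] by force
  moreover have "eventually good ?Fl" using ev by (auto elim: eventually_mono)
  ultimately show ?thesis by (simp add: val_cont_def)
qed

text \<open>Joint continuity is pulled back through one logarithm. On a compact piece of length
  \<open>QK K\<close> of the half-line, the image of a nearby point, seen from its parameter, is
  close in ratio to that of the given point, so it avoids the parameter there; beyond that piece the
  point is tall and the limit map avoids it. The two lifts then differ by the principal logarithm of
  the ratio, up to a multiple of 2 pi i that is excluded at the far end.\<close>

lemma val_cont_step:
  assumes K: "K > 2 * pi + 6" "norm \<kappa> < K" and d: "0 < d" and st: "(s, t) \<in> Deep d"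
    and g: "good (\<kappa>, s, t)"
    and IH: "\<And>s t. (s, t) \<in> Deep (F d) \<Longrightarrow> good (\<kappa>, s, t) \<Longrightarrow> val_cont (F d) \<kappa> s t"
  shows "val_cont d \<kappa> s t"
proof -
  let ?Fl = "nbh (\<kappa>, s, t) (UNIV \<times> Deep d)"
  obtain \<gamma> where \<gamma>: "ray \<kappa> s t \<gamma>" using g by (auto simp: good_iff)
  define b where "b = QK K"
  have b: "0 \<le> b" using QK_pos(2) by (simp add: b_def)
  \<comment> \<open>\<Phi> raises the perturbed point by \<open>x\<close> and applies the model map;
    \<rho> is the quotient of the two image values, each taken relative to its own parameter, hence
    the quotient of the exponentials one level below.\<close>
  define \<Phi> where "\<Phi> = (\<lambda>((k, a, u), x). (k, drp 1 a, hgt a 1 (u + x)) :: complex \<times> address \<times> real)"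
  define \<rho> where "\<rho> p = (val (\<Phi> p) - fst (fst p)) / (\<gamma> 1 (t + snd p) - \<kappa>)" for p :: "(complex \<times> address \<times> real) \<times> real"
  have g1: "\<gamma> 1 y - \<kappa> \<noteq> 0" if "y \<ge> t" for y
    using rayD(3)[OF \<gamma> that, of 0] by (metis One_nat_def exp_not_eq_zero)
  have tall: "Tall (QK K) a (u + x)" if "(a, u) \<in> Deep d" "x \<ge> b" for a u x
    using that d QK_pos(2)[of K] by (intro Tall_large[OF Deep_X_bar[OF that(1)]]) (auto simp: b_def)
  have local: "\<forall>\<^sub>F p in nbh ((\<kappa>, s, t), x) ((UNIV \<times> Deep d) \<times> {0..}). good (\<Phi> p) \<and> norm (\<rho> p - 1) < e"
    if x: "0 \<le> x" and e: "0 < e" for x e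
  proof -
    let ?G = "nbh ((\<kappa>, s, t), x) ((UNIV \<times> Deep d) \<times> {0..})"
    have id: "((\<lambda>p. p) \<longlongrightarrow> ((\<kappa>, s, t), x)) ?G"
      by (intro filterlim_mono[OF filterlim_ident]) auto
    note f = tendsto_fst[OF id, unfolded fst_conv] and xlim = tendsto_snd[OF id, unfolded snd_conv]
    note flims = tendsto_fst[OF f, unfolded fst_conv] tendsto_fst[OF tendsto_snd[OF f], unfolded fst_conv snd_conv]
      tendsto_snd[OF tendsto_snd[OF f], unfolded snd_conv]
    have "((\<lambda>p. (fst (fst p), drp 1 (fst (snd (fst p))), hgt (fst (snd (fst p))) 1 (snd (snd (fst p)) + snd p)))
        \<longlongrightarrow> (\<kappa>, drp 1 s, hgt s 1 (t + x))) ?G"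
      by (intro tendsto_Pair tendsto_drp tendsto_hgt tendsto_add flims xlim)
    moreover have "\<Phi> = (\<lambda>p. (fst (fst p), drp 1 (fst (snd (fst p))), hgt (fst (snd (fst p))) 1 (snd (snd (fst p)) + snd p)))"
      by (auto simp: \<Phi>_def)
    ultimately have "(\<Phi> \<longlongrightarrow> (\<kappa>, drp 1 s, hgt s 1 (t + x))) ?G" by simp
    moreover have inG: "\<forall>\<^sub>F p in ?G. p \<in> (UNIV \<times> Deep d) \<times> {0..}"
      by (auto simp: eventually_inf_principal)
    then have "\<forall>\<^sub>F p in ?G. \<Phi> p \<in> UNIV \<times> Deep (F d)"
    proof eventually_elim
      case (elim p)
      then show ?case using Deep_drp[OF Deep_upward, of _ _ d] d by (auto simp: \<Phi>_def)
    qed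
    ultimately have \<Phi>: "filterlim \<Phi> (nbh (\<kappa>, drp 1 s, hgt s 1 (t + x)) (UNIV \<times> Deep (F d))) ?G"
      by (simp add: filterlim_inf filterlim_principal)
    have "gext \<kappa> (drp 1 s, hgt s 1 (t + x)) = Some (\<gamma> 1 (t + x))"
      using ray_level[OF \<gamma>, of "t + x" 1] x by simp
    note v = val_eqI[OF this]
    have "(drp 1 s, hgt s 1 (t + x)) \<in> Deep (F d)"
      using Deep_drp[OF Deep_upward[OF st, of "t + x"]] d x by simp
    from IH[OF this] v have vc: "val_cont (F d) \<kappa> (drp 1 s) (hgt s 1 (t + x))" by blast
    have "\<forall>\<^sub>F p in ?G. good (\<Phi> p)"
      using vc \<Phi> unfolding val_cont_def by (auto simp: filterlim_iff)
    moreover have vlim: "((\<lambda>p. val (\<Phi> p)) \<longlongrightarrow> \<gamma> 1 (t + x)) ?G"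
      using vc filterlim_compose[OF _ \<Phi>] v unfolding val_cont_def by auto
    have "((\<lambda>p. \<gamma> 1 (t + snd p)) \<longlongrightarrow> \<gamma> 1 (t + x)) ?G"
    proof (rule continuous_on_tendsto_compose[OF rayD(2)[OF \<gamma>]])
      show "((\<lambda>p. t + snd p) \<longlongrightarrow> t + x) ?G" by (intro tendsto_intros xlim)
      show "\<forall>\<^sub>F p in ?G. t + snd p \<in> {t..}" using inG by (auto elim: eventually_mono)
    qed (use x in auto)
    then have "(\<rho> \<longlongrightarrow> (\<gamma> 1 (t + x) - \<kappa>) / (\<gamma> 1 (t + x) - \<kappa>)) ?G"
      unfolding \<rho>_def using g1[of "t + x"] x by (intro tendsto_intros vlim flims) auto
    then have "(\<rho> \<longlongrightarrow> 1) ?G" using g1[of "t + x"] x by simp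
    then have "\<forall>\<^sub>F p in ?G. dist (\<rho> p) 1 < e" using e by (simp add: tendsto_iff)
    ultimately show ?thesis by eventually_elim (simp add: dist_norm)
  qed
  have glims: "((\<lambda>l. glim (fst l) (fst (snd l)) (snd (snd l) + b)) \<longlongrightarrow> glim \<kappa> s (t + b)) ?Fl"
  proof (rule glim_tendsto_joint[OF K(1) tendsto_nbh_components(1) _ _ tendsto_nbh_components(2)])
    show "\<forall>\<^sub>F l in ?Fl. norm (fst l) \<le> K"
      by (rule eventually_mono[OF order_tendstoD(2)[OF tendsto_norm[OF tendsto_nbh_components(1)] K(2)]]) simp
    show "((\<lambda>l. snd (snd l) + b) \<longlongrightarrow> t + b) ?Fl" by (intro tendsto_intros tendsto_nbh_components)
    show "\<forall>\<^sub>F l in ?Fl. Tall (QK K) (fst (snd l)) (snd (snd l) + b)"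
      using tall by (auto simp: eventually_inf_principal intro!: always_eventually)
  qed (use K tall[OF st] in auto)
  have main: "\<forall>\<^sub>F l in ?Fl. good l \<and> norm (val l - val (\<kappa>, s, t)) \<le> 2 * e" if e: "0 < e" "e < 1/4" for e
  proof -
    have "\<forall>\<^sub>F l in ?Fl. \<forall>x\<in>{0..b}. good (\<Phi> (l, x)) \<and> norm (\<rho> (l, x) - 1) < e"
      by (rule tube_eventually[where D = "{0..}"]) (use local e in auto)
    moreover have "\<forall>\<^sub>F l in ?Fl. norm (fst l) < K"
      by (rule order_tendstoD(2)[OF tendsto_norm[OF tendsto_nbh_components(1)] K(2)])
    moreover have "\<forall>\<^sub>F l in ?Fl. snd l \<in> Deep d"
      by (simp add: eventually_inf_principal mem_Times_iff)
    moreover have "\<forall>\<^sub>F l in ?Fl. dist (glim (fst l) (fst (snd l)) (snd (snd l) + b)) (glim \<kappa> s (t + b)) < e"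
      using glims e by (simp add: tendsto_iff)
    ultimately show ?thesis
    proof eventually_elim
      case (elim l)
      obtain k a u where l: "l = (k, a, u)" by (metis prod_cases3)
      have au: "(a, u) \<in> Deep d" and k: "norm k \<le> K" using elim by (auto simp: l)
      have X: "(a, u) \<in> X" using Deep_X[OF au d] .
      have Xb: "(a, u) \<in> X_bar" using X by (rule X_subset_X_bar)
      have good1: "good (k, drp 1 a, hgt a 1 (u + x))"
        and rho: "norm (\<rho> ((k, a, u), x) - 1) < e" if "0 \<le> x" "x \<le> b" for x
        using elim(1) that by (auto simp: l \<Phi>_def)
      obtain \<gamma>' where \<gamma>': "ray k (drp 1 a) (hgt a 1 u) \<gamma>'"
        using good1[of 0] b by (auto simp: good_iff)
      have lev: "\<gamma>' 0 (hgt a 1 (u + x)) = val (k, drp 1 a, hgt a 1 (u + x))" if "0 \<le> x" for x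
        using ray_level[OF \<gamma>' hgt_mono[OF Xb, of "u + x"], of 0] that by (simp add: val_def)
      have rho_eq: "\<rho> ((k, a, u), x) * (\<gamma> 1 (t + x) - \<kappa>) = \<gamma>' 0 (hgt a 1 (u + x)) - k" if "0 \<le> x" for x
        using g1[of "t + x"] that lev[OF that] by (simp add: \<rho>_def \<Phi>_def)
      have rho_slit: "\<rho> ((k, a, u), x) \<notin> \<real>\<^sub>\<le>\<^sub>0" if x: "0 \<le> x" "x \<le> b" for x
      proof -
        have "\<bar>Re (\<rho> ((k, a, u), x) - 1)\<bar> < e" using rho[OF x] abs_Re_le_cmod le_less_trans by blast
        then show ?thesis using e by (auto simp: complex_nonpos_Reals_iff)
      qed
      \<comment> \<open>Up to height \<open>b\<close> above \<open>u\<close> the ratio is nonzero;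
        above that the value differs from \<open>k\<close> by an exponential of the limit
        map.\<close>
      have "\<gamma>' 0 y \<noteq> k" if y: "y \<ge> hgt a 1 u" for y
      proof -
        obtain z where z: "z \<ge> u" "hgt a 1 z = y" using hgt_surj[OF Xb y] by blast
        show ?thesis
        proof (cases "z - u \<le> b")
          case True
          have "\<rho> ((k, a, u), z - u) \<noteq> 0" using rho_slit[of "z - u"] True z(1) by auto
          then show ?thesis using rho_eq[of "z - u"] g1[of "t + (z - u)"] z by auto
        next
          case False
          then have T: "Tall (QK K) a z" using tall[OF au, of "z - u"] by simp
          have "\<gamma>' 0 y = glim k (drp 1 a) y"
            using ray_eq_glim[OF K(1) k \<gamma>' y, of 0] Tall_drp[OF T, of 1] z(2) by simp
          moreover have "exp (glim k a z) = glim k (drp 1 a) y - k" using glim_exp[OF K(1) k T] z(2) by simp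
          ultimately show ?thesis by (metis exp_not_eq_zero right_minus_eq)
        qed
      qed
      then obtain \<delta> where \<delta>: "ray k a u \<delta>" "\<And>n x. x \<ge> u \<Longrightarrow> \<delta> (Suc n) x = \<gamma>' n (hgt a 1 x)"
        using ray_lift[OF X \<gamma>'] by blast
      define q where "q x = \<gamma> 0 (t + x) + Ln (\<rho> ((k, a, u), x))" for x
      have exp_eq: "exp (\<delta> 0 (u + x)) = exp (q x)" if x: "x \<in> {0..b}" for x
      proof -
        have "\<rho> ((k, a, u), x) \<noteq> 0" using rho_slit[of x] x by auto
        then have "exp (q x) = (\<gamma> 1 (t + x) - \<kappa>) * \<rho> ((k, a, u), x)"
          using rayD(3)[OF \<gamma>, of "t + x" 0] x by (simp add: q_def exp_add)
        also have "\<dots> = \<gamma>' 0 (hgt a 1 (u + x)) - k" using rho_eq[of x] x by (simp add: mult.commute)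
        also have "\<dots> = exp (\<delta> 0 (u + x))" using rayD(3)[OF \<delta>(1), of "u + x" 0] \<delta>(2)[of "u + x" 0] x by simp
        finally show ?thesis by simp
      qed
      have "continuous_on {0..b} (\<lambda>x. \<gamma>' 0 (hgt a 1 (u + x)))"
        by (rule continuous_on_compose2[OF rayD(2)[OF \<gamma>', of 0]])
          (use hgt_mono[OF Xb] in \<open>auto intro!: continuous_intros\<close>)
      moreover have c\<gamma>: "continuous_on {0..b} (\<lambda>x. \<gamma> n (t + x))" for n
        by (rule continuous_on_compose2[OF rayD(2)[OF \<gamma>, of n]]) (auto intro!: continuous_intros)
      ultimately have "continuous_on {0..b} (\<lambda>x. (\<gamma>' 0 (hgt a 1 (u + x)) - k) / (\<gamma> 1 (t + x) - \<kappa>))"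
        using g1 by (intro continuous_intros) auto
      then have "continuous_on {0..b} (\<lambda>x. \<rho> ((k, a, u), x))"
        by (rule continuous_on_eq) (use lev in \<open>simp add: \<rho>_def \<Phi>_def\<close>)
      then have cq: "continuous_on {0..b} q"
        unfolding q_def using rho_slit by (intro continuous_intros c\<gamma>) auto
      have c\<delta>: "continuous_on {0..b} (\<lambda>x. \<delta> 0 (u + x))"
        by (rule continuous_on_compose2[OF rayD(2)[OF \<delta>(1), of 0]]) (auto intro!: continuous_intros)
      obtain m :: int where m: "\<And>x. x \<in> {0..b} \<Longrightarrow> \<delta> 0 (u + x) = q x + 2 * of_real pi * \<i> * of_int m"
        using exp_lifts[OF connected_Icc c\<delta> cq exp_eq] by blast
      have lnrho: "norm (Ln (\<rho> ((k, a, u), x))) \<le> 2 * e" if "0 \<le> x" "x \<le> b" for x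
        using norm_Ln_le[of "\<rho> ((k, a, u), x) - 1"] rho[OF that] e by simp
      \<comment> \<open>At the far end \<open>b\<close> both rays are given by the limit map, whose
        joint continuity is known; the discrepancy there is below \<open>3 * e\<close>, less than 2
        pi.\<close>
      have "m = 0"
      proof -
        have "\<delta> 0 (u + b) = glim k a (u + b)"
          using ray_eq_glim[OF K(1) k \<delta>(1), of "u + b" 0] tall[OF au, of b] b by simp
        moreover have "\<gamma> 0 (t + b) = glim \<kappa> s (t + b)"
          using ray_eq_glim[OF K(1) less_imp_le[OF K(2)] \<gamma>, of "t + b" 0] tall[OF st, of b] b by simp
        ultimately have "2 * of_real pi * \<i> * of_int m = (glim k a (u + b) - glim \<kappa> s (t + b)) - Ln (\<rho> ((k, a, u), b))"
          using m[of b] b by (simp add: q_def algebra_simps)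
        also have "norm \<dots> \<le> norm (glim k a (u + b) - glim \<kappa> s (t + b)) + norm (Ln (\<rho> ((k, a, u), b)))"
          by (rule norm_triangle_ineq4)
        also have "\<dots> < 3 * e" using elim(4) lnrho[of b] b by (simp add: l dist_norm)
        finally have "2 * pi * \<bar>real_of_int m\<bar> < 3 * e" by (simp add: norm_mult)
        moreover have "2 * pi * \<bar>real_of_int m\<bar> \<ge> 2 * pi * 1" if "m \<noteq> 0"
        proof (rule mult_left_mono)
          show "1 \<le> \<bar>real_of_int m\<bar>" using that by linarith
        qed simp
        ultimately show ?thesis using e pi_gt3 by (cases "m = 0") (blast, linarith)
      qed
      then have "\<delta> 0 u = \<gamma> 0 t + Ln (\<rho> ((k, a, u), 0))" using m[of 0] b by (simp add: q_def)
      moreover have "good (k, a, u) \<and> val (k, a, u) = \<delta> 0 u" by (rule val_eqI[OF gext_eq[OF \<delta>(1)]])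
      moreover have "val (\<kappa>, s, t) = \<gamma> 0 t" using val_eqI[OF gext_eq[OF \<gamma>]] by blast
      ultimately show ?case using lnrho[of 0] b by (simp add: l)
    qed
  qed
  have "eventually good ?Fl" using main[of "1/8"] by (auto elim: eventually_mono)
  moreover have "(val \<longlongrightarrow> val (\<kappa>, s, t)) ?Fl"
  proof (rule tendstoI)
    fix e :: real assume e: "0 < e"
    define e' where "e' = min (e / 4) (1/8)"
    have "0 < e'" "e' < 1/4" "2 * e' < e" using e by (auto simp: e'_def min_def)
    from main[OF this(1,2)] show "\<forall>\<^sub>F l in ?Fl. dist (val l) (val (\<kappa>, s, t)) < e"
      using \<open>2 * e' < e\<close> by (auto elim!: eventually_mono simp: dist_norm)
  qed
  ultimately show ?thesis by (simp add: val_cont_def)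
qed

lemma F_iter_reaches:
  assumes "0 < d"
  obtains n where "q \<le> (F ^^ n) d"
  using F_iter_at_top[OF assms] unfolding filterlim_at_top eventually_sequentially by blast

lemma F_iter_Suc: "(F ^^ n) (F d) = (F ^^ Suc n) d"
  by (simp only: funpow_Suc_right o_apply)

lemma val_cont:
  assumes d: "0 < d" and st: "(s, t) \<in> Deep d" and g: "good (\<kappa>, s, t)"
  shows "val_cont d \<kappa> s t"
proof -
  define K where "K = norm \<kappa> + 2 * pi + 7"
  have K: "K > 2 * pi + 6" "norm \<kappa> < K" using pi_gt3 norm_ge_zero[of \<kappa>] unfolding K_def by linarith+
  obtain n where n: "QK K \<le> (F ^^ n) d" using F_iter_reaches[OF d] .
  from n d st g show ?thesis
  proof (induction n arbitrary: d s t)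
    case 0
    then show ?case using val_cont_base[OF K] by simp
  next
    case (Suc n)
    have "0 < F d" using Suc.prems(2) F_ge_self[of d] by linarith
    show ?case
    proof (rule val_cont_step[OF K Suc.prems(2-4)])
      fix s t assume "(s, t) \<in> Deep (F d)" "good (\<kappa>, s, t)"
      with Suc.prems(1) show "val_cont (F d) \<kappa> s t"
        by (intro Suc.IH \<open>0 < F d\<close>) (simp_all only: F_iter_Suc)
    qed
  qed
qed

lemma val_tendsto:
  assumes "0 < d" "(s, t) \<in> Deep d" "good (\<kappa>, s, t)"
    and "(kf \<longlongrightarrow> \<kappa>) Fl" "(sf \<longlongrightarrow> s) Fl" "(tf \<longlongrightarrow> t) Fl" "\<forall>\<^sub>F i in Fl. (sf i, tf i) \<in> Deep d"
  shows "\<forall>\<^sub>F i in Fl. good (kf i, sf i, tf i)"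
    "((\<lambda>i. val (kf i, sf i, tf i)) \<longlongrightarrow> val (\<kappa>, s, t)) Fl"
proof -
  have "filterlim (\<lambda>i. (kf i, sf i, tf i)) (nbh (\<kappa>, s, t) (UNIV \<times> Deep d)) Fl"
    using assms(4-7) by (simp add: filterlim_inf filterlim_principal tendsto_Pair)
  with val_cont[OF assms(1-3)] show "\<forall>\<^sub>F i in Fl. good (kf i, sf i, tf i)"
    "((\<lambda>i. val (kf i, sf i, tf i)) \<longlongrightarrow> val (\<kappa>, s, t)) Fl"
    by (auto simp: val_cont_def filterlim_iff dest: filterlim_compose)
qed

lemma good_drp:
  assumes "good (\<kappa>, s, t)"
  shows "good (\<kappa>, drp 1 s, hgt s 1 t)" "val (\<kappa>, drp 1 s, hgt s 1 t) = E \<kappa> (val (\<kappa>, s, t))"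
  using gext_step[OF gext_val[OF assms]] val_eqI by blast+

lemma field_differentiable_cong_ev:
  assumes "f field_differentiable (at x)" "\<forall>\<^sub>F y in nhds x. f y = g y"
  shows "g field_differentiable (at x)"
  using assms(1) DERIV_cong_ev[OF refl assms(2) refl] unfolding field_differentiable_def by metis

text \<open>Holomorphy is inherited backwards from the limit map. The quotient \<open>h\<close> of
  exponentials equals 1 at the base parameter, and by continuity \<open>val\<close> stays within 1
  of its base value \<open>w\<close>, so near that parameter \<open>val\<close> equals
  \<open>w\<close> plus the principal logarithm of \<open>h\<close>.\<close>

lemma val_holomorphic:
  assumes d: "0 < d" and st: "(s, t) \<in> Deep d"
  shows "open {\<kappa>. good (\<kappa>, s, t)}" "(\<lambda>\<kappa>. val (\<kappa>, s, t)) holomorphic_on {\<kappa>. good (\<kappa>, s, t)}"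
proof -
  have ev: "\<forall>\<^sub>F k in nhds \<kappa>. good (k, s, t)" and cont: "((\<lambda>k. val (k, s, t)) \<longlongrightarrow> val (\<kappa>, s, t)) (nhds \<kappa>)"
    if "good (\<kappa>, s, t)" "0 < d" "(s, t) \<in> Deep d" for d \<kappa> s t
    using val_tendsto[OF that(2,3,1), of "\<lambda>k. k" "nhds \<kappa>" "\<lambda>_. s" "\<lambda>_. t"] that(3) by (auto simp: filterlim_ident)
  show "open {\<kappa>. good (\<kappa>, s, t)}"
  proof (rule iffD2[OF open_subopen], intro ballI)
    fix \<kappa> assume "\<kappa> \<in> {\<kappa>. good (\<kappa>, s, t)}"
    then have "\<forall>\<^sub>F k in nhds \<kappa>. good (k, s, t)" using ev[OF _ d st] by simp
    then obtain S where "open S" "\<kappa> \<in> S" "\<forall>k\<in>S. good (k, s, t)" unfolding eventually_nhds by metis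
    then show "\<exists>S. open S \<and> \<kappa> \<in> S \<and> S \<subseteq> {\<kappa>. good (\<kappa>, s, t)}" by (intro exI[of _ S]) auto
  qed
  have diff: "(\<lambda>k. val (k, s, t)) field_differentiable (at \<kappa>)"
    if g: "good (\<kappa>, s, t)" and d: "0 < d" and st: "(s, t) \<in> Deep d" for \<kappa> d s t
  proof -
    define K where "K = norm \<kappa> + 2 * pi + 7"
    have K: "K > 2 * pi + 6" "norm \<kappa> < K" using pi_gt3 norm_ge_zero[of \<kappa>] unfolding K_def by linarith+
    obtain n where n: "QK K \<le> (F ^^ n) d" using F_iter_reaches[OF d] .
    from n d st g show ?thesis
    proof (induction n arbitrary: d s t)
      case 0
      then have D: "QK K \<le> d" by simp
      have T: "Tall (QK K) s t" by (rule Deep_gext_glim(1)[OF K(1) less_imp_le[OF K(2)] D 0(3)])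
      have "(\<lambda>k. glim k s t) field_differentiable (at \<kappa>)"
        using glim_holomorphic[OF K(1) T] K(2)
        by (intro holomorphic_on_imp_differentiable_at[of _ "ball 0 K"]) auto
      moreover have "glim k s t = val (k, s, t)" if "k \<in> ball 0 K" for k
        using val_eqI[OF Deep_gext_glim(2)[OF K(1) _ D 0(3), of k]] that by simp
      then have "\<forall>\<^sub>F k in nhds \<kappa>. glim k s t = val (k, s, t)"
        using eventually_nhds_in_open[of "ball 0 K" \<kappa>] K(2) by (auto elim!: eventually_mono)
      ultimately show ?case
        by (rule field_differentiable_cong_ev)
    next
      case (Suc n)
      have Fd: "0 < F d" using Suc.prems(2) F_ge_self[of d] by linarith
      have st': "(drp 1 s, hgt s 1 t) \<in> Deep (F d)" by (rule Deep_drp) (use Suc.prems in auto)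
      have IH: "(\<lambda>k. val (k, drp 1 s, hgt s 1 t)) field_differentiable (at \<kappa>)"
        by (rule Suc.IH[OF _ Fd st' good_drp(1)[OF Suc.prems(4)]]) (use Suc.prems(1) in \<open>simp only: F_iter_Suc\<close>)
      define w where "w = val (\<kappa>, s, t)"
      define h where "h k = (val (k, drp 1 s, hgt s 1 t) - k) / exp w" for k
      have exp_val: "exp (val (k, s, t)) = val (k, drp 1 s, hgt s 1 t) - k" if "good (k, s, t)" for k
        using good_drp(2)[OF that] by (simp add: E_def)
      have "h \<kappa> = 1" unfolding h_def exp_val[OF Suc.prems(4), symmetric] w_def by simp
      have "h field_differentiable (at \<kappa>)"
        unfolding h_def by (intro derivative_intros IH) auto
      then have "(\<lambda>k. Ln (h k)) field_differentiable (at \<kappa>)"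
        using field_differentiable_compose[of h \<kappa> Ln] field_differentiable_at_Ln[of 1] \<open>h \<kappa> = 1\<close>
        by (simp add: o_def)
      then have lnh: "(\<lambda>k. w + Ln (h k)) field_differentiable (at \<kappa>)"
        by (intro derivative_intros)
      have "\<forall>\<^sub>F k in nhds \<kappa>. dist (val (k, s, t)) w < 1"
        using cont[OF Suc.prems(4,2,3)] by (simp add: tendsto_iff w_def)
      then have "\<forall>\<^sub>F k in nhds \<kappa>. w + Ln (h k) = val (k, s, t)"
        using ev[OF Suc.prems(4,2,3)]
      proof eventually_elim
        case (elim k)
        have "\<bar>Im (val (k, s, t) - w)\<bar> < 1"
          using elim(1) abs_Im_le_cmod[of "val (k, s, t) - w"] by (simp add: dist_norm)
        then have "Ln (exp (val (k, s, t) - w)) = val (k, s, t) - w"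
          using pi_gt3 by (intro Ln_exp) (auto simp: abs_less_iff)
        then show ?case using exp_val[OF elim(2)] by (simp add: h_def exp_diff)
      qed
      with lnh show ?case
        by (rule field_differentiable_cong_ev)
    qed
  qed
  show "(\<lambda>\<kappa>. val (\<kappa>, s, t)) holomorphic_on {\<kappa>. good (\<kappa>, s, t)}"
    unfolding holomorphic_on_def
    using diff[OF _ d st] by (auto intro: field_differentiable_at_within)
qed

section \<open>Limits of parameters\<close>

lemma tendsto_E_iter:
  assumes "(kf \<longlongrightarrow> \<kappa>) Fl" "(zf \<longlongrightarrow> z) Fl"
  shows "((\<lambda>i. (E (kf i) ^^ n) (zf i)) \<longlongrightarrow> (E \<kappa> ^^ n) z) Fl"
  by (induction n) (auto simp: E_def intro!: tendsto_intros assms)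

definition param :: "complex \<Rightarrow> address \<Rightarrow> real \<Rightarrow> bool" where
  "param \<kappa> s t \<longleftrightarrow> gext \<kappa> (s, t) = Some \<kappa>"

text \<open>If the ray of \<open>(s, t)\<close> is blocked by \<open>\<kappa>\<close> although \<open>E_\<kappa>^N(\<kappa>)\<close> already has the value of
  the \<open>N\<close>-th iterate of \<open>(s, t)\<close>, then injectivity makes that iterate periodic under the shift
  with heights that do not increase along the period.\<close>

lemma good_of_late_value:
  assumes X: "(s, t) \<in> X" and late: "gext \<kappa> (drp N s, hgt s N t) = Some ((E \<kappa> ^^ N) \<kappa>)"
  shows "good (\<kappa>, s, t)"
proof (rule ccontr)
  assume "\<not> good (\<kappa>, s, t)"
  then obtain m x where m: "m \<ge> 1" "x \<ge> t" "gext \<kappa> (drp m s, hgt s m x) = Some \<kappa>"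
    using gext_None_iff[OF X, of \<kappa>] by (auto simp: good_def)
  define s' a where "s' = drp N s" and "a = hgt s N t"
  have X': "(s', a) \<in> X" using X_drp[OF X] by (simp add: s'_def a_def)
  have "gext \<kappa> (drp (m + N) s, hgt s (m + N) x) = Some ((E \<kappa> ^^ N) \<kappa>)"
    using gext_iter[OF m(3), of N] by (simp add: hgt_drp)
  from gext_inj[OF this late] have per: "drp (m + N) s = s'" "hgt s (m + N) x = a"
    by (simp_all add: s'_def a_def)
  have per': "drp m s' = s'" using per(1) by (simp add: s'_def add.commute)
  have "hgt s' m a = hgt s (m + N) t"
    unfolding s'_def a_def by (simp add: hgt_drp add.commute)
  also have "\<dots> \<le> a" using hgt_mono[OF X_subset_X_bar[OF X] m(2), of "m + N"] per(2) by simp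
  finally have le: "hgt s' m a \<le> a" .
  have iter: "drp (k * m) s' = s' \<and> hgt s' (k * m) a \<le> a" for k
  proof (induction k)
    case (Suc k)
    have "hgt s' (Suc k * m) a = hgt (drp (k * m) s') m (hgt s' (k * m) a)"
      by (simp only: hgt_drp mult_Suc add.commute[of m])
    also have "\<dots> = hgt s' m (hgt s' (k * m) a)" using Suc by simp
    also have "\<dots> \<le> hgt s' m a"
      using Suc X_bar_drp[OF X_subset_X_bar[OF X'], of "k * m"] by (intro hgt_mono) auto
    also note le
    finally have "hgt s' (Suc k * m) a \<le> a" .
    moreover have "drp (Suc k * m) s' = drp m (drp (k * m) s')" by (simp add: add.commute)
    ultimately show ?case using Suc per' by simp
  qed simp
  obtain n where n: "\<And>k. k \<ge> n \<Longrightarrow> a + 1 \<le> hgt s' k a"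
    using X' unfolding X_iff filterlim_at_top eventually_sequentially by blast
  have "a + 1 \<le> hgt s' (n * m) a" using m(1) by (intro n) simp
  then show False using iter[of n] by linarith
qed

text \<open>It is not clear at first that g is defined at the limit point for the limit parameter.
  At level \<open>N\<close> all points are tall, so the limit map shows that the \<open>N\<close>-th
  iterate of \<kappa> has the right value there; \<open>good_of_late_value\<close> then gives
  definedness at level 0, and continuity gives the equation.\<close>

lemma param_closed:
  assumes d: "0 < d" and st: "(s, t) \<in> Deep d" and nontriv: "Fl \<noteq> bot"
    and lim: "(kf \<longlongrightarrow> \<kappa>) Fl" "(sf \<longlongrightarrow> s) Fl" "(tf \<longlongrightarrow> t) Fl"
    and ev: "\<forall>\<^sub>F i in Fl. (sf i, tf i) \<in> Deep d" "\<forall>\<^sub>F i in Fl. param (kf i) (sf i) (tf i)"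
  shows "param \<kappa> s t"
proof -
  define K where "K = norm \<kappa> + 2 * pi + 7"
  have K: "K > 2 * pi + 6" "norm \<kappa> < K" using pi_gt3 norm_ge_zero[of \<kappa>] unfolding K_def by linarith+
  obtain N where N: "QK K \<le> (F ^^ N) d" using F_iter_reaches[OF d] .
  have T: "Tall (QK K) (drp N a) (hgt a N u)" if "(a, u) \<in> Deep d" for a u
    using Deep_Tall[OF that _ N] d by simp
  have evK: "\<forall>\<^sub>F i in Fl. norm (kf i) < K" by (rule order_tendstoD(2)[OF tendsto_norm[OF lim(1)] K(2)])
  have "((\<lambda>i. glim (kf i) (drp N (sf i)) (hgt (sf i) N (tf i))) \<longlongrightarrow> glim \<kappa> (drp N s) (hgt s N t)) Fl"
  proof (rule glim_tendsto_joint[OF K(1) lim(1) less_imp_le[OF K(2)]])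
    show "\<forall>\<^sub>F i in Fl. norm (kf i) \<le> K" using evK by eventually_elim simp
    show "\<forall>\<^sub>F i in Fl. Tall (QK K) (drp N (sf i)) (hgt (sf i) N (tf i))"
      using ev(1) by eventually_elim (rule T)
  qed (intro tendsto_intros lim T st)+
  moreover have "\<forall>\<^sub>F i in Fl. glim (kf i) (drp N (sf i)) (hgt (sf i) N (tf i)) = (E (kf i) ^^ N) (kf i)"
    using evK ev
  proof eventually_elim
    case (elim i)
    from gext_iter[OF elim(3)[unfolded param_def], of N]
      gext_glim[OF K(1) _ T[OF elim(2)] X_drp[OF Deep_X[OF elim(2) d]], of "kf i"] elim(1)
    show ?case by simp
  qed
  ultimately have "((\<lambda>i. (E (kf i) ^^ N) (kf i)) \<longlongrightarrow> glim \<kappa> (drp N s) (hgt s N t)) Fl"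
    by (rule Lim_transform_eventually)
  then have "(E \<kappa> ^^ N) \<kappa> = glim \<kappa> (drp N s) (hgt s N t)"
    using tendsto_unique[OF nontriv tendsto_E_iter[OF lim(1,1), of N]] by blast
  then have "gext \<kappa> (drp N s, hgt s N t) = Some ((E \<kappa> ^^ N) \<kappa>)"
    using gext_glim[OF K(1) less_imp_le[OF K(2)] T[OF st] X_drp[OF Deep_X[OF st d]]] by simp
  from good_of_late_value[OF Deep_X[OF st d] this] have g: "good (\<kappa>, s, t)" .
  have "((\<lambda>i. val (kf i, sf i, tf i)) \<longlongrightarrow> val (\<kappa>, s, t)) Fl"
    by (rule val_tendsto(2)[OF d st g lim ev(1)])
  moreover have "\<forall>\<^sub>F i in Fl. val (kf i, sf i, tf i) = kf i"
    using ev(2) by eventually_elim (simp add: param_def val_def)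
  ultimately have "(kf \<longlongrightarrow> val (\<kappa>, s, t)) Fl" by (rule Lim_transform_eventually)
  then have "val (\<kappa>, s, t) = \<kappa>" using tendsto_unique[OF nontriv _ lim(1)] by blast
  then show ?thesis using gext_val[OF g] by (simp add: param_def)
qed

section \<open>The winding of rays\<close>

text \<open>Writing out real and imaginary parts reduces the slope estimate to
  \<open>c + \<eta> \<le> (c + 4 * \<eta>) * (1 - c * \<eta>)\<close>; the factor 4 is generous
  enough to absorb the loss in the real part.\<close>

lemma slope_divide:
  fixes D w :: complex
  assumes w: "0 < Re w" "\<bar>Im w\<bar> \<le> \<eta> * Re w" and D: "0 < Re D" "\<bar>Im D\<bar> \<le> c * Re D"
    and c: "0 \<le> c" "0 \<le> \<eta>" "\<eta> \<le> 1/2" "c + 4 * \<eta> \<le> 1"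
  shows "0 < Re (D / w)" "\<bar>Im (D / w)\<bar> \<le> (c + 4 * \<eta>) * Re (D / w)"
proof -
  define p q x y where "p = Re D" "q = Im D" "x = Re w" "y = Im w"
  note defs = this
  have px: "0 < p * x" using w D by (simp add: defs)
  have "\<bar>q * y\<bar> \<le> (c * p) * (\<eta> * x)"
    unfolding abs_mult using w D c by (intro mult_mono) (auto simp: defs)
  then have 1: "p * x * (1 - c * \<eta>) \<le> p * x + q * y" by (simp add: algebra_simps abs_le_iff)
  have "\<bar>q\<bar> * x \<le> (c * p) * x" "p * \<bar>y\<bar> \<le> p * (\<eta> * x)"
    using w D by (auto simp: defs intro!: mult_right_mono mult_left_mono)
  then have "\<bar>q * x\<bar> \<le> p * x * c" "\<bar>p * y\<bar> \<le> p * x * \<eta>"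
    using w D by (simp_all add: defs abs_mult mult_ac)
  then have 2: "\<bar>q * x - p * y\<bar> \<le> p * x * (c + \<eta>)"
    using abs_triangle_ineq4[of "q * x" "p * y"] by (simp add: algebra_simps)
  have c1: "c \<le> 1" using c by linarith
  have "c * \<eta> \<le> 1 * (1/2)" using c c1 by (intro mult_mono) auto
  then have pos: "0 < 1 - c * \<eta>" by simp
  have "c * c \<le> 1 * 1" using c c1 by (intro mult_mono) auto
  then have "c * c * \<eta> \<le> 1 * 1 * \<eta>" "(c * \<eta>) * \<eta> \<le> (1 * (1/2)) * \<eta>"
    using c \<open>c * \<eta> \<le> 1 * (1/2)\<close> by (intro mult_right_mono; simp)+
  then have 3: "c + \<eta> \<le> (c + 4 * \<eta>) * (1 - c * \<eta>)" by (simp add: algebra_simps)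
  have "p * x * (c + \<eta>) \<le> p * x * ((c + 4 * \<eta>) * (1 - c * \<eta>))"
    using 3 px by (intro mult_left_mono) auto
  also have "\<dots> = (c + 4 * \<eta>) * (p * x * (1 - c * \<eta>))" by simp
  also have "\<dots> \<le> (c + 4 * \<eta>) * (p * x + q * y)" using 1 c by (intro mult_left_mono) auto
  finally have 4: "\<bar>q * x - p * y\<bar> \<le> (c + 4 * \<eta>) * (p * x + q * y)" using 2 by linarith
  have 5: "0 < p * x + q * y" using 1 mult_pos_pos[OF px pos] by linarith
  have n: "0 < x\<^sup>2 + y\<^sup>2" using w by (simp add: defs add_pos_nonneg)
  have eq: "Re (D / w) = (p * x + q * y) / (x\<^sup>2 + y\<^sup>2)" "Im (D / w) = (q * x - p * y) / (x\<^sup>2 + y\<^sup>2)"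
    by (simp_all add: Re_divide Im_divide defs)
  show "0 < Re (D / w)" using 5 n by (simp add: eq)
  show "\<bar>Im (D / w)\<bar> \<le> (c + 4 * \<eta>) * Re (D / w)"
    using 4 n unfolding eq by (simp add: abs_divide divide_right_mono)
qed

text \<open>Along the segment from \<open>w1\<close> to \<open>w2\<close>, which stays in the sector
  by convexity, the derivative of the logarithm is \<open>D / w r\<close>.
  \<open>slope_divide\<close> bounds its direction, and the bound integrates to the secant.\<close>

lemma Ln_secant:
  fixes w1 w2 :: complex
  assumes w1: "0 < Re w1" "\<bar>Im w1\<bar> \<le> \<eta> * Re w1" and w2: "0 < Re w2" "\<bar>Im w2\<bar> \<le> \<eta> * Re w2"
    and D: "0 < Re (w2 - w1)" "\<bar>Im (w2 - w1)\<bar> \<le> c * Re (w2 - w1)"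
    and c: "0 \<le> c" "0 \<le> \<eta>" "\<eta> \<le> 1/2" "c + 4 * \<eta> \<le> 1"
  shows "0 < Re (Ln w2 - Ln w1)" "\<bar>Im (Ln w2 - Ln w1)\<bar> \<le> (c + 4 * \<eta>) * Re (Ln w2 - Ln w1)"
proof -
  define D where "D = w2 - w1"
  define w where "w r = w1 + of_real r * D" for r :: real
  have w_eq: "w r = (1 - r) *\<^sub>R w1 + r *\<^sub>R w2" for r
    by (simp add: w_def D_def scaleR_conv_of_real algebra_simps)
  have wr: "0 < Re (w r)" "\<bar>Im (w r)\<bar> \<le> \<eta> * Re (w r)" if r: "0 \<le> r" "r \<le> 1" for r
  proof -
    have "0 < (1 - r) * Re w1 + r * Re w2"
      using r w1(1) w2(1) by (cases "r = 0") (auto intro: add_nonneg_pos)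
    then show "0 < Re (w r)" by (simp add: w_eq)
    have "\<bar>(1 - r) * Im w1 + r * Im w2\<bar> \<le> (1 - r) * \<bar>Im w1\<bar> + r * \<bar>Im w2\<bar>"
      using r abs_triangle_ineq[of "(1 - r) * Im w1" "r * Im w2"] by (simp add: abs_mult)
    also have "\<dots> \<le> (1 - r) * (\<eta> * Re w1) + r * (\<eta> * Re w2)"
      using r w1 w2 by (intro add_mono mult_left_mono) auto
    also have "\<dots> = \<eta> * ((1 - r) * Re w1 + r * Re w2)" by (simp add: algebra_simps)
    finally show "\<bar>Im (w r)\<bar> \<le> \<eta> * Re (w r)" by (simp add: w_eq)
  qed
  define f where "f r = Ln (w r)" for r
  have der: "((\<lambda>r. Re (f r)) has_real_derivative Re (D / w r)) (at r)"
    "((\<lambda>r. Im (f r)) has_real_derivative Im (D / w r)) (at r)" if "0 \<le> r" "r \<le> 1" for r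
  proof -
    have "w r \<notin> \<real>\<^sub>\<le>\<^sub>0" using wr[OF that] by (auto simp: complex_nonpos_Reals_iff)
    then have "((\<lambda>z. Ln (w1 + z * D)) has_field_derivative D / w r) (at (of_real r))"
      unfolding w_def by (auto intro!: derivative_eq_intros simp: divide_inverse)
    from has_vector_derivative_real_field[OF this, of UNIV]
    show "((\<lambda>r. Re (f r)) has_real_derivative Re (D / w r)) (at r)"
      "((\<lambda>r. Im (f r)) has_real_derivative Im (D / w r)) (at r)"
      unfolding has_vector_derivative_complex_iff by (simp_all add: f_def w_def)
  qed
  have slope: "0 < Re (D / w r)" "\<bar>Im (D / w r)\<bar> \<le> (c + 4 * \<eta>) * Re (D / w r)" if "0 \<le> r" "r \<le> 1" for r
    using slope_divide[OF wr[OF that] D[folded D_def] c] by blast+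
  have "Re (f 0) < Re (f 1)"
    by (rule DERIV_pos_imp_increasing[where f = "\<lambda>r. Re (f r)"]) (use der slope in auto)
  moreover have "(c + 4 * \<eta>) * Re (f 0) + s * Im (f 0) \<le> (c + 4 * \<eta>) * Re (f 1) + s * Im (f 1)"
    if s: "s = 1 \<or> s = -1" for s
  proof (rule DERIV_nonneg_imp_nondecreasing[where f = "\<lambda>r. (c + 4 * \<eta>) * Re (f r) + s * Im (f r)"])
    fix r :: real assume r: "0 \<le> r" "r \<le> 1"
    have "((\<lambda>r. (c + 4 * \<eta>) * Re (f r) + s * Im (f r)) has_real_derivative
        (c + 4 * \<eta>) * Re (D / w r) + s * Im (D / w r)) (at r)"
      by (intro derivative_intros der r DERIV_cmult)
    moreover have "0 \<le> (c + 4 * \<eta>) * Re (D / w r) + s * Im (D / w r)"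
      using slope(2)[OF r] s by auto
    ultimately show "\<exists>y. ((\<lambda>r. (c + 4 * \<eta>) * Re (f r) + s * Im (f r)) has_real_derivative y) (at r) \<and> 0 \<le> y"
      by blast
  qed simp
  note this[of 1] this[of "-1"]
  moreover have "f 0 = Ln w1" "f 1 = Ln w2" by (simp_all add: f_def w_def D_def)
  ultimately show "0 < Re (Ln w2 - Ln w1)" "\<bar>Im (Ln w2 - Ln w1)\<bar> \<le> (c + 4 * \<eta>) * Re (Ln w2 - Ln w1)"
    by (auto simp: abs_le_iff algebra_simps)
qed

lemma Im_Ln_le:
  assumes "0 < Re w"
  shows "\<bar>Im (Ln w)\<bar> \<le> \<bar>Im w\<bar> / Re w"
proof -
  let ?S = "{z. Re z \<ge> Re w}"
  have "norm (Ln w - Ln (of_real (Re w))) \<le> inverse (Re w) * norm (w - of_real (Re w))"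
  proof (rule field_differentiable_bound[where S = ?S and f' = inverse])
    show "convex ?S" by (rule convex_halfspace_Re_ge)
    fix z assume z: "z \<in> ?S"
    then have "z \<notin> \<real>\<^sub>\<le>\<^sub>0" using assms by (auto simp: complex_nonpos_Reals_iff)
    then show "(Ln has_field_derivative inverse z) (at z within ?S)"
      by (rule has_field_derivative_at_within[OF has_field_derivative_Ln])
    have "Re w \<le> norm z" using z complex_Re_le_cmod[of z] by simp
    then show "norm (inverse z) \<le> inverse (Re w)"
      using le_imp_inverse_le[of "Re w" "norm z"] assms by (simp add: norm_inverse)
  qed auto
  moreover have "w - of_real (Re w) = \<i> * of_real (Im w)" by (simp add: complex_eq_iff)
  moreover have "Im (Ln (of_real (Re w))) = 0" using assms by (simp add: Ln_of_real)
  ultimately show ?thesis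
    using abs_Im_le_cmod[of "Ln w - Ln (of_real (Re w))"] by (simp add: norm_mult divide_inverse mult.commute)
qed

text \<open>The divided difference of \<open>exp\<close> at 0, filled in continuously. It gives
  \<open>exp v - exp u = exp u * chi (v - u) * (v - u)\<close>, so secants can be compared between
  levels even when they shrink to a point, and no derivative of the ray is required.\<close>

definition chi :: "complex \<Rightarrow> complex" where
  "chi u = (if u = 0 then 1 else (exp u - 1) / u)"

lemma chi_mult: "chi u * u = exp u - 1"
  by (simp add: chi_def)

lemma continuous_chi: "continuous_on UNIV chi"
proof -
  have "isCont chi u" for u
  proof (cases "u = 0")
    case True
    have "((\<lambda>h. (exp (0 + h) - exp 0) / h) \<longlongrightarrow> exp 0) (at (0::complex))"
      using DERIV_exp[of "0::complex"] by (simp add: DERIV_def)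
    then have "((\<lambda>h. (exp h - 1) / h) \<longlongrightarrow> 1) (at (0::complex))" by simp
    then have "(chi \<longlongrightarrow> 1) (at 0)"
      by (rule Lim_transform_eventually) (auto simp: chi_def eventually_at_filter)
    then show ?thesis using True by (simp add: isCont_def chi_def)
  next
    case False
    have "\<forall>\<^sub>F v in nhds u. v \<in> - {0}" by (rule eventually_nhds_in_open) (use False in auto)
    then have "\<forall>\<^sub>F v in nhds u. chi v = (exp v - 1) / v" by eventually_elim (simp add: chi_def)
    moreover have "isCont (\<lambda>v. (exp v - 1) / v) u" using False by (intro continuous_intros)
    ultimately show ?thesis using isCont_cong[of chi "\<lambda>v. (exp v - 1) / v" u] by blast
  qed
  then show ?thesis by (simp add: continuous_at_imp_continuous_on)
qed

text \<open>In \<open>hopf\<close>, \<open>p\<close> is the argument of a secant at level N and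
  \<open>h\<close> that of the factor from level i to level N, so \<open>p - h\<close> is an
  argument of the secant at level i. Near \<open>b\<close> it is below pi / 2 + 1/2 in modulus,
  where a positive cosine forces it below pi / 2; it cannot cross pi / 2 afterwards. The estimate is
  taken just left of \<open>b\<close> because \<open>p\<close> has no value on the diagonal.\<close>

lemma arg_track_right:
  fixes p h :: "real \<Rightarrow> real"
  assumes "a < b" and p: "continuous_on {a..<b} p" "\<And>x. x \<in> {a..<b} \<Longrightarrow> \<bar>p x\<bar> < pi / 2"
    and h: "continuous_on {a..b} h" "\<bar>h b\<bar> < 1/2"
    and pos: "\<And>x. x \<in> {a..<b} \<Longrightarrow> 0 < cos (p x - h x)"
  shows "\<bar>p a - h a\<bar> < pi / 2"
proof (rule ccontr)
  assume a: "\<not> ?thesis"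
  have "(h \<longlongrightarrow> h b) (at b within {a..b})" using h(1) \<open>a < b\<close> by (simp add: continuous_on_def)
  then have "(h \<longlongrightarrow> h b) (at_left b)" using at_within_Icc_at_left[OF \<open>a < b\<close>] by simp
  then have "\<forall>\<^sub>F x in at_left b. \<bar>h x\<bar> < 1/2"
    using order_tendstoD(2)[OF tendsto_rabs h(2)] by blast
  moreover have "\<forall>\<^sub>F x in at_left b. x \<in> {a<..<b}" using eventually_at_left_real[OF \<open>a < b\<close>] .
  ultimately have "\<forall>\<^sub>F x in at_left b. \<bar>h x\<bar> < 1/2 \<and> x \<in> {a<..<b}" by (auto intro: eventually_conj)
  then obtain c where c: "\<bar>h c\<bar> < 1/2" "a < c" "c < b"
    using eventually_happens[of _ "at_left b"] by (auto simp: trivial_limit_at_left_real)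
  have "\<bar>p c - h c\<bar> < pi / 2 + 1/2" using p(2)[of c] c by auto
  moreover have "\<not> (pi / 2 \<le> \<bar>p c - h c\<bar>)"
  proof
    assume "pi / 2 \<le> \<bar>p c - h c\<bar>"
    then have "cos (pi - \<bar>p c - h c\<bar>) \<ge> 0"
      using \<open>\<bar>p c - h c\<bar> < pi / 2 + 1/2\<close> pi_gt3 by (intro cos_ge_zero) auto
    then show False using pos[of c] c by (simp add: cos_diff)
  qed
  ultimately have "\<bar>p c - h c\<bar> < pi / 2" by simp
  moreover have "continuous_on {a..c} (\<lambda>x. \<bar>p x - h x\<bar>)"
    using c by (intro continuous_intros continuous_on_subset[OF p(1)] continuous_on_subset[OF h(1)]) auto
  ultimately have "\<exists>x\<ge>a. x \<le> c \<and> \<bar>p x - h x\<bar> = pi / 2"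
    using a c by (intro IVT2') auto
  then obtain x where x: "a \<le> x" "x \<le> c" "\<bar>p x - h x\<bar> = pi / 2" by blast
  then have "cos (p x - h x) = 0" by (metis cos_abs_real cos_pi_half)
  then show False using pos[of x] x c by simp
qed

text \<open>Starting in (-pi / 2, 0], the quantity \<open>\<sigma> * (p x - h x)\<close> can leave
  [-pi, 0] only through points where its sine is positive. Together with the bound on
  \<open>p\<close> this bounds \<open>h\<close>, which, unlike \<open>p\<close>, extends
  continuously to \<open>a\<close>.\<close>

lemma arg_track_half_plane:
  fixes p h :: "real \<Rightarrow> real"
  assumes "a < b" and p: "continuous_on {a<..b} p" "\<And>x. x \<in> {a<..b} \<Longrightarrow> \<bar>p x\<bar> < pi / 2"
    and h: "continuous_on {a..b} h"
    and \<sigma>: "\<sigma> = 1 \<or> \<sigma> = (-1 :: real)" and neg: "\<And>x. x \<in> {a<..b} \<Longrightarrow> \<sigma> * sin (p x - h x) \<le> 0"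
    and start: "\<bar>p b - h b\<bar> < pi / 2"
  shows "\<bar>h a\<bar> \<le> 3 * pi / 2"
proof -
  define f where "f x = \<sigma> * (p x - h x)" for x
  have sinf: "sin (f x) \<le> 0" if "x \<in> {a<..b}" for x
    using neg[OF that] \<sigma> sin_minus[of "p x - h x"] by (auto simp: f_def)
  have fb: "\<bar>f b\<bar> < pi / 2" using start \<sigma> abs_minus_commute[of "p b" "h b"] by (auto simp: f_def)
  have fb0: "f b \<le> 0"
  proof (rule ccontr)
    assume "\<not> ?thesis"
    then have "0 < sin (f b)" using fb pi_gt_zero by (intro sin_gt_zero) auto
    then show False using sinf[of b] \<open>a < b\<close> by simp
  qed
  have contf: "continuous_on {x..b} f" if "a < x" for x
    unfolding f_def using that
    by (intro continuous_intros continuous_on_subset[OF p(1)] continuous_on_subset[OF h]) auto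
  have f_range: "- pi \<le> f x \<and> f x \<le> 0" if x: "x \<in> {a<..b}" for x
  proof (intro conjI)
    show "f x \<le> 0"
    proof (rule ccontr)
      assume "\<not> ?thesis"
      moreover have "f b \<le> pi / 2" using fb0 pi_gt_zero by linarith
      ultimately have "\<exists>z\<ge>x. z \<le> b \<and> f z = min (f x) (pi / 2)"
        using x fb0 contf[of x] by (intro IVT2') auto
      then obtain z where z: "x \<le> z" "z \<le> b" "f z = min (f x) (pi / 2)" by blast
      have "0 < sin (f z)" using \<open>\<not> f x \<le> 0\<close> pi_gt_zero by (intro sin_gt_zero) (auto simp: z min_def max_def)
      then show False using sinf[of z] z x by simp
    qed
    show "- pi \<le> f x"
    proof (rule ccontr)
      assume n: "\<not> ?thesis"
      then have "\<exists>z\<ge>x. z \<le> b \<and> f z = max (f x) (- (3 * pi / 2))"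
        using x fb contf[of x] pi_gt_zero by (intro IVT') auto
      then obtain z where z: "x \<le> z" "z \<le> b" "f z = max (f x) (- (3 * pi / 2))" by blast
      have "0 < sin (f z + 2 * pi)" using n pi_gt_zero by (intro sin_gt_zero) (auto simp: z min_def max_def)
      then show False using sinf[of z] z x by simp
    qed
  qed
  have hb: "\<bar>h x\<bar> \<le> 3 * pi / 2" if "x \<in> {a<..b}" for x
    using f_range[OF that] p(2)[OF that] \<sigma> by (auto simp: f_def)
  have "(h \<longlongrightarrow> h a) (at a within {a..b})" using h \<open>a < b\<close> by (simp add: continuous_on_def)
  then have "(h \<longlongrightarrow> h a) (at_right a)" using at_within_Icc_at_right[OF \<open>a < b\<close>] by simp
  moreover have "\<forall>\<^sub>F x in at_right a. \<bar>h x\<bar> \<le> 3 * pi / 2"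
    using eventually_at_right_real[OF \<open>a < b\<close>] by eventually_elim (use hb in auto)
  ultimately show ?thesis
    using tendsto_upperbound[OF tendsto_rabs] trivial_limit_at_right_real by blast
qed

lemma F_ge_add_one: "2 \<le> x \<Longrightarrow> x + 1 \<le> F x"
proof -
  assume x: "2 \<le> x"
  then have "2 * 2 \<le> x * x" by (intro mult_mono) auto
  then show ?thesis using F_quadratic[of x] x by (simp add: power2_eq_square)
qed

lemma exp_6_le: "exp 6 \<le> (729 :: real)"
proof -
  have "exp 6 = exp (1::real) ^ 6" using exp_of_nat_mult[of 6 "1::real"] by simp
  also have "\<dots> \<le> 3 ^ 6" using exp_le by (intro power_mono) auto
  finally show ?thesis by simp
qed

section \<open>Secants and arguments along one fixed ray\<close>

context
  fixes \<kappa> :: complex and s :: address and t :: real and \<gamma> :: "nat \<Rightarrow> real \<Rightarrow> complex" and d :: real and N :: nat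
  assumes ray: "ray \<kappa> s t \<gamma>" and d: "0 < d" and st: "(s, t) \<in> Deep d" and R: "13 \<le> norm \<kappa>"
    and N: "50 * (norm \<kappa> + 5) \<le> exp ((F ^^ N) d)"
begin

text \<open>The bound 13 on the modulus of \<kappa> exceeds 2 pi + 6, so the modulus itself can
  serve as the constant \<open>K\<close>.\<close>

lemma level_K: "norm \<kappa> > 2 * pi + 6" "norm \<kappa> \<le> norm \<kappa>"
  using R pi_approx by auto

lemma QK_le_level: "n \<ge> N \<Longrightarrow> 6 \<le> (F ^^ n) d" "n \<ge> N \<Longrightarrow> QK (norm \<kappa>) \<le> (F ^^ n) d"
proof -
  assume n: "n \<ge> N"
  have "729 \<le> 50 * (norm \<kappa> + 5)" using R by simp
  from order_trans[OF exp_6_le order_trans[OF this N]] have "exp 6 \<le> exp ((F ^^ N) d)" .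
  then have 6: "6 \<le> (F ^^ N) d" by simp
  with F_iter_le[OF n, of d] show "6 \<le> (F ^^ n) d" by simp
  have "ln (4 * (norm \<kappa> + pi + 3)) \<le> ln (exp ((F ^^ N) d))"
  proof (rule ln_mono)
    show "0 < 4 * (norm \<kappa> + pi + 3)" using R pi_gt_zero by (intro mult_pos_pos) linarith+
    have "4 * (norm \<kappa> + pi + 3) \<le> 4 * (norm \<kappa> + 4 + 3)" using pi_less_4 by (intro mult_left_mono) auto
    also have "\<dots> \<le> 50 * (norm \<kappa> + 5)" by simp
    also note N
    finally show "4 * (norm \<kappa> + pi + 3) \<le> exp ((F ^^ N) d)" .
  qed
  then have "QK (norm \<kappa>) \<le> (F ^^ N) d" using 6 pi_less_4 by (simp add: QK_def)
  with F_iter_le[OF n, of d] show "QK (norm \<kappa>) \<le> (F ^^ n) d" by simp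
qed

lemma level_Tall: "n \<ge> N \<Longrightarrow> x \<ge> t \<Longrightarrow> Tall (QK (norm \<kappa>)) (drp n s) (hgt s n x)"
  using Deep_Tall[OF Deep_upward[OF st], of x] d QK_le_level(2) by simp

lemma level_glim: "n \<ge> N \<Longrightarrow> x \<ge> t \<Longrightarrow> \<gamma> n x = glim \<kappa> (drp n s) (hgt s n x)"
  by (rule ray_eq_glim[OF level_K ray _ level_Tall])

lemma level_Ln:
  assumes "n \<ge> N" "x \<ge> t"
  shows "\<gamma> n x = Ln (\<gamma> (Suc n) x - \<kappa>) + 2 * of_real pi * \<i> * of_int (s n)"
  using glim_eq[OF level_K level_Tall[OF assms]] level_glim[OF assms] level_glim[of "Suc n" x] assms
    hgt_drp[of n s 1 x] by simp

lemma level_Z: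
  assumes "n \<ge> N" "x \<ge> t"
  shows "\<bar>Re (\<gamma> n x) - hgt s n x\<bar> \<le> 3" "\<bar>Im (\<gamma> n x) - 2 * pi * real_of_int (s n)\<bar> \<le> 3 * pi / 4"
  using glim_Re[OF level_K level_Tall[OF assms]] glim_Im[OF level_K level_Tall[OF assms]] level_glim[OF assms]
  by simp_all

definition theta :: "nat \<Rightarrow> real" where
  "theta n = exp (- (F ^^ n) d)"

lemma theta_pos: "0 < theta n"
  by (simp add: theta_def)

lemma theta_Suc: "n \<ge> N \<Longrightarrow> theta (Suc n) \<le> theta n / 2"
proof -
  assume n: "n \<ge> N"
  have "(F ^^ n) d + 1 \<le> (F ^^ Suc n) d" using F_ge_add_one[of "(F ^^ n) d"] QK_le_level(1)[OF n] by simp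
  then have "theta (Suc n) \<le> exp (- (F ^^ n) d - 1)" by (simp add: theta_def)
  also have "\<dots> = theta n / exp 1" by (simp add: theta_def exp_diff)
  also have "\<dots> \<le> theta n / 2"
    using exp_ge_add_one_self[of "1::real"] theta_pos[of n] by (intro divide_left_mono) auto
  finally show ?thesis .
qed

lemma theta_sum: "n \<ge> N \<Longrightarrow> (\<Sum>j\<in>{n..<n+k}. theta j) \<le> 2 * theta n - 2 * theta (n + k)"
proof (induction k)
  case (Suc k)
  then show ?case using theta_Suc[of "n + k"] by simp
qed simp

lemma theta_N: "(norm \<kappa> + 5) * theta N \<le> 1 / 50"
proof -
  have "50 * (norm \<kappa> + 5) * theta N \<le> exp ((F ^^ N) d) * theta N"
    using N theta_pos[of N] by (intro mult_right_mono) auto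
  also have "\<dots> = 1" by (simp add: theta_def flip: exp_add)
  finally show ?thesis by (simp add: algebra_simps)
qed

lemma theta_le: "n \<ge> N \<Longrightarrow> theta n \<le> theta N"
  using F_iter_le[of N n d] by (simp add: theta_def)

text \<open>The point at height \<open>x - d\<close> still has nonnegative heights, so
  \<open>1 + 2 * pi * \<bar>s (Suc n)\<bar>\<close> is at most \<open>exp (hgt s n (x - d))\<close>.
  This is smaller than \<open>exp (hgt s n x)\<close> by at least the factor \<open>theta n\<close>,
  so at deep points the imaginary part is negligible against the real part.\<close>

lemma level_slope:
  assumes n: "n \<ge> N" and x: "x \<ge> t"
  shows "0 < Re (\<gamma> (Suc n) x - \<kappa>)"
    "\<bar>Im (\<gamma> (Suc n) x - \<kappa>)\<bar> \<le> (2 * (norm \<kappa> + 5) * theta n) * Re (\<gamma> (Suc n) x - \<kappa>)"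
proof -
  define e b r where "e = exp (hgt s n x)" and "b = 2 * pi * \<bar>real_of_int (s (Suc n))\<bar>" and "r = norm \<kappa>"
  have sx: "(s, x) \<in> Deep d" using Deep_upward[OF st x] .
  have e: "e = hgt s (Suc n) x + b + 1" by (simp add: e_def b_def exp_hgt)
  have "0 \<le> hgt s (Suc n) (x - d)" using sx by (simp add: Deep_iff X_bar_iff)
  then have "1 + b \<le> exp (hgt s n (x - d))" by (simp add: exp_hgt b_def)
  also have "\<dots> \<le> exp (hgt s n x - (F ^^ n) d)" using Deep_hgt(1)[OF sx, of n] d by simp
  also have "\<dots> = e * theta n" by (simp add: e_def theta_def exp_diff exp_minus divide_inverse)
  finally have eb: "1 + b \<le> e * theta n" .
  have b0: "0 \<le> b" by (simp add: b_def)
  have r0: "0 \<le> r" by (simp add: r_def)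
  have e1: "1 \<le> e * theta n" using eb b0 by simp
  have small: "(r + 5) * theta n \<le> 1 / 50"
    using theta_N theta_le[OF n] mult_left_mono[OF theta_le[OF n], of "r + 5"] r0 by (simp add: r_def)
  have epos: "0 < e" by (simp add: e_def)
  have e5: "(r + 4) * 1 \<le> (r + 4) * (e * theta n)" using e1 r0 by (intro mult_left_mono) auto
  have "\<bar>Re \<kappa>\<bar> \<le> r" "\<bar>Im \<kappa>\<bar> \<le> r" unfolding r_def by (rule abs_Re_le_cmod abs_Im_le_cmod)+
  note z = level_Z[of "Suc n" x] this
  have "e - b - 4 - r \<le> Re (\<gamma> (Suc n) x - \<kappa>)" using z n x e by (simp add: abs_le_iff)
  moreover have "e * ((r + 5) * theta n) \<le> e * (1 / 50)" using small epos by (intro mult_left_mono) auto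
  then have "b + (r + 4) \<le> e / 50" using eb e5 by (simp add: algebra_simps)
  ultimately have Re: "e / 2 \<le> Re (\<gamma> (Suc n) x - \<kappa>)" using epos by simp
  then show pos: "0 < Re (\<gamma> (Suc n) x - \<kappa>)" using epos by simp
  have bb: "b = \<bar>2 * pi * real_of_int (s (Suc n))\<bar>" by (simp add: b_def abs_mult)
  have "3 * pi / 4 \<le> 3" using pi_less_4 by simp
  then have "\<bar>Im (\<gamma> (Suc n) x - \<kappa>)\<bar> \<le> b + 3 + r"
    using z(2,4) n x unfolding bb minus_complex.sel by linarith
  also have "\<dots> \<le> (r + 5) * (e * theta n)" using eb e5 by (simp add: algebra_simps)
  also have "\<dots> = (2 * (r + 5) * theta n) * (e / 2)" by simp
  also have "\<dots> \<le> (2 * (r + 5) * theta n) * Re (\<gamma> (Suc n) x - \<kappa>)"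
    using Re r0 theta_pos[of n] by (intro mult_left_mono) auto
  finally show "\<bar>Im (\<gamma> (Suc n) x - \<kappa>)\<bar> \<le> (2 * (norm \<kappa> + 5) * theta n) * Re (\<gamma> (Suc n) x - \<kappa>)"
    by (simp add: r_def)
qed

text \<open>Far out the secants of the ray are almost horizontal because \<open>\<gamma> M\<close> stays close to a horizontal
  line; pulling back by a logarithm turns them by at most the argument of \<open>\<gamma> (Suc n) x - \<kappa>\<close>.\<close>

lemma level_secant:
  assumes x: "t \<le> x1" "x1 < x2"
  shows "0 < Re (\<gamma> N x2 - \<gamma> N x1)"
proof -
  obtain M0 where M0: "20 \<le> (F ^^ M0) (x2 - x1)" using F_iter_reaches[of "x2 - x1"] x(2) by auto
  define M where "M = N + M0"
  \<comment> \<open>The value 35/100 bounds the slope at level \<open>M\<close>, as 49/10 over 14.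
    The pull-back to level \<open>j\<close> adds four times the slope bound of
    \<open>level_slope\<close>; by \<open>theta_N\<close>, where the constant 50 enters, all of
    these together add at most 16/50, so the slope never exceeds 1.\<close>
  define c where "c n = 35/100 + 4 * (\<Sum>j\<in>{n..<M}. 2 * (norm \<kappa> + 5) * theta j)" for n
  have x2: "t \<le> x2" using x by simp
  have xb: "(s, x1) \<in> X_bar" using Deep_X_bar[OF Deep_upward[OF st x(1)]] d by simp
  have c_le: "c n \<le> 1" and c_ge: "0 \<le> c n" if n: "N \<le> n" "n \<le> M" for n
  proof -
    have "(\<Sum>j\<in>{n..<M}. theta j) \<le> 2 * theta n - 2 * theta M"
      using theta_sum[of n "M - n"] n by simp
    also have "\<dots> \<le> 2 * theta N" using theta_le[OF n(1)] theta_pos[of M] by simp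
    finally have "(norm \<kappa> + 5) * (\<Sum>j\<in>{n..<M}. theta j) \<le> (norm \<kappa> + 5) * (2 * theta N)"
      by (intro mult_left_mono) auto
    also have "\<dots> = 2 * ((norm \<kappa> + 5) * theta N)" by simp
    finally have "8 * ((norm \<kappa> + 5) * (\<Sum>j\<in>{n..<M}. theta j)) \<le> 16 / 50" using theta_N by linarith
    moreover have "c n = 35/100 + 8 * ((norm \<kappa> + 5) * (\<Sum>j\<in>{n..<M}. theta j))"
      unfolding c_def sum_distrib_left[symmetric] by simp
    ultimately show "c n \<le> 1" by linarith
    show "0 \<le> c n" unfolding c_def using theta_pos
      by (intro add_nonneg_nonneg mult_nonneg_nonneg sum_nonneg) (auto intro: less_imp_le)
  qed
  have "0 < Re (\<gamma> n x2 - \<gamma> n x1) \<and> \<bar>Im (\<gamma> n x2 - \<gamma> n x1)\<bar> \<le> c n * Re (\<gamma> n x2 - \<gamma> n x1)"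
    if "N \<le> n" "n \<le> M" for n
    using that(2,1)
  proof (induction rule: inc_induct)
    case base
    have "20 \<le> (F ^^ M) (x2 - x1)" using M0 F_iter_le[of M0 M "x2 - x1"] by (simp add: M_def)
    then have "20 \<le> hgt s M x2 - hgt s M x1" using hgt_gap[OF xb, of x2 M] x(2) by simp
    then have "14 \<le> Re (\<gamma> M x2 - \<gamma> M x1)"
      using level_Z(1)[of M x1] level_Z(1)[of M x2] x base unfolding minus_complex.sel by linarith
    moreover have "\<bar>Im (\<gamma> M x2 - \<gamma> M x1)\<bar> \<le> 3 * pi / 4 + 3 * pi / 4"
      using level_Z(2)[of M x1] level_Z(2)[of M x2] x base unfolding minus_complex.sel by linarith
    moreover have "3 * pi / 4 + 3 * pi / 4 \<le> 49/10" using pi_approx by simp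
    ultimately show ?case by (simp add: c_def)
  next
    case (step n)
    define \<eta> where "\<eta> = 2 * (norm \<kappa> + 5) * theta n"
    have nN: "N \<le> n" using step by simp
    have cn: "c n = c (Suc n) + 4 * \<eta>"
      using step(2) by (simp add: c_def \<eta>_def sum.atLeast_Suc_lessThan)
    have \<eta>: "0 \<le> \<eta>" using theta_pos[of n] by (simp add: \<eta>_def)
    have "c n \<le> 1" "0 \<le> c (Suc n)" using c_le[of n] c_ge[of "Suc n"] nN step(2) by auto
    then have \<eta>2: "\<eta> \<le> 1/2" using cn by linarith
    note sl = level_slope[OF nN x(1), folded \<eta>_def] level_slope[OF nN x2, folded \<eta>_def]
    have IH: "0 < Re ((\<gamma> (Suc n) x2 - \<kappa>) - (\<gamma> (Suc n) x1 - \<kappa>))"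
      "\<bar>Im ((\<gamma> (Suc n) x2 - \<kappa>) - (\<gamma> (Suc n) x1 - \<kappa>))\<bar> \<le> c (Suc n) * Re ((\<gamma> (Suc n) x2 - \<kappa>) - (\<gamma> (Suc n) x1 - \<kappa>))"
      using step.IH nN by simp_all
    have eq: "\<gamma> n x2 - \<gamma> n x1 = Ln (\<gamma> (Suc n) x2 - \<kappa>) - Ln (\<gamma> (Suc n) x1 - \<kappa>)"
      using level_Ln[OF nN x(1)] level_Ln[OF nN x2] by simp
    show ?case
      unfolding eq cn using Ln_secant[OF sl IH] \<open>0 \<le> c (Suc n)\<close> \<eta> \<eta>2 \<open>c n \<le> 1\<close> cn by auto
  qed
  from this[of N] show ?thesis by (simp add: M_def)
qed

lemma ray_inj:
  assumes "t \<le> x1" "t \<le> x2" "\<gamma> n x1 = \<gamma> n x2" "n \<le> N"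
  shows "x1 = x2"
proof -
  have "\<gamma> N x1 = \<gamma> N x2"
    using ray_funpow[OF ray assms(1), of "N - n" n] ray_funpow[OF ray assms(2), of "N - n" n] assms by simp
  then show ?thesis
    using level_secant[of x1 x2] level_secant[of x2 x1] assms by (cases x1 x2 rule: linorder_cases) auto
qed

text \<open>Since \<open>exp (\<gamma> n x)\<close> is \<open>\<gamma> (Suc n) x - \<kappa>\<close>,
  this is a continuous argument of the next level as seen from the singular value \<kappa>,
  normalised by \<open>level_angle_tendsto\<close> to vanish at the far end of the ray.\<close>

definition level_angle :: "nat \<Rightarrow> real \<Rightarrow> real" where
  "level_angle n x = Im (\<gamma> n x) - 2 * pi * real_of_int (s n)"

lemma continuous_level_angle: "continuous_on {t..} (level_angle n)"
  unfolding level_angle_def by (intro continuous_intros rayD(2)[OF ray])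

lemma ray_Re_large: "\<exists>b\<ge>t. \<forall>x\<ge>b. Tall (QK (norm \<kappa>)) (drp n s) (hgt s n x) \<and> x + q \<le> Re (\<gamma> n x) + (t + q + 3)"
proof -
  have Xb: "(s, t) \<in> X_bar" using X_subset_X_bar[OF rayD(1)[OF ray]] .
  define b where "b = t + \<bar>QK (norm \<kappa>)\<bar>"
  have "Tall (QK (norm \<kappa>)) (drp n s) (hgt s n x) \<and> x + q \<le> Re (\<gamma> n x) + (t + q + 3)" if x: "x \<ge> b" for x
  proof -
    have tall: "Tall (QK (norm \<kappa>)) (drp n s) (hgt s n x)" using ray_Tall_large[OF ray] x by (simp add: b_def)
    have xt: "x \<ge> t" using x by (simp add: b_def)
    have "0 \<le> hgt s n t" using Xb by (simp add: X_bar_iff)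
    then have "x - t \<le> hgt s n x" using hgt_gap_lin[OF Xb xt, of n] by simp
    moreover have "\<bar>Re (\<gamma> n x) - hgt s n x\<bar> \<le> 3"
      using glim_Re[OF level_K tall] ray_eq_glim[OF level_K ray xt tall] by simp
    ultimately show ?thesis using tall by (simp add: abs_le_iff)
  qed
  then show ?thesis by (intro exI[of _ b]) (auto simp: b_def)
qed

text \<open>Far out, the next level minus \<kappa> has bounded imaginary part and a real part that
  grows at least like \<open>x\<close>, so its principal argument is of order 1 / x.\<close>

lemma level_angle_tendsto: "(level_angle n \<longlongrightarrow> 0) at_top"
proof -
  obtain b1 where b1: "b1 \<ge> t" "\<And>x. x \<ge> b1 \<Longrightarrow> Tall (QK (norm \<kappa>)) (drp n s) (hgt s n x)"
    using ray_Re_large[of n 0] by blast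
  obtain b2 where b2: "b2 \<ge> t" "\<And>x. x \<ge> b2 \<Longrightarrow> Tall (QK (norm \<kappa>)) (drp (Suc n) s) (hgt s (Suc n) x) \<and>
      x \<le> Re (\<gamma> (Suc n) x) + (t + 3)"
    using ray_Re_large[of "Suc n" 0] by auto
  define c where "c = \<bar>2 * pi * real_of_int (s (Suc n))\<bar> + 3 * pi / 4 + norm \<kappa>"
  define q where "q = t + 3 + norm \<kappa>"
  have bound: "norm (level_angle n x) \<le> c / (x - q)" if x: "x \<ge> max b1 (max b2 (q + 1))" for x
  proof -
    have xt: "x \<ge> t" using x b1(1) by simp
    define w where "w = \<gamma> (Suc n) x - \<kappa>"
    have "\<gamma> n x = Ln w + 2 * of_real pi * \<i> * of_int (s n)"
      using glim_eq[OF level_K b1(2)[of x]] ray_eq_glim[OF level_K ray xt b1(2)[of x]]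
        ray_eq_glim[OF level_K ray xt, of "Suc n"] b2(2)[of x] x hgt_drp[of n s 1 x] by (simp add: w_def)
    then have y: "level_angle n x = Im (Ln w)" by (simp add: level_angle_def)
    have Re: "x - q \<le> Re w"
      using b2(2)[of x] x abs_Re_le_cmod[of \<kappa>] by (simp add: w_def q_def abs_le_iff)
    have "\<bar>Im (\<gamma> (Suc n) x) - 2 * pi * real_of_int (s (Suc n))\<bar> \<le> 3 * pi / 4"
      using glim_Im[OF level_K, of "drp (Suc n) s" "hgt s (Suc n) x"] ray_eq_glim[OF level_K ray xt, of "Suc n"]
        b2(2)[of x] x by simp
    then have Im: "\<bar>Im w\<bar> \<le> c" using abs_Im_le_cmod[of \<kappa>] unfolding c_def w_def minus_complex.sel by linarith
    have "\<bar>Im (Ln w)\<bar> \<le> \<bar>Im w\<bar> / Re w" using Re x by (intro Im_Ln_le) simp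
    also have "\<dots> \<le> c / (x - q)" using Re Im x by (intro frac_le) auto
    finally show ?thesis by (simp add: y)
  qed
  have "((\<lambda>x. c / (x - q)) \<longlongrightarrow> 0) at_top"
  proof (rule tendsto_divide_0[OF tendsto_const])
    have "filterlim (\<lambda>x. - q + x) at_top at_top"
      by (rule filterlim_tendsto_add_at_top[OF tendsto_const filterlim_ident])
    then show "filterlim (\<lambda>x. x - q) at_infinity at_top"
      by (intro filterlim_at_top_imp_at_infinity) (simp add: algebra_simps)
  qed
  then show ?thesis
    by (rule Lim_null_comparison[rotated])
      (use bound in \<open>auto simp: eventually_at_top_linorder intro!: exI[of _ "max b1 (max b2 (q + 1))"]\<close>)
qed


text \<open>\<open>B\<close> is the first point where \<open>f\<close> reaches a value above all
  those on the initial interval. In \<open>hopf\<close> it serves as an endpoint towards which all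
  secants point to the right.\<close>

lemma record_point:
  fixes f :: "real \<Rightarrow> real"
  assumes "continuous_on {a..} f" "filterlim f at_top at_top" "a \<le> b0"
  obtains B where "b0 < B" "\<And>x. a \<le> x \<Longrightarrow> x < B \<Longrightarrow> f x < f B"
proof -
  have "compact (f ` {a..b0})"
    by (intro compact_continuous_image continuous_on_subset[OF assms(1)]) auto
  then have "bdd_above (f ` {a..b0})" by (intro bounded_imp_bdd_above compact_imp_bounded)
  then obtain M where "\<forall>y\<in>f ` {a..b0}. y \<le> M" unfolding bdd_above_def by blast
  then have M: "f x \<le> M" if "x \<in> {a..b0}" for x using that by blast
  define S where "S = {x \<in> {a..}. M + 1 \<le> f x}"
  have "closed S"
    unfolding S_def by (intro continuous_closed_preimage_constant continuous_on_closed_Collect_le)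
      (use assms(1) in \<open>auto intro: continuous_intros\<close>)
  moreover obtain c where "\<And>x. x \<ge> c \<Longrightarrow> M + 1 \<le> f x"
    using assms(2) unfolding filterlim_at_top eventually_at_top_linorder by blast
  then have "max a c \<in> S" by (auto simp: S_def)
  moreover have bdd: "bdd_below S" by (auto simp: S_def intro: bdd_belowI[of _ a])
  ultimately have B: "Inf S \<in> S" by (intro closed_contains_Inf) auto
  have less: "f x < f (Inf S)" if "a \<le> x" "x < Inf S" for x
  proof -
    have "x \<notin> S" using cInf_lower[OF _ bdd, of x] that by auto
    then show ?thesis using that B by (auto simp: S_def)
  qed
  have "b0 < Inf S"
    using B M[of "Inf S"] by (force simp: S_def)
  then show ?thesis using less that by blast
qed

text \<open>Hopf's argument: the direction of the secant from \<open>x0\<close> to \<open>b\<close>, followed continuously from a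
  far right point to \<open>b = x0\<close>, never leaves a half plane because \<open>\<gamma> i x0\<close> is an extreme point of
  the curve; and the direction of the tangent at \<open>x0\<close> is minus the sum of the imaginary parts.\<close>

lemma hopf:
  assumes i: "i \<le> N" and x0: "t \<le> x0" and max: "\<And>x. t \<le> x \<Longrightarrow> \<bar>level_angle i x\<bar> \<le> \<bar>level_angle i x0\<bar>"
  shows "\<bar>\<Sum>j\<in>{i..<N}. level_angle j x0\<bar> \<le> 3 * pi / 2"
proof -
  have "((\<lambda>x. \<Sum>j\<in>{i..<N}. level_angle j x) \<longlongrightarrow> (\<Sum>j\<in>{i..<N}. 0)) at_top"
    by (intro tendsto_sum level_angle_tendsto)
  then have "\<forall>\<^sub>F x in at_top. dist (\<Sum>j\<in>{i..<N}. level_angle j x) 0 < 1/2"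
    using tendstoD[of "\<lambda>x. \<Sum>j\<in>{i..<N}. level_angle j x" 0 at_top "1/2"] by simp
  then obtain b1 where b1: "\<And>x. x \<ge> b1 \<Longrightarrow> \<bar>\<Sum>j\<in>{i..<N}. level_angle j x\<bar> < 1/2"
    unfolding eventually_at_top_linorder by (auto simp: dist_real_def)
  obtain b2 where b2: "b2 \<ge> t" "\<And>x. x \<ge> b2 \<Longrightarrow> x \<le> Re (\<gamma> i x) + (t + 3)"
    using ray_Re_large[of i 0] by auto
  have "filterlim (\<lambda>x. - (t + 3) + x) at_top at_top"
    by (rule filterlim_tendsto_add_at_top[OF tendsto_const filterlim_ident])
  then have "filterlim (\<lambda>x. Re (\<gamma> i x)) at_top at_top"
    by (rule filterlim_at_top_mono) (use b2(2) in \<open>force simp: eventually_at_top_linorder\<close>)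
  moreover have "continuous_on {x0..} (\<lambda>x. Re (\<gamma> i x))"
    by (intro continuous_intros continuous_on_subset[OF rayD(2)[OF ray]]) (use x0 in auto)
  ultimately obtain B where B: "max b1 x0 < B" "\<And>x. x0 \<le> x \<Longrightarrow> x < B \<Longrightarrow> Re (\<gamma> i x) < Re (\<gamma> i B)"
    using record_point[of x0 "\<lambda>x. Re (\<gamma> i x)" "max b1 x0"] by auto
  \<comment> \<open>The triangle of parameter pairs for secants, including the diagonal, where a
    secant degenerates to a tangent direction.\<close>
  define Tr where "Tr = {p :: real \<times> real. x0 \<le> fst p \<and> fst p \<le> snd p \<and> snd p \<le> B}"
  \<comment> \<open>The factor that turns a secant at level i into the corresponding secant at level
    N. It does not vanish, because the ray is injective at levels up to N, so it has a continuous
    logarithm on the contractible triangle.\<close>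
  define Q where "Q p = (\<Prod>j\<in>{i..<N}. exp (\<gamma> j (fst p)) * chi (\<gamma> j (snd p) - \<gamma> j (fst p)))" for p
  have conv: "convex Tr"
    unfolding convex_alt Tr_def
  proof (intro ballI allI impI)
    fix p q :: "real \<times> real" and u :: real
    assume p: "p \<in> {p. x0 \<le> fst p \<and> fst p \<le> snd p \<and> snd p \<le> B}"
      and q: "q \<in> {p. x0 \<le> fst p \<and> fst p \<le> snd p \<and> snd p \<le> B}" and u: "0 \<le> u \<and> u \<le> 1"
    have "(1 - u) * x0 + u * x0 \<le> (1 - u) * fst p + u * fst q"
      "(1 - u) * fst p + u * fst q \<le> (1 - u) * snd p + u * snd q"
      "(1 - u) * snd p + u * snd q \<le> (1 - u) * B + u * B"
      using p q u by (intro add_mono mult_left_mono; simp)+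
    moreover have "(1 - u) * c + u * c = c" for c :: real by (simp add: algebra_simps)
    ultimately show "(1 - u) *\<^sub>R p + u *\<^sub>R q \<in> {p. x0 \<le> fst p \<and> fst p \<le> snd p \<and> snd p \<le> B}"
      by simp
  qed
  have cont: "continuous_on Tr (\<lambda>p. \<gamma> j (fst p))" "continuous_on Tr (\<lambda>p. \<gamma> j (snd p))" for j
    by (rule continuous_on_compose2[OF rayD(2)[OF ray]];
        use x0 in \<open>auto simp: Tr_def intro!: continuous_intros\<close>)+
  have "continuous_on Tr Q"
    unfolding Q_def
    by (intro continuous_intros cont continuous_on_compose2[OF continuous_chi]) auto
  moreover have Q0: "Q p \<noteq> 0" if p: "p \<in> Tr" for p
  proof -
    have "chi (\<gamma> j (snd p) - \<gamma> j (fst p)) \<noteq> 0" if j: "j \<in> {i..<N}" for j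
    proof
      assume c0: "chi (\<gamma> j (snd p) - \<gamma> j (fst p)) = 0"
      have ge: "t \<le> fst p" "t \<le> snd p" using p x0 by (auto simp: Tr_def)
      have "exp (\<gamma> j (snd p) - \<gamma> j (fst p)) = 1"
        using chi_mult[of "\<gamma> j (snd p) - \<gamma> j (fst p)"] c0 by simp
      then have "exp (\<gamma> j (snd p)) = exp (\<gamma> j (fst p))" by (simp add: exp_diff)
      then have "\<gamma> (Suc j) (fst p) = \<gamma> (Suc j) (snd p)" using rayD(3)[OF ray ge(1)] rayD(3)[OF ray ge(2)] by simp
      then have "fst p = snd p" by (rule ray_inj[OF ge]) (use j in auto)
      then show False using c0 by (simp add: chi_def)
    qed
    then show ?thesis by (simp add: Q_def)
  qed
  moreover have "contractible Tr" using conv by (rule convex_imp_contractible)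
  ultimately obtain l where l: "continuous_on Tr l" "\<And>p. p \<in> Tr \<Longrightarrow> Q p = exp (l p)"
    using continuous_logarithm_on_contractible[of Tr Q] by metis
  have diag: "Q (x, x) = exp (\<Sum>j\<in>{i..<N}. \<gamma> j x - 2 * of_real pi * \<i> * of_int (s j))" for x
    by (simp add: Q_def chi_def exp_sum exp_diff exp_2pi_int)
  have cl: "continuous_on {x0..B} (\<lambda>x. l (x, x))"
    by (rule continuous_on_compose2[OF l(1)]) (auto simp: Tr_def intro!: continuous_intros)
  have cs: "continuous_on {x0..B} (\<lambda>x. \<Sum>j\<in>{i..<N}. \<gamma> j x - 2 * of_real pi * \<i> * of_int (s j))"
    by (intro continuous_intros continuous_on_subset[OF rayD(2)[OF ray]]) (use x0 in auto)
  have "exp (l (x, x)) = exp (\<Sum>j\<in>{i..<N}. \<gamma> j x - 2 * of_real pi * \<i> * of_int (s j))"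
    if "x \<in> {x0..B}" for x
    using l(2)[of "(x, x)"] diag[of x] that by (simp add: Tr_def)
  from exp_lifts[OF connected_Icc cl cs this] obtain m :: int where m: "\<And>x. x \<in> {x0..B} \<Longrightarrow>
      l (x, x) = (\<Sum>j\<in>{i..<N}. \<gamma> j x - 2 * of_real pi * \<i> * of_int (s j)) + 2 * of_real pi * \<i> * of_int m"
    by blast
  \<comment> \<open>The shift by \<open>m\<close> makes \<open>h\<close> on the diagonal equal to
    the sum of the angles, and hence small at the far corner.\<close>
  define h where "h p = Im (l p) - 2 * pi * real_of_int m" for p
  have hdiag: "h (x, x) = (\<Sum>j\<in>{i..<N}. level_angle j x)" if "x \<in> {x0..B}" for x
    using m[OF that] by (simp add: h_def level_angle_def)
  have ch: "continuous_on Tr h" unfolding h_def by (intro continuous_intros l(1))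
  define p where "p a b = Im (Ln (\<gamma> N b - \<gamma> N a))" for a b
  have Spos: "0 < Re (\<gamma> N b - \<gamma> N a)" if "x0 \<le> a" "a < b" for a b
    using level_secant[of a b] x0 that by simp
  have pbound: "\<bar>p a b\<bar> < pi / 2" if "x0 \<le> a" "a < b" for a b
    unfolding p_def using Spos[OF that] Re_Ln_pos_lt_imp by blast
  have prod: "\<gamma> n b - \<gamma> n a = (\<gamma> i b - \<gamma> i a) * (\<Prod>j\<in>{i..<n}. exp (\<gamma> j a) * chi (\<gamma> j b - \<gamma> j a))"
    if "t \<le> a" "t \<le> b" "i \<le> n" for n a b
    using that(3)
  proof (induction rule: dec_induct)
    case (step n)
    have "\<gamma> (Suc n) b - \<gamma> (Suc n) a = exp (\<gamma> n b) - exp (\<gamma> n a)"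
      using rayD(3)[OF ray that(1), of n] rayD(3)[OF ray that(2), of n] by simp
    also have "\<dots> = exp (\<gamma> n a) * (chi (\<gamma> n b - \<gamma> n a) * (\<gamma> n b - \<gamma> n a))"
      unfolding chi_mult by (simp add: exp_diff field_simps)
    finally show ?case using step by (simp add: mult_ac)
  qed simp
  have polar: "\<gamma> i b - \<gamma> i a = exp (Ln (\<gamma> N b - \<gamma> N a) - l (a, b))" if "x0 \<le> a" "a < b" "b \<le> B" for a b
  proof -
    have "\<gamma> N b - \<gamma> N a = (\<gamma> i b - \<gamma> i a) * exp (l (a, b))"
      using prod[of a b N] l(2)[of "(a, b)"] that x0 i by (simp add: Q_def Tr_def)
    moreover have "\<gamma> N b - \<gamma> N a \<noteq> 0" using Spos[OF that(1,2)] by (metis less_irrefl zero_complex.sel(1))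
    ultimately show ?thesis by (simp add: exp_diff)
  qed
  \<comment> \<open>Hence \<open>p - h\<close> is an argument of the secant at level i, written in
    polar coordinates.\<close>
  have polar2: "\<exists>r>0. Re (\<gamma> i b - \<gamma> i a) = r * cos (p a b - h (a, b)) \<and> Im (\<gamma> i b - \<gamma> i a) = r * sin (p a b - h (a, b))"
    if "x0 \<le> a" "a < b" "b \<le> B" for a b
  proof -
    define z where "z = Ln (\<gamma> N b - \<gamma> N a) - l (a, b) + 2 * of_real pi * \<i> * of_int m"
    have "\<gamma> i b - \<gamma> i a = exp z" unfolding polar[OF that] z_def by (simp add: exp_add exp_2pi_int)
    moreover have "Im z = p a b - h (a, b)" by (simp add: z_def p_def h_def)
    ultimately show ?thesis by (intro exI[of _ "exp (Re z)"]) (simp add: Re_exp Im_exp)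
  qed
  have cp: "continuous_on S (\<lambda>x. p (f x) (g x))"
    if "continuous_on S f" "continuous_on S g" "\<And>x. x \<in> S \<Longrightarrow> x0 \<le> f x \<and> f x < g x" for S and f g :: "real \<Rightarrow> real"
  proof -
    have "continuous_on S (\<lambda>x. \<gamma> N (f x))" "continuous_on S (\<lambda>x. \<gamma> N (g x))"
      by (rule continuous_on_compose2[OF rayD(2)[OF ray]]; use that x0 in force)+
    moreover have "\<gamma> N (g x) - \<gamma> N (f x) \<notin> \<real>\<^sub>\<le>\<^sub>0" if "x \<in> S" for x
      using Spos[of "f x" "g x"] \<open>\<And>x. x \<in> S \<Longrightarrow> x0 \<le> f x \<and> f x < g x\<close>[OF that]
      by (auto simp: complex_nonpos_Reals_iff)
    ultimately show ?thesis unfolding p_def by (intro continuous_intros)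
  qed
  have Bx: "x0 < B" using B(1) by simp
  have right: "\<bar>p x0 B - h (x0, B)\<bar> < pi / 2"
  proof (rule arg_track_right[OF Bx, of "\<lambda>a. p a B" "\<lambda>a. h (a, B)"])
    show "continuous_on {x0..<B} (\<lambda>a. p a B)" by (rule cp) (auto intro!: continuous_intros)
    show "continuous_on {x0..B} (\<lambda>a. h (a, B))"
      by (rule continuous_on_compose2[OF ch]) (auto simp: Tr_def intro!: continuous_intros)
    show "\<bar>h (B, B)\<bar> < 1/2" using hdiag[of B] b1[of B] B(1) by simp
    fix x assume x: "x \<in> {x0..<B}"
    then show "\<bar>p x B\<bar> < pi / 2" by (intro pbound) auto
    have "\<exists>r>0. Re (\<gamma> i B - \<gamma> i x) = r * cos (p x B - h (x, B))" using polar2[of x B] x by auto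
    then obtain r where r: "r > 0" "Re (\<gamma> i B - \<gamma> i x) = r * cos (p x B - h (x, B))" by blast
    have "0 < Re (\<gamma> i B - \<gamma> i x)" using B(2)[of x] x by simp
    then show "0 < cos (p x B - h (x, B))" unfolding r(2) using r(1) by (rule zero_less_mult_pos)
  qed
  \<comment> \<open>As the modulus of the angle is maximal at \<open>x0\<close>, the whole curve
    lies on one side of the horizontal line through \<open>\<gamma> i x0\<close>; \<sigma> records
    which side.\<close>
  obtain \<sigma> :: real where \<sigma>: "\<sigma> = 1 \<or> \<sigma> = -1" "\<And>x. t \<le> x \<Longrightarrow> \<sigma> * (level_angle i x - level_angle i x0) \<le> 0"
  proof (cases "0 \<le> level_angle i x0")
    case True
    then show ?thesis using max by (intro that[of 1]) (auto simp: abs_le_iff)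
  next
    case False
    then show ?thesis using max by (intro that[of "-1"]) (auto simp: abs_le_iff)
  qed
  have "\<bar>h (x0, x0)\<bar> \<le> 3 * pi / 2"
  proof (rule arg_track_half_plane[OF Bx, of "\<lambda>b. p x0 b" "\<lambda>b. h (x0, b)" \<sigma>])
    show "continuous_on {x0<..B} (\<lambda>b. p x0 b)" by (rule cp) (auto intro!: continuous_intros)
    show "continuous_on {x0..B} (\<lambda>b. h (x0, b))"
      by (rule continuous_on_compose2[OF ch]) (auto simp: Tr_def intro!: continuous_intros)
    fix x assume x: "x \<in> {x0<..B}"
    then show "\<bar>p x0 x\<bar> < pi / 2" by (intro pbound) auto
    have "\<exists>r>0. Im (\<gamma> i x - \<gamma> i x0) = r * sin (p x0 x - h (x0, x))" using polar2[of x0 x] x by auto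
    then obtain r where r: "r > 0" "Im (\<gamma> i x - \<gamma> i x0) = r * sin (p x0 x - h (x0, x))" by blast
    have "\<sigma> * (r * sin (p x0 x - h (x0, x))) \<le> 0"
      using \<sigma>(2)[of x] x x0 r(2) by (simp add: level_angle_def)
    then have "r * (\<sigma> * sin (p x0 x - h (x0, x))) \<le> 0" by (simp add: mult_ac)
    then show "\<sigma> * sin (p x0 x - h (x0, x)) \<le> 0" using r(1) by (simp add: mult_le_0_iff)
  qed (use \<sigma>(1) right in auto)
  then show ?thesis using hdiag[of x0] Bx by simp
qed

lemma level_angle_max:
  obtains x0 where "t \<le> x0" "\<And>x. t \<le> x \<Longrightarrow> \<bar>level_angle i x\<bar> \<le> \<bar>level_angle i x0\<bar>"
proof (cases "\<forall>x\<ge>t. level_angle i x = 0")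
  case True
  then show ?thesis using that[of t] by auto
next
  case False
  then obtain z where z: "t \<le> z" "level_angle i z \<noteq> 0" by blast
  then have "\<forall>\<^sub>F x in at_top. dist (level_angle i x) 0 < \<bar>level_angle i z\<bar>" using tendstoD[OF level_angle_tendsto, of "\<bar>level_angle i z\<bar>" i] by simp
  then obtain b where b: "\<And>x. x \<ge> b \<Longrightarrow> \<bar>level_angle i x\<bar> < \<bar>level_angle i z\<bar>"
    unfolding eventually_at_top_linorder by (auto simp: dist_real_def)
  have "continuous_on {t..max z b} (\<lambda>x. \<bar>level_angle i x\<bar>)"
    by (intro continuous_intros continuous_on_subset[OF continuous_level_angle]) auto
  then have "\<exists>x0\<in>{t..max z b}. \<forall>x\<in>{t..max z b}. \<bar>level_angle i x\<bar> \<le> \<bar>level_angle i x0\<bar>"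
    using z(1) by (intro continuous_attains_sup) auto
  then obtain x0 where x0: "x0 \<in> {t..max z b}" "\<And>x. x \<in> {t..max z b} \<Longrightarrow> \<bar>level_angle i x\<bar> \<le> \<bar>level_angle i x0\<bar>"
    by blast
  have "\<bar>level_angle i x\<bar> \<le> \<bar>level_angle i x0\<bar>" if "t \<le> x" for x
  proof (cases "x \<le> max z b")
    case True
    then show ?thesis using x0(2)[of x] that by simp
  next
    case False
    then have "b \<le> x" by simp
    from b[OF this] x0(2)[of z] z(1) show ?thesis by simp
  qed
  then show ?thesis using x0(1) by (intro that[of x0]) auto
qed

text \<open>At a point where the angle of level N - k has maximal modulus, \<open>hopf\<close>
  bounds the sum of the angles from that level up to N - 1. Subtracting the angles already bounded
  leaves \<open>3 * pi / 2 + (5 * 2 ^ k - 10)\<close>, and \<open>3 * pi / 2\<close> is below 10.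
  The price is a bound exponential in \<open>k\<close>.\<close>

lemma level_angle_bound_below: "1 \<le> k \<Longrightarrow> k \<le> N \<Longrightarrow> t \<le> x \<Longrightarrow> \<bar>level_angle (N - k) x\<bar> \<le> 5 * 2 ^ k"
proof (induction k arbitrary: x rule: less_induct)
  case (less k)
  obtain x0 where x0: "t \<le> x0" "\<And>x. t \<le> x \<Longrightarrow> \<bar>level_angle (N - k) x\<bar> \<le> \<bar>level_angle (N - k) x0\<bar>" using level_angle_max by blast
  have "{N - k..<N} = insert (N - k) {Suc (N - k)..<N}" using less.prems by auto
  then have "level_angle (N - k) x0 = (\<Sum>j\<in>{N - k..<N}. level_angle j x0) - (\<Sum>j\<in>{Suc (N - k)..<N}. level_angle j x0)" by simp
  also have "(\<Sum>j\<in>{Suc (N - k)..<N}. level_angle j x0) = (\<Sum>l\<in>{1..<k}. level_angle (N - l) x0)"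
    by (rule sum.reindex_bij_witness[of _ "\<lambda>l. N - l" "\<lambda>j. N - j"]) (use less.prems in auto)
  finally have "\<bar>level_angle (N - k) x0\<bar> \<le> \<bar>\<Sum>j\<in>{N - k..<N}. level_angle j x0\<bar> + \<bar>\<Sum>l\<in>{1..<k}. level_angle (N - l) x0\<bar>"
    by linarith
  also have "\<dots> \<le> 3 * pi / 2 + (\<Sum>l\<in>{1..<k}. 5 * 2 ^ l)"
  proof (rule add_mono)
    show "\<bar>\<Sum>j\<in>{N - k..<N}. level_angle j x0\<bar> \<le> 3 * pi / 2" by (rule hopf) (use x0 in auto)
    show "\<bar>\<Sum>l\<in>{1..<k}. level_angle (N - l) x0\<bar> \<le> (\<Sum>l\<in>{1..<k}. 5 * 2 ^ l)"
      by (rule order_trans[OF sum_abs sum_mono]) (use less x0(1) in auto)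
  qed
  also have "(\<Sum>l\<in>{1..<k}. 5 * 2 ^ l) = (5 * 2 ^ k - 10 :: real)"
    using less.prems(1) by (induction rule: dec_induct) auto
  finally show ?case using x0(2)[OF less.prems(3)] pi_less_4 by simp
qed

lemma level_angle_bound:
  assumes "t \<le> x"
  shows "\<bar>Im (\<gamma> n x) - 2 * pi * real_of_int (s n)\<bar> \<le> 5 * 2 ^ N"
proof (cases "n < N")
  case True
  have "\<bar>level_angle (N - (N - n)) x\<bar> \<le> 5 * 2 ^ (N - n)" by (rule level_angle_bound_below) (use True assms in auto)
  also have "\<dots> \<le> (5 * 2 ^ N :: real)" by (intro mult_left_mono power_increasing) auto
  finally show ?thesis using True by (simp add: level_angle_def)
next
  case False
  have "(1::real) \<le> 2 ^ N" by simp
  moreover have "\<bar>Im (\<gamma> n x) - 2 * pi * real_of_int (s n)\<bar> \<le> 3 * pi / 4"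
    using level_Z(2)[of n x] False assms by simp
  ultimately show ?thesis using pi_less_4 by linarith
qed

end

section \<open>Bounds for parameters\<close>

text \<open>If \<open>Re (E_\<kappa>^m \<kappa>)\<close> is very negative, a small disc around \<open>\<kappa>\<close> returns into itself.\<close>

lemma nonescaping:
  fixes \<kappa> :: complex
  defines "x \<equiv> (\<lambda>j. Re ((E \<kappa> ^^ j) \<kappa>))"
  assumes lo: "\<And>j. j < m \<Longrightarrow> -1 \<le> x j" and sum: "(\<Sum>j\<le>m. 1 + x j) \<le> 0"
  shows "\<kappa> \<notin> escaping_set \<kappa>"
proof
  define z where "z j = (E \<kappa> ^^ j) \<kappa>" for j
  have x: "x j = Re (z j)" for j by (simp add: x_def z_def)
  \<comment> \<open>Within distance 1 of \<open>z m\<close> the exponential has modulus at most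
    \<open>r\<close>, so the disc of radius \<open>r\<close> around \<kappa> returns into itself
    once its images stay within distance 1 of the orbit up to time \<open>m\<close>; the hypothesis
    on the sum ensures exactly this.\<close>
  define r where "r = exp (1 + x m)"
  have partial: "1 + x m + (\<Sum>j<i. 1 + x j) \<le> 0" if "i \<le> m" for i
  proof -
    have "(\<Sum>j<i. 1 + x j) \<le> (\<Sum>j<m. 1 + x j)"
      using that lo by (intro sum_mono2) force+
    then show ?thesis using sum by (simp add: lessThan_Suc_atMost[symmetric])
  qed
  have close: "norm ((E \<kappa> ^^ i) w - z i) \<le> r * exp (\<Sum>j<i. 1 + x j)" if w: "norm (w - \<kappa>) \<le> r" "i \<le> m" for w i
    using w(2)
  proof (induction i)
    case 0
    then show ?case using w(1) by (simp add: z_def)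
  next
    case (Suc i)
    let ?v = "(E \<kappa> ^^ i) w"
    have IH: "norm (?v - z i) \<le> r * exp (\<Sum>j<i. 1 + x j)" using Suc by simp
    also have "\<dots> = exp (1 + x m + (\<Sum>j<i. 1 + x j))" by (simp add: r_def exp_add)
    also have "\<dots> \<le> 1" using partial[of i] Suc.prems by simp
    finally have v1: "norm (?v - z i) \<le> 1" .
    have "norm (exp ?v - exp (z i)) \<le> exp (1 + x i) * norm (?v - z i)"
    proof (rule field_differentiable_bound[where S = "cball (z i) 1" and f' = exp])
      fix u assume "u \<in> cball (z i) 1"
      then have "Re (u - z i) \<le> 1" using complex_Re_le_cmod[of "u - z i"] by (simp add: dist_norm norm_minus_commute)
      then show "norm (exp u) \<le> exp (1 + x i)" by (simp add: x)
      show "(exp has_field_derivative exp u) (at u within cball (z i) 1)"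
        by (rule DERIV_subset[OF DERIV_exp]) simp
    qed (use v1 in \<open>auto simp: dist_norm norm_minus_commute\<close>)
    also have "\<dots> \<le> exp (1 + x i) * (r * exp (\<Sum>j<i. 1 + x j))" using IH by (intro mult_left_mono) auto
    also have "\<dots> = r * exp (\<Sum>j<Suc i. 1 + x j)" by (simp add: exp_add)
    finally show ?case by (simp add: E_def[of \<kappa> ?v] E_def[of \<kappa> "(E \<kappa> ^^ i) \<kappa>"] z_def)
  qed
  have return: "norm ((E \<kappa> ^^ Suc m) w - \<kappa>) \<le> r" if w: "norm (w - \<kappa>) \<le> r" for w
  proof -
    let ?v = "(E \<kappa> ^^ m) w"
    have "norm (?v - z m) \<le> exp (1 + x m + (\<Sum>j<m. 1 + x j))"
      using close[OF w order_refl] by (simp add: r_def exp_add)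
    also have "\<dots> \<le> 1" using partial[of m] by simp
    finally have "Re (?v - z m) \<le> 1" using complex_Re_le_cmod[of "?v - z m"] by simp
    then show ?thesis by (simp add: E_def[of \<kappa> ?v] r_def x)
  qed
  have orbit: "norm ((E \<kappa> ^^ (k * Suc m)) \<kappa> - \<kappa>) \<le> r" for k
  proof (induction k)
    case (Suc k)
    have "(E \<kappa> ^^ (Suc k * Suc m)) \<kappa> = (E \<kappa> ^^ Suc m) ((E \<kappa> ^^ (k * Suc m)) \<kappa>)"
      by (simp only: mult_Suc funpow_add o_apply)
    then show ?case using return[OF Suc] by simp
  qed (simp add: r_def)
  assume "\<kappa> \<in> escaping_set \<kappa>"
  then have "filterlim (\<lambda>n. norm ((E \<kappa> ^^ n) \<kappa>)) at_top sequentially"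
    by (simp add: escaping_set_def filterlim_at_infinity_conv_norm_at_top)
  then obtain n where n: "\<And>k. k \<ge> n \<Longrightarrow> r + norm \<kappa> + 1 \<le> norm ((E \<kappa> ^^ k) \<kappa>)"
    unfolding filterlim_at_top eventually_sequentially by blast
  have "r + norm \<kappa> + 1 \<le> norm ((E \<kappa> ^^ (n * Suc m)) \<kappa>)" by (rule n) simp
  also have "\<dots> \<le> norm ((E \<kappa> ^^ (n * Suc m)) \<kappa> - \<kappa>) + norm \<kappa>"
    using norm_triangle_ineq[of "(E \<kappa> ^^ (n * Suc m)) \<kappa> - \<kappa>" \<kappa>] by simp
  also have "\<dots> \<le> r + norm \<kappa>" using orbit[of n] by simp
  finally show False by simp
qed

text \<open>Above 2 the map \<open>F\<close> at least doubles, so it reaches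
  \<open>ln (50 * (R + 5))\<close> after a number N of steps for which \<open>2 ^ N\<close> is of
  order \<open>ln R\<close>, and this is negligible against R. So the exponential bound on the
  winding is affordable.\<close>

lemma level_exists:
  assumes d: "0 < d"
  shows "\<exists>R0. \<forall>R\<ge>R0. \<exists>N. 50 * (R + 5) \<le> exp ((F ^^ N) d) \<and> 5 * 2 ^ N \<le> R / 8"
proof -
  obtain n0 where n0: "2 \<le> (F ^^ n0) d" using F_iter_reaches[OF d] .
  have grow: "2 ^ k \<le> (F ^^ (n0 + k)) d" and grow2: "2 \<le> (F ^^ (n0 + k)) d" for k
  proof -
    have "2 * 2 ^ k \<le> (F ^^ (n0 + k)) d"
    proof (induction k)
      case (Suc k)
      define y where "y = (F ^^ (n0 + k)) d"
      have "(1::real) \<le> 2 ^ k" by simp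
      then have y2: "2 \<le> y" using Suc unfolding y_def by linarith
      then have "2 * y \<le> y * y" by (intro mult_right_mono) auto
      then have "2 * y \<le> F y" using F_quadratic[of y] y2 unfolding power2_eq_square by linarith
      then show ?case using Suc by (simp add: y_def)
    qed (use n0 in simp)
    moreover have "(1::real) \<le> 2 ^ k" by simp
    ultimately show "2 ^ k \<le> (F ^^ (n0 + k)) d" "2 \<le> (F ^^ (n0 + k)) d" by linarith+
  qed
  \<comment> \<open>The factor 800 combines the denominator 8 of the target \<open>R / 8\<close>
    with the estimate \<open>u \<le> 100 * R\<close>.\<close>
  define C where "C = 10 * 2 ^ n0 * (800::real)"
  have C: "0 < C" by (simp add: C_def)
  have "\<forall>\<^sub>F u in at_top. ln u / u < 1 / C"
    by (rule order_tendstoD(2)[OF ln_x_over_x_tendsto_0]) (use C in simp)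
  then obtain u0 where u0: "\<And>u. u \<ge> u0 \<Longrightarrow> ln u / u < 1 / C" by (auto simp: eventually_at_top_linorder)
  have "\<exists>N. 50 * (R + 5) \<le> exp ((F ^^ N) d) \<and> 5 * 2 ^ N \<le> R / 8" if R: "R \<ge> max u0 5" for R
  proof -
    define u where "u = 50 * (R + 5)"
    have u: "u \<ge> u0" "u \<ge> 500" "u \<le> 100 * R" using R by (auto simp: u_def)
    have "exp 1 \<le> u" using exp_le u(2) by linarith
    then have l1: "1 \<le> ln u" using u(2) by (subst ln_ge_iff) auto
    define k where "k = (LEAST k. ln u \<le> 2 ^ k)"
    have "\<exists>k. ln u \<le> 2 ^ k" using real_arch_pow[of 2 "ln u"] by (auto intro: less_imp_le)
    then have k: "ln u \<le> 2 ^ k" unfolding k_def by (rule LeastI_ex)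
    have k2: "2 ^ k \<le> 2 * ln u"
    proof (cases k)
      case 0
      then show ?thesis using l1 by simp
    next
      case (Suc j)
      have "\<not> ln u \<le> 2 ^ j" using not_less_Least[of j "\<lambda>k. ln u \<le> 2 ^ k"] Suc by (simp add: k_def)
      then show ?thesis by (simp add: Suc)
    qed
    have "u = exp (ln u)" using u(2) by simp
    also have "\<dots> \<le> exp ((F ^^ (n0 + k)) d)" using k grow[of k] by simp
    finally have A: "u \<le> exp ((F ^^ (n0 + k)) d)" .
    have "ln u * C < u" using u0[OF u(1)] C u(2) by (simp add: field_simps)
    moreover have "5 * 2 ^ (n0 + k) \<le> 10 * 2 ^ n0 * ln u"
      using k2 by (simp add: power_add)
    ultimately have "5 * 2 ^ (n0 + k) * 800 \<le> u" by (simp add: C_def algebra_simps)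
    then have "5 * 2 ^ (n0 + k) \<le> R / 8" using u(3) by simp
    with A show ?thesis by (auto simp: u_def)
  qed
  then show ?thesis by blast
qed

lemma exp_ge_quadratic: "0 \<le> x \<Longrightarrow> 1 + x + x * x / 2 \<le> exp (x::real)"
  using exp_lower_Taylor_quadratic[of x] by (simp add: power2_eq_square)

text \<open>For large \<kappa> the winding bound leaves the imaginary part of each iterate within
  \<open>R / 8\<close> of 2 pi times the address entry, so an iterate of large modulus has large
  real part in modulus. A large negative real part is impossible by \<open>nonescaping\<close>;
  hence the real parts outgrow the iterates of \<open>t\<close> under \<open>F\<close>, whereas at
  level \<open>N\<close> they must be within 3 of the height. The factor 4 ensures that the initial
  real part, at least 3 R / 4, exceeds \<open>t + R / 2\<close>.\<close>

lemma param_bounded: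
  assumes d: "0 < d"
  shows "\<exists>R1\<ge>0. \<forall>\<kappa> s t. (s, t) \<in> Deep d \<longrightarrow> \<bar>real_of_int (s 0)\<bar> \<le> S \<longrightarrow> param \<kappa> s t \<longrightarrow> norm \<kappa> \<le> R1 + 4 * t"
proof -
  obtain R0 where R0: "\<And>R. R \<ge> R0 \<Longrightarrow> \<exists>N. 50 * (R + 5) \<le> exp ((F ^^ N) d) \<and> 5 * 2 ^ N \<le> R / 8"
    using level_exists[OF d] by blast
  define R1 where "R1 = max (max R0 40) (16 * pi * S)"
  have "norm \<kappa> \<le> R1 + 4 * t"
    if st: "(s, t) \<in> Deep d" and S: "\<bar>real_of_int (s 0)\<bar> \<le> S" and par: "param \<kappa> s t" for \<kappa> s t
  proof (rule ccontr)
    assume large: "\<not> ?thesis"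
    define R where "R = norm \<kappa>"
    have Xb: "(s, t) \<in> X_bar" using Deep_X_bar[OF st] d by simp
    have t0: "0 \<le> t" using Xb by (auto simp: X_bar_iff dest: spec[of _ 0])
    have R: "R \<ge> R0" "R \<ge> 40" "16 * pi * S \<le> R" "4 * t \<le> R"
      using large t0 unfolding R1_def R_def by linarith+
    obtain N where N: "50 * (norm \<kappa> + 5) \<le> exp ((F ^^ N) d)" "5 * 2 ^ N \<le> R / 8" using R0[OF R(1)] by (auto simp: R_def)
    obtain \<gamma> where \<gamma>: "ray \<kappa> s t \<gamma>" "\<gamma> 0 t = \<kappa>" using par by (auto simp: param_def gext_Some_iff)
    have R13: "13 \<le> norm \<kappa>" using R(2) by (simp add: R_def)
    define z where "z n = (E \<kappa> ^^ n) \<kappa>" for n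
    have z: "z n = \<gamma> n t" for n using ray_funpow[OF \<gamma>(1) order_refl, of n 0] \<gamma>(2) by (simp add: z_def)
    define x where "x n = Re (z n)" for n
    define b where "b n = (F ^^ n) t" for n
    have Imz: "\<bar>Im (z n)\<bar> \<le> R / 8 + \<bar>2 * pi * real_of_int (s n)\<bar>" for n
      using level_angle_bound[OF \<gamma>(1) d st R13 N(1) order_refl, of n] N(2) unfolding z by linarith
    have sb: "\<bar>2 * pi * real_of_int (s (Suc n))\<bar> \<le> b (Suc n)" for n
    proof -
      have "0 \<le> hgt s (Suc n) t" using Xb by (simp add: X_bar_iff)
      then have "\<bar>2 * pi * real_of_int (s (Suc n))\<bar> \<le> F (hgt s n t)" by (simp add: hgt_Suc abs_mult)
      also have "\<dots> \<le> F (b n)" unfolding b_def by (rule F_mono[OF hgt_le_F_iter[OF Xb]])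
      finally show ?thesis by (simp add: b_def)
    qed
    have esc: "\<kappa> \<in> escaping_set \<kappa>" using gext_escaping par by (auto simp: param_def)
    have x0: "3 * R / 4 \<le> x 0"
    proof -
      have "\<bar>2 * pi * real_of_int (s 0)\<bar> = 2 * pi * \<bar>real_of_int (s 0)\<bar>" by (simp add: abs_mult)
      also have "\<dots> \<le> 2 * pi * S" using S by (intro mult_left_mono) auto
      finally have "\<bar>Im \<kappa>\<bar> \<le> R / 4" using Imz[of 0] R(3) by (simp add: z_def)
      then have "3 * R / 4 \<le> \<bar>Re \<kappa>\<bar>" using cmod_le[of \<kappa>] by (simp add: R_def)
      moreover have "- 1 < Re \<kappa>"
      proof (rule ccontr)
        assume "\<not> ?thesis"
        then have "\<kappa> \<notin> escaping_set \<kappa>" by (intro nonescaping[of 0]) auto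
        with esc show False by simp
      qed
      ultimately show ?thesis using R(2) by (simp add: x_def z_def)
    qed
    \<comment> \<open>The bound on the sum feeds \<open>nonescaping\<close> at the next step: if the
      next real part were negative, it would be at most \<open>- exp (x n) / 2\<close> and outweigh
      everything before it.\<close>
    have main: "b n + R / 2 \<le> x n \<and> (\<Sum>j\<le>n. 1 + x j) \<le> 2 * x n + 2 \<and> (\<forall>j\<le>n. 0 \<le> x j)" for n
    proof (induction n)
      case 0
      then show ?case using x0 R by (simp add: b_def)
    next
      case (Suc n)
      have b0: "0 \<le> b n" using t0 F_iter_ge_self[of t n] by (simp add: b_def)
      have xn: "20 \<le> x n" using Suc R(2) b0 by linarith
      have ebn: "4 * exp (b n) \<le> exp (x n)"
      proof -
        have "(4::real) \<le> 1 + R / 2" using R(2) by simp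
        also have "\<dots> \<le> exp (R / 2)" by (rule exp_ge_add_one_self)
        finally have "4 * exp (b n) \<le> exp (R / 2) * exp (b n)" by (intro mult_right_mono) auto
        also have "\<dots> \<le> exp (x n)" using Suc by (simp add: add.commute flip: exp_add)
        finally show ?thesis .
      qed
      have q: "1 + x n + x n * x n / 2 \<le> exp (x n)" using exp_ge_quadratic[of "x n"] xn by simp
      have "20 * x n \<le> x n * x n" using xn by (intro mult_right_mono) auto
      then have q2: "1 + 11 * x n \<le> exp (x n)" using q by linarith
      have Rx: "R \<le> 2 * x n" using Suc b0 by linarith
      have zS: "z (Suc n) - \<kappa> = exp (z n)" by (simp add: z_def E_def[of \<kappa> "(E \<kappa> ^^ n) \<kappa>"])
      have "exp (x n) \<le> norm (z (Suc n)) + R"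
        using norm_triangle_ineq4[of "z (Suc n)" \<kappa>] unfolding zS by (simp add: x_def R_def)
      also have "norm (z (Suc n)) \<le> \<bar>x (Suc n)\<bar> + \<bar>Im (z (Suc n))\<bar>" using cmod_le[of "z (Suc n)"] by (simp add: x_def)
      finally have "exp (x n) - R - \<bar>Im (z (Suc n))\<bar> \<le> \<bar>x (Suc n)\<bar>" by simp
      moreover have bS: "b (Suc n) = exp (b n) - 1" by (simp add: b_def F_def)
      moreover have "\<bar>Im (z (Suc n))\<bar> \<le> R / 8 + b (Suc n)" using Imz[of "Suc n"] sb[of n] by linarith
      ultimately have half: "exp (x n) / 2 \<le> \<bar>x (Suc n)\<bar>" using ebn q2 Rx xn by linarith
      have pos: "0 \<le> x (Suc n)"
      proof (rule ccontr)
        assume "\<not> ?thesis"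
        then have neg: "x (Suc n) \<le> - (exp (x n) / 2)" using half by linarith
        have "(\<Sum>j\<le>Suc n. 1 + x j) \<le> (2 * x n + 2) + (1 + x (Suc n))" using Suc by simp
        also have "\<dots> \<le> 0" using neg q2 xn by linarith
        finally have "\<kappa> \<notin> escaping_set \<kappa>"
          using Suc by (intro nonescaping[of "Suc n"]) (auto simp: x_def z_def less_Suc_eq_le intro: order_trans[of _ 0])
        with esc show False by simp
      qed
      have "b (Suc n) + R / 2 \<le> x (Suc n)" using half pos ebn q2 Rx xn unfolding bS by linarith
      moreover have "(\<Sum>j\<le>Suc n. 1 + x j) \<le> 2 * x (Suc n) + 2" using Suc half pos q2 xn by simp
      ultimately show ?case using Suc pos by (auto simp: le_Suc_eq)
    qed
    have "x N \<le> hgt s N t + 3"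
      using level_Z(1)[OF \<gamma>(1) d st R13 N(1) order_refl order_refl] by (simp add: x_def z abs_le_iff)
    also have "hgt s N t \<le> b N" unfolding b_def by (rule hgt_le_F_iter[OF Xb])
    finally show False using main[of N] R(2) by linarith
  qed
  moreover have "0 \<le> R1" by (simp add: R1_def)
  ultimately show ?thesis by blast
qed

section \<open>Existence and uniqueness of the parameter\<close>

definition defect :: "address \<Rightarrow> real \<Rightarrow> complex \<Rightarrow> complex" where
  "defect s t \<kappa> = val (\<kappa>, s, t) - \<kappa>"

definition params :: "address \<Rightarrow> real \<Rightarrow> complex set" where
  "params s t = {\<kappa>. param \<kappa> s t}"

lemma params_iff: "\<kappa> \<in> params s t \<longleftrightarrow> good (\<kappa>, s, t) \<and> defect s t \<kappa> = 0"
proof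
  assume "\<kappa> \<in> params s t"
  then have "gext \<kappa> (s, t) = Some \<kappa>" by (simp add: params_def param_def)
  from val_eqI[OF this] show "good (\<kappa>, s, t) \<and> defect s t \<kappa> = 0" by (simp add: defect_def)
next
  assume "good (\<kappa>, s, t) \<and> defect s t \<kappa> = 0"
  then show "\<kappa> \<in> params s t" using gext_val[of \<kappa> s t] by (simp add: params_def param_def defect_def)
qed

lemma param_cluster:
  assumes d: "0 < d" and st: "(s, t) \<in> Deep d" and nontriv: "Fl \<noteq> bot"
    and lim: "(sf \<longlongrightarrow> s) Fl" "(tf \<longlongrightarrow> t) Fl"
    and ev: "\<forall>\<^sub>F i in Fl. (sf i, tf i) \<in> Deep d" "\<forall>\<^sub>F i in Fl. param (kf i) (sf i) (tf i)"
    and C: "compact C" "\<forall>\<^sub>F i in Fl. kf i \<in> C"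
  obtains \<kappa> where "\<kappa> \<in> C" "param \<kappa> s t"
proof -
  have "filtermap kf Fl \<noteq> bot" using nontriv by (simp add: filtermap_bot_iff)
  moreover have "eventually (\<lambda>x. x \<in> C) (filtermap kf Fl)" using C(2) by (simp add: eventually_filtermap)
  ultimately obtain \<kappa> where \<kappa>: "\<kappa> \<in> C" "inf (nhds \<kappa>) (filtermap kf Fl) \<noteq> bot"
    using C(1) unfolding compact_filter by blast
  define Fl' where "Fl' = inf Fl (filtercomap kf (nhds \<kappa>))"
  have "Fl' \<noteq> bot"
  proof
    assume "Fl' = bot"
    then have "eventually (\<lambda>_. False) Fl'" by simp
    then obtain P Q where PQ: "eventually P Fl" "eventually Q (filtercomap kf (nhds \<kappa>))" "\<And>x. P x \<Longrightarrow> Q x \<Longrightarrow> False"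
      unfolding Fl'_def eventually_inf by blast
    obtain R where R: "eventually R (nhds \<kappa>)" "\<And>x. R (kf x) \<Longrightarrow> Q x"
      using PQ(2) unfolding eventually_filtercomap by blast
    have "eventually (\<lambda>x. \<not> R x) (filtermap kf Fl)"
      unfolding eventually_filtermap using PQ(1) by eventually_elim (use PQ(3) R(2) in blast)
    with R(1) have "eventually (\<lambda>_. False) (inf (nhds \<kappa>) (filtermap kf Fl))"
      unfolding eventually_inf by blast
    with \<kappa>(2) show False by (simp add: eventually_False)
  qed
  have le: "Fl' \<le> Fl" by (simp add: Fl'_def)
  have "filterlim kf (nhds \<kappa>) (filtercomap kf (nhds \<kappa>))" by (rule filterlim_filtercomap)
  then have "(kf \<longlongrightarrow> \<kappa>) Fl'" by (rule filterlim_mono) (auto simp: Fl'_def)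
  then have "param \<kappa> s t"
    using param_closed[OF d st \<open>Fl' \<noteq> bot\<close> _ tendsto_mono[OF le lim(1)] tendsto_mono[OF le lim(2)]
      filter_leD[OF le ev(1)] filter_leD[OF le ev(2)]] by blast
  with \<kappa>(1) that show ?thesis by blast
qed

lemma defect_holomorphic:
  assumes "0 < d" "(s, t) \<in> Deep d" "A \<subseteq> {\<kappa>. good (\<kappa>, s, t)}"
  shows "defect s t holomorphic_on A"
  unfolding defect_def
  by (intro holomorphic_intros holomorphic_on_subset[OF val_holomorphic(2)[OF assms(1,2)] assms(3)])

lemma params_compact:
  assumes d: "0 < d" and st: "(s, t) \<in> Deep d"
  shows "compact (params s t)"
proof -
  obtain R1 where R1: "\<And>\<kappa>. param \<kappa> s t \<Longrightarrow> norm \<kappa> \<le> R1 + 4 * t"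
    using param_bounded[OF d, of "\<bar>real_of_int (s 0)\<bar>"] st by blast
  have "bounded (params s t)" unfolding bounded_iff using R1 by (auto simp: params_def)
  moreover have "closed (params s t)"
    unfolding closed_sequential_limits
  proof (intro allI impI, elim conjE)
    fix k \<kappa> assume k: "\<forall>n. k n \<in> params s t" "k \<longlonglongrightarrow> \<kappa>"
    have "param \<kappa> s t"
      by (rule param_closed[OF d st sequentially_bot k(2) tendsto_const tendsto_const])
        (use k(1) st in \<open>auto simp: params_def\<close>)
    then show "\<kappa> \<in> params s t" by (simp add: params_def)
  qed
  ultimately show ?thesis by (simp add: compact_eq_bounded_closed)
qed

lemma params_limit_ball:
  assumes d: "0 < d" and st: "(s, t) \<in> Deep d" and \<kappa>: "\<kappa> islimpt params s t"
  obtains e where "0 < e" "ball \<kappa> e \<subseteq> params s t"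
proof -
  have "closed (params s t)" using params_compact[OF d st] by (rule compact_imp_closed)
  then have "\<kappa> \<in> params s t" using \<kappa> by (auto simp: closed_limpt)
  then have "\<kappa> \<in> {\<kappa>. good (\<kappa>, s, t)}" by (simp add: params_iff)
  then obtain e where e: "0 < e" "ball \<kappa> e \<subseteq> {\<kappa>. good (\<kappa>, s, t)}"
    using val_holomorphic(1)[OF d st] openE by blast
  have lim: "\<kappa> islimpt (params s t \<inter> ball \<kappa> e)"
    unfolding islimpt_approachable
  proof (intro allI impI)
    fix r :: real assume "0 < r"
    then obtain w where "w \<in> params s t" "w \<noteq> \<kappa>" "dist w \<kappa> < min r e"
      using \<kappa> e(1) unfolding islimpt_approachable by (metis min_less_iff_conj)
    then show "\<exists>w\<in>params s t \<inter> ball \<kappa> e. w \<noteq> \<kappa> \<and> dist w \<kappa> < r"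
      by (intro bexI[of _ w]) (auto simp: dist_commute)
  qed
  have "defect s t w = 0" if "w \<in> ball \<kappa> e" for w
    by (rule analytic_continuation[OF defect_holomorphic[OF d st e(2)] open_ball connected_ball _ _ lim])
      (use e(1) that in \<open>auto simp: params_iff\<close>)
  then show ?thesis using e by (intro that[of e]) (auto simp: params_iff)
qed

text \<open>An accumulation point makes the interior of the solution set nonempty, and
  \<open>params_limit_ball\<close> makes that interior closed. The connected plane would then
  consist of solutions, contradicting compactness.\<close>

lemma params_finite:
  assumes d: "0 < d" and st: "(s, t) \<in> Deep d"
  shows "finite (params s t)"
proof (rule ccontr)
  assume inf: "infinite (params s t)"
  have cpt: "compact (params s t)" by (rule params_compact[OF d st])
  then obtain \<kappa> where "\<kappa> islimpt params s t"
    using inf unfolding compact_eq_Bolzano_Weierstrass by blast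
  from params_limit_ball[OF d st this] obtain e where e: "0 < e" "ball \<kappa> e \<subseteq> params s t" .
  have ne: "interior (params s t) \<noteq> {}"
    using e by (metis centre_in_ball empty_iff interior_maximal open_ball subsetD)
  have "closure (interior (params s t)) \<subseteq> interior (params s t)"
  proof
    fix w assume w: "w \<in> closure (interior (params s t))"
    show "w \<in> interior (params s t)"
    proof (cases "w \<in> interior (params s t)")
      case False
      then have "w islimpt interior (params s t)" using w by (auto simp: closure_def)
      then have "w islimpt params s t" by (rule islimpt_subset) (rule interior_subset)
      from params_limit_ball[OF d st this] obtain e where "0 < e" "ball w e \<subseteq> params s t" .
      then show ?thesis by (metis centre_in_ball interior_maximal open_ball subsetD)
    qed simp
  qed
  then have "closed (interior (params s t))" by (metis closure_subset closed_closure subset_antisym)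
  then have "interior (params s t) = UNIV"
    using ne connected_UNIV[where 'a = complex] open_interior[of "params s t"]
    unfolding connected_clopen by (metis closed_closedin open_openin subtopology_UNIV)
  then have "params s t = UNIV" using interior_subset by blast
  then show False using compact_imp_bounded[OF cpt] not_bounded_UNIV by metis
qed

section \<open>Counting parameters with multiplicity\<close>

definition param_count :: "address \<Rightarrow> real \<Rightarrow> int" where
  "param_count s t = (\<Sum>\<kappa>\<in>params s t. zorder (defect s t) \<kappa>)"

text \<open>Rouche's theorem on the circle of radius \<open>r\<close>, whose winding number about
  every zero involved is 1. The comparison function is the defect at a neighbouring height in one
  application and \<open>Z (s, t) - p\<close> in the other.\<close>

lemma param_count_disc:
  fixes f :: "complex \<Rightarrow> complex"
  assumes d: "0 < d" and st: "(s, t) \<in> Deep d" and r: "0 < r" "r < r'"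
    and good: "ball z r' \<subseteq> {\<kappa>. good (\<kappa>, s, t)}"
    and f: "f holomorphic_on ball z r'" "finite {p \<in> ball z r'. f p = 0}"
    and less: "\<And>p. p \<in> sphere z r \<Longrightarrow> norm (defect s t p - f p) < norm (f p)"
    and inside: "{p \<in> ball z r'. f p = 0} \<subseteq> ball z r" "params s t \<inter> ball z r' \<subseteq> ball z r"
  shows "(\<Sum>p\<in>params s t \<inter> ball z r'. zorder (defect s t) p) = (\<Sum>p\<in>{p \<in> ball z r'. f p = 0}. zorder f p)"
proof -
  define \<gamma> where "\<gamma> = circlepath z r"
  have eq: "(\<lambda>p. f p + (defect s t p - f p)) = defect s t" by auto
  have zeros: "{p \<in> ball z r'. defect s t p = 0} = params s t \<inter> ball z r'"
    using good by (auto simp: params_iff)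
  have wind: "winding_number \<gamma> p = 1" if "p \<in> ball z r" for p
    unfolding \<gamma>_def using that by (intro winding_number_circlepath) (simp add: dist_norm norm_minus_commute)
  have "(\<Sum>p\<in>{p \<in> ball z r'. f p + (defect s t p - f p) = 0}. winding_number \<gamma> p * zorder (\<lambda>p. f p + (defect s t p - f p)) p)
      = (\<Sum>p\<in>{p \<in> ball z r'. f p = 0}. winding_number \<gamma> p * zorder f p)"
  proof (rule Rouche_theorem[of "ball z r'" f "\<lambda>p. defect s t p - f p" \<gamma>])
    show "finite {p \<in> ball z r'. f p + (defect s t p - f p) = 0}"
      using params_finite[OF d st] zeros by simp
    show "(\<lambda>p. defect s t p - f p) holomorphic_on ball z r'"
      by (intro holomorphic_intros f defect_holomorphic[OF d st good])
    show "path_image \<gamma> \<subseteq> ball z r'" using r by (auto simp: \<gamma>_def)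
    show "\<forall>p\<in>path_image \<gamma>. norm (defect s t p - f p) < norm (f p)" using less r by (auto simp: \<gamma>_def)
    show "\<forall>w. w \<notin> ball z r' \<longrightarrow> winding_number \<gamma> w = 0"
    proof (intro allI impI)
      fix w assume "w \<notin> ball z r'"
      then show "winding_number \<gamma> w = 0"
        using r by (intro winding_number_zero_outside[of _ "cball z r"]) (auto simp: \<gamma>_def)
    qed
  qed (use f in \<open>auto simp: \<gamma>_def\<close>)
  then have "(\<Sum>p\<in>params s t \<inter> ball z r'. winding_number \<gamma> p * zorder (defect s t) p)
      = (\<Sum>p\<in>{p \<in> ball z r'. f p = 0}. winding_number \<gamma> p * zorder f p)"
    unfolding eq using zeros by simp
  moreover have "(\<Sum>p\<in>params s t \<inter> ball z r'. winding_number \<gamma> p * zorder (defect s t) p)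
      = (\<Sum>p\<in>params s t \<inter> ball z r'. of_int (zorder (defect s t) p))"
    by (intro sum.cong refl) (use wind inside(2) in auto)
  moreover have "(\<Sum>p\<in>{p \<in> ball z r'. f p = 0}. winding_number \<gamma> p * zorder f p)
      = (\<Sum>p\<in>{p \<in> ball z r'. f p = 0}. of_int (zorder f p))"
    by (intro sum.cong refl) (use wind inside(1) in auto)
  ultimately have "(of_int (\<Sum>p\<in>params s t \<inter> ball z r'. zorder (defect s t) p) :: complex)
      = of_int (\<Sum>p\<in>{p \<in> ball z r'. f p = 0}. zorder f p)"
    by simp
  then show ?thesis by (simp only: of_int_eq_iff)
qed

lemma Deep_line: "(s, a) \<in> X_bar \<Longrightarrow> a + d \<le> t \<Longrightarrow> (s, t) \<in> Deep d"
  unfolding Deep_iff using X_bar_upward[of s a "t - d"] by simp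

text \<open>Around each solution at \<open>t0\<close> Rouche's theorem preserves the number of
  solutions. None appears elsewhere: solutions at heights tending to \<open>t0\<close> that stay
  outside the small discs are bounded, so they cluster at a solution for \<open>t0\<close> outside
  these discs.\<close>

lemma param_count_locally_constant:
  assumes a: "(s, a) \<in> X_bar" "a < t0"
  shows "\<forall>\<^sub>F t in nhds t0. param_count s t = param_count s t0"
proof -
  define d where "d = (t0 - a) / 2"
  have d: "0 < d" using a by (simp add: d_def)
  have st0: "(s, t0) \<in> Deep d" by (rule Deep_line[OF a(1)]) (use a in \<open>simp add: d_def field_simps\<close>)
  have near: "\<forall>\<^sub>F t in nhds t0. (s, t) \<in> Deep d \<and> t < t0 + 1"
  proof -
    have "\<forall>\<^sub>F t in nhds t0. t \<in> {a + d<..<t0 + 1}"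
      by (rule eventually_nhds_in_open) (use a in \<open>auto simp: d_def field_simps\<close>)
    then show ?thesis by eventually_elim (auto intro: Deep_line[OF a(1)])
  qed
  define Z0 where "Z0 = params s t0"
  have Z0: "finite Z0" unfolding Z0_def by (rule params_finite[OF d st0])
  \<comment> \<open>Rouche's circle has radius \<open>r\<close> inside a disc of radius
    \<open>2 * r\<close> on which g is defined; separation by \<open>4 * r\<close> keeps each small
    disc away from the larger discs of the other zeros.\<close>
  have "\<exists>r>0. (\<forall>z\<in>Z0. cball z (2 * r) \<subseteq> {\<kappa>. good (\<kappa>, s, t0)}) \<and> (\<forall>z\<in>Z0. \<forall>z'\<in>Z0. z \<noteq> z' \<longrightarrow> 4 * r < dist z z')"
  proof -
    have "\<forall>\<^sub>F r in at_right (0::real). cball z (2 * r) \<subseteq> {\<kappa>. good (\<kappa>, s, t0)}" if "z \<in> Z0" for z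
    proof -
      have "z \<in> {\<kappa>. good (\<kappa>, s, t0)}" using that by (simp add: Z0_def params_iff)
      then obtain e where e: "0 < e" "cball z e \<subseteq> {\<kappa>. good (\<kappa>, s, t0)}"
        using val_holomorphic(1)[OF d st0] open_contains_cball by blast
      have "\<forall>\<^sub>F r in at_right (0::real). r \<in> {0<..<e / 2}" by (rule eventually_at_right_real) (use e in simp)
      then show ?thesis by eventually_elim (use e(2) in force)
    qed
    moreover have "\<forall>\<^sub>F r in at_right (0::real). z \<noteq> z' \<longrightarrow> 4 * r < dist z z'" for z z' :: complex
    proof (cases "z = z'")
      case False
      have "\<forall>\<^sub>F r in at_right (0::real). r \<in> {0<..<dist z z' / 4}" by (rule eventually_at_right_real) (use False in simp)
      then show ?thesis by eventually_elim auto
    qed simp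
    ultimately have "\<forall>\<^sub>F r in at_right (0::real). (\<forall>z\<in>Z0. cball z (2 * r) \<subseteq> {\<kappa>. good (\<kappa>, s, t0)})
        \<and> (\<forall>z\<in>Z0. \<forall>z'\<in>Z0. z \<noteq> z' \<longrightarrow> 4 * r < dist z z') \<and> 0 < r"
      using Z0 by (intro eventually_conj eventually_ball_finite ballI) (auto simp: eventually_at_right_less)
    then show ?thesis using eventually_happens'[OF trivial_limit_at_right_real] by fast
  qed
  then obtain r where r: "0 < r" "\<And>z. z \<in> Z0 \<Longrightarrow> cball z (2 * r) \<subseteq> {\<kappa>. good (\<kappa>, s, t0)}"
    "\<And>z z'. z \<in> Z0 \<Longrightarrow> z' \<in> Z0 \<Longrightarrow> z \<noteq> z' \<Longrightarrow> 4 * r < dist z z'" by blast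
  have apart: "w \<notin> cball z (2 * r)" if "z \<in> Z0" "z' \<in> Z0" "z \<noteq> z'" "w \<in> ball z' r \<or> w = z'" for w z z'
    using r(3)[OF that(1-3)] that(4) r(1) dist_triangle[of z z' w] by (auto simp: dist_commute)
  have zeros0: "{p \<in> ball z (2 * r). defect s t0 p = 0} = {z}" if z: "z \<in> Z0" for z
  proof -
    have "p = z" if "p \<in> ball z (2 * r)" "defect s t0 p = 0" for p
    proof -
      have "good (p, s, t0)" using subsetD[OF r(2)[OF z], of p] that(1) by simp
      then have "p \<in> Z0" using that(2) by (simp add: Z0_def params_iff)
      then show ?thesis using apart[OF z \<open>p \<in> Z0\<close>, of p] that(1) by auto
    qed
    moreover have "defect s t0 z = 0" using z by (simp add: Z0_def params_iff)
    ultimately show ?thesis using r(1) by auto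
  qed
  let ?S = "{t. (s, t) \<in> Deep d}"
  have at_pair: "((\<lambda>p. val (snd p, s, fst p)) \<longlongrightarrow> val (\<kappa>, s, t0)) (nbh (t0, \<kappa>) (?S \<times> UNIV))"
    "\<forall>\<^sub>F p in nbh (t0, \<kappa>) (?S \<times> UNIV). good (snd p, s, fst p)"
    "((\<lambda>p. val (snd p, s, t0)) \<longlongrightarrow> val (\<kappa>, s, t0)) (nbh (t0, \<kappa>) (?S \<times> UNIV))"
    "(snd \<longlongrightarrow> \<kappa>) (nbh (t0, \<kappa>) (?S \<times> UNIV))"
    if g: "good (\<kappa>, s, t0)" for \<kappa>
  proof -
    have id: "((\<lambda>p. p) \<longlongrightarrow> (t0, \<kappa>)) (nbh (t0, \<kappa>) (?S \<times> UNIV))"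
      by (intro filterlim_mono[OF filterlim_ident]) auto
    show k: "(snd \<longlongrightarrow> \<kappa>) (nbh (t0, \<kappa>) (?S \<times> UNIV))" using tendsto_snd[OF id] by simp
    have t: "(fst \<longlongrightarrow> t0) (nbh (t0, \<kappa>) (?S \<times> UNIV))" using tendsto_fst[OF id] by simp
    have D: "\<forall>\<^sub>F p in nbh (t0, \<kappa>) (?S \<times> UNIV). (s, fst p) \<in> Deep d"
      by (simp add: eventually_inf_principal mem_Times_iff)
    show "((\<lambda>p. val (snd p, s, fst p)) \<longlongrightarrow> val (\<kappa>, s, t0)) (nbh (t0, \<kappa>) (?S \<times> UNIV))"
      "\<forall>\<^sub>F p in nbh (t0, \<kappa>) (?S \<times> UNIV). good (snd p, s, fst p)"
      using val_tendsto[OF d st0 g k tendsto_const t D] by auto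
    show "((\<lambda>p. val (snd p, s, t0)) \<longlongrightarrow> val (\<kappa>, s, t0)) (nbh (t0, \<kappa>) (?S \<times> UNIV))"
      using val_tendsto(2)[OF d st0 g k tendsto_const tendsto_const] st0 by auto
  qed
  have "\<forall>\<^sub>F t in nbh t0 ?S. \<forall>z\<in>Z0. \<forall>\<kappa>\<in>cball z (2 * r). good (\<kappa>, s, t)"
  proof (rule eventually_ball_finite[OF Z0], rule ballI)
    fix z assume z: "z \<in> Z0"
    have "\<forall>\<^sub>F t in nbh t0 ?S. \<forall>\<kappa>\<in>cball z (2 * r). (\<lambda>p. good (snd p, s, fst p)) (t, \<kappa>)"
      by (rule tube_eventually[where D = UNIV]) (use at_pair(2) r(2)[OF z] in auto)
    then show "\<forall>\<^sub>F t in nbh t0 ?S. \<forall>\<kappa>\<in>cball z (2 * r). good (\<kappa>, s, t)" by simp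
  qed
  then have good: "\<forall>\<^sub>F t in nhds t0. \<forall>z\<in>Z0. \<forall>\<kappa>\<in>cball z (2 * r). good (\<kappa>, s, t)"
    using near by (auto simp: eventually_inf_principal elim: eventually_elim2)
  have "\<forall>\<^sub>F t in nbh t0 ?S. \<forall>z\<in>Z0. \<forall>\<kappa>\<in>sphere z r. norm (defect s t \<kappa> - defect s t0 \<kappa>) < norm (defect s t0 \<kappa>)"
  proof (rule eventually_ball_finite[OF Z0], rule ballI)
    fix z assume z: "z \<in> Z0"
    have "\<forall>\<^sub>F t in nbh t0 ?S. \<forall>\<kappa>\<in>sphere z r.
        (\<lambda>p. norm (defect s (fst p) (snd p) - defect s t0 (snd p)) < norm (defect s t0 (snd p))) (t, \<kappa>)"
    proof (rule tube_eventually[where D = UNIV])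
      fix \<kappa> assume \<kappa>: "\<kappa> \<in> sphere z r"
      then have "\<kappa> \<in> ball z (2 * r)" "\<kappa> \<noteq> z" using r(1) by auto
      then have g: "good (\<kappa>, s, t0)" and nz: "defect s t0 \<kappa> \<noteq> 0"
        using subsetD[OF r(2)[OF z], of \<kappa>] zeros0[OF z] by auto
      have "((\<lambda>p. norm (defect s t0 (snd p)) - norm (defect s (fst p) (snd p) - defect s t0 (snd p)))
          \<longlongrightarrow> norm (defect s t0 \<kappa>) - norm (defect s t0 \<kappa> - defect s t0 \<kappa>)) (nbh (t0, \<kappa>) (?S \<times> UNIV))"
        unfolding defect_def by (intro tendsto_intros at_pair[OF g])
      then have "\<forall>\<^sub>F p in nbh (t0, \<kappa>) (?S \<times> UNIV).
          0 < norm (defect s t0 (snd p)) - norm (defect s (fst p) (snd p) - defect s t0 (snd p))"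
        by (rule order_tendstoD(1)) (use nz in simp)
      then show "\<forall>\<^sub>F p in nbh (t0, \<kappa>) (?S \<times> UNIV).
          norm (defect s (fst p) (snd p) - defect s t0 (snd p)) < norm (defect s t0 (snd p))"
        by eventually_elim simp
    qed auto
    then show "\<forall>\<^sub>F t in nbh t0 ?S. \<forall>\<kappa>\<in>sphere z r. norm (defect s t \<kappa> - defect s t0 \<kappa>) < norm (defect s t0 \<kappa>)" by simp
  qed
  then have less: "\<forall>\<^sub>F t in nhds t0. \<forall>z\<in>Z0. \<forall>\<kappa>\<in>sphere z r. norm (defect s t \<kappa> - defect s t0 \<kappa>) < norm (defect s t0 \<kappa>)"
    using near by (auto simp: eventually_inf_principal elim: eventually_elim2)
  have confined: "\<forall>\<^sub>F t in nhds t0. params s t \<subseteq> (\<Union>z\<in>Z0. ball z r)"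
  proof (rule ccontr)
    let ?P = "\<lambda>t. params s t \<subseteq> (\<Union>z\<in>Z0. ball z r)"
    assume "\<not> eventually ?P (nhds t0)"
    then have nb: "nbh t0 {t. \<not> ?P t} \<noteq> bot"
      unfolding trivial_limit_def eventually_inf_principal by simp
    obtain k where k: "\<And>t. \<not> ?P t \<Longrightarrow> k t \<in> params s t - (\<Union>z\<in>Z0. ball z r)"
    proof -
      have "\<forall>t. \<exists>k. \<not> ?P t \<longrightarrow> k \<in> params s t - (\<Union>z\<in>Z0. ball z r)" by blast
      then obtain k where "\<forall>t. \<not> ?P t \<longrightarrow> k t \<in> params s t - (\<Union>z\<in>Z0. ball z r)" by (rule choice[THEN exE])
      then show thesis by (intro that[of k]) simp
    qed
    obtain R1 where R1: "\<And>t \<kappa>. (s, t) \<in> Deep d \<Longrightarrow> param \<kappa> s t \<Longrightarrow> norm \<kappa> \<le> R1 + 4 * t"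
      using param_bounded[OF d, of "\<bar>real_of_int (s 0)\<bar>"] by blast
    have nearP: "\<forall>\<^sub>F t in nbh t0 {t. \<not> ?P t}. (s, t) \<in> Deep d \<and> t < t0 + 1"
      using near unfolding eventually_inf_principal by eventually_elim simp
    have kP: "\<forall>\<^sub>F t in nbh t0 {t. \<not> ?P t}. k t \<in> params s t - (\<Union>z\<in>Z0. ball z r)"
      unfolding eventually_inf_principal using k by (auto intro: always_eventually)
    obtain \<kappa> where "\<kappa> \<in> cball 0 (R1 + 4 * (t0 + 1)) - (\<Union>z\<in>Z0. ball z r)" "param \<kappa> s t0"
    proof (rule param_cluster[OF d st0 nb tendsto_const, of "\<lambda>t. t" k "cball 0 (R1 + 4 * (t0 + 1)) - (\<Union>z\<in>Z0. ball z r)"])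
      show "((\<lambda>t. t) \<longlongrightarrow> t0) (nbh t0 {t. \<not> ?P t})"
        by (intro filterlim_mono[OF filterlim_ident]) auto
      show "\<forall>\<^sub>F t in nbh t0 {t. \<not> ?P t}. (s, t) \<in> Deep d" using nearP by eventually_elim simp
      show "\<forall>\<^sub>F t in nbh t0 {t. \<not> ?P t}. param (k t) s t" using kP by eventually_elim (simp add: params_def)
      show "compact (cball 0 (R1 + 4 * (t0 + 1)) - (\<Union>z\<in>Z0. ball z r))"
        by (intro compact_diff compact_cball) auto
      show "\<forall>\<^sub>F t in nbh t0 {t. \<not> ?P t}. k t \<in> cball 0 (R1 + 4 * (t0 + 1)) - (\<Union>z\<in>Z0. ball z r)"
        using nearP kP
      proof eventually_elim
        case (elim t)
        then have "norm (k t) \<le> R1 + 4 * t" using R1[of t "k t"] by (simp add: params_def)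
        then show ?case using elim by auto
      qed
    qed
    then show False using r(1) by (auto simp: Z0_def params_def)
  qed
  show ?thesis
    using near good less confined
  proof eventually_elim
    case (elim t)
    have st: "(s, t) \<in> Deep d" using elim(1) by simp
    have sub: "params s t \<inter> ball z (2 * r) \<subseteq> ball z r" if z: "z \<in> Z0" for z
    proof
      fix w assume w: "w \<in> params s t \<inter> ball z (2 * r)"
      then obtain z' where z': "z' \<in> Z0" "w \<in> ball z' r" using elim(4) by blast
      then show "w \<in> ball z r" using apart[OF z z'(1), of w] w by (cases "z = z'") auto
    qed
    have "(\<Sum>p\<in>params s t \<inter> ball z (2 * r). zorder (defect s t) p) = zorder (defect s t0) z" if z: "z \<in> Z0" for z
    proof -
      have "(\<Sum>p\<in>params s t \<inter> ball z (2 * r). zorder (defect s t) p)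
          = (\<Sum>p\<in>{p \<in> ball z (2 * r). defect s t0 p = 0}. zorder (defect s t0) p)"
      proof (rule param_count_disc[OF d st r(1)])
        show "defect s t0 holomorphic_on ball z (2 * r)"
          by (rule defect_holomorphic[OF d st0 subset_trans[OF ball_subset_cball r(2)[OF z]]])
        show "ball z (2 * r) \<subseteq> {\<kappa>. good (\<kappa>, s, t)}" using bspec[OF elim(2) z] ball_subset_cball[of z "2 * r"] by blast
        show "norm (defect s t p - defect s t0 p) < norm (defect s t0 p)" if "p \<in> sphere z r" for p
          using elim(3) z that by blast
      qed (use r(1) zeros0[OF z] sub[OF z] in auto)
      then show ?thesis using zeros0[OF z] by simp
    qed
    moreover have "params s t = (\<Union>z\<in>Z0. params s t \<inter> ball z (2 * r))"
    proof (intro subset_antisym subsetI)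
      fix w assume w: "w \<in> params s t"
      then obtain z where "z \<in> Z0" "w \<in> ball z r" using elim(4) by blast
      then show "w \<in> (\<Union>z\<in>Z0. params s t \<inter> ball z (2 * r))" using w r(1) by (intro UN_I[of z]) simp_all
    qed blast
    then have "param_count s t = (\<Sum>p\<in>(\<Union>z\<in>Z0. params s t \<inter> ball z (2 * r)). zorder (defect s t) p)"
      unfolding param_count_def by (rule arg_cong)
    moreover have "\<dots> = (\<Sum>z\<in>Z0. \<Sum>p\<in>params s t \<inter> ball z (2 * r). zorder (defect s t) p)"
    proof (rule sum.UNION_disjoint[OF Z0])
      show "\<forall>z\<in>Z0. finite (params s t \<inter> ball z (2 * r))" using params_finite[OF d st] by simp
      show "\<forall>z\<in>Z0. \<forall>z'\<in>Z0. z \<noteq> z' \<longrightarrow> params s t \<inter> ball z (2 * r) \<inter> (params s t \<inter> ball z' (2 * r)) = {}"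
      proof (intro ballI impI)
        fix z z' assume zz: "z \<in> Z0" "z' \<in> Z0" "z \<noteq> z'"
        then show "params s t \<inter> ball z (2 * r) \<inter> (params s t \<inter> ball z' (2 * r)) = {}"
          using sub[OF zz(2)] apart[OF zz] ball_subset_cball[of z "2 * r"] by blast
      qed
    qed
    ultimately show ?case by (simp add: param_count_def Z0_def)
  qed
qed

text \<open>At large height \<open>g\<close> is within 3 of \<open>Z (s, t)\<close>, so Rouche's theorem compares the equation \<open>g = \<kappa>\<close>
  with \<open>Z (s, t) = \<kappa>\<close>.\<close>

lemma param_count_large:
  assumes a: "(s, a) \<in> X_bar"
  shows "\<forall>\<^sub>F t in at_top. param_count s t = 1"
proof -
  obtain R1 where R1: "0 \<le> R1" "\<And>t \<kappa>. (s, t) \<in> Deep 1 \<Longrightarrow> param \<kappa> s t \<Longrightarrow> norm \<kappa> \<le> R1 + 4 * t"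
    using param_bounded[of 1 "\<bar>real_of_int (s 0)\<bar>"] by auto
  define m where "m = 2 * pi * \<bar>real_of_int (s 0)\<bar>"
  have m: "0 \<le> m" by (simp add: m_def)
  \<comment> \<open>\<open>K t\<close> exceeds both the bound \<open>R1 + 4 * t\<close> for
    solutions and the bound \<open>t + m\<close> for \<open>Z (s, t)\<close>, with room to spare on
    the circle of radius \<open>K t - 1\<close>; it grows only linearly, so its logarithm stays
    below the available height \<open>t - a\<close>.\<close>
  define K where "K t = R1 + 4 * t + (t + m) + 20" for t
  have "\<forall>\<^sub>F t in at_top. ln (4 * (R1 + 4 * t + (t + m) + 20 + pi + 3)) \<le> t - a" by real_asymp
  then have "\<forall>\<^sub>F t in at_top. ln (4 * (K t + pi + 3)) \<le> t - a" unfolding K_def .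
  then show ?thesis
    using eventually_ge_at_top[of "a + pi + 2"] eventually_ge_at_top[of 0]
  proof eventually_elim
    case (elim t)
    have K: "K t > 2 * pi + 6" using elim R1 m pi_less_4 by (simp add: K_def)
    have st: "(s, t) \<in> Deep 1" by (rule Deep_line[OF a]) (use elim pi_gt3 in simp)
    have X: "(s, t) \<in> X" by (rule Deep_X[OF st]) simp
    have "QK (K t) \<le> t - a" using elim by (simp add: QK_def)
    then have Tall: "Tall (QK (K t)) s t" using elim pi_gt3 by (intro Tall_large[OF a]) simp_all
    have val: "good (\<kappa>, s, t) \<and> val (\<kappa>, s, t) = glim \<kappa> s t" if "norm \<kappa> \<le> K t" for \<kappa>
      by (rule val_eqI[OF gext_glim[OF K that Tall X]])
    have "norm (Z (s, t)) \<le> norm (of_real t :: complex) + norm (2 * of_real pi * \<i> * of_int (s 0))"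
      unfolding Z_eq by (rule norm_triangle_ineq)
    then have Z: "norm (Z (s, t)) \<le> t + m" using elim by (simp add: m_def norm_mult)
    have zero: "{p \<in> ball 0 (K t). Z (s, t) - p = 0} = {Z (s, t)}" using Z R1 elim by (auto simp: K_def)
    have bound: "params s t \<subseteq> ball 0 (K t - 1)" using R1(2)[OF st] elim m by (force simp: params_def K_def)
    have "(\<Sum>p\<in>params s t \<inter> ball 0 (K t). zorder (defect s t) p)
        = (\<Sum>p\<in>{p \<in> ball 0 (K t). Z (s, t) - p = 0}. zorder (\<lambda>p. Z (s, t) - p) p)"
    proof (rule param_count_disc[OF _ st, where r = "K t - 1"])
      show "norm (defect s t p - (Z (s, t) - p)) < norm (Z (s, t) - p)" if "p \<in> sphere 0 (K t - 1)" for p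
      proof -
        have "norm p = K t - 1" using that by simp
        then have "norm (defect s t p - (Z (s, t) - p)) \<le> 3"
          using val[of p] glim_Z[OF K _ Tall, of p] by (simp add: defect_def)
        moreover have "norm p - norm (Z (s, t)) \<le> norm (Z (s, t) - p)"
          using norm_triangle_ineq2[of p "Z (s, t)"] by (simp add: norm_minus_commute)
        ultimately show ?thesis using \<open>norm p = K t - 1\<close> Z R1 elim by (simp add: K_def)
      qed
      show "{p \<in> ball 0 (K t). Z (s, t) - p = 0} \<subseteq> ball 0 (K t - 1)"
        unfolding zero using Z R1 elim by (simp add: K_def)
    qed (use val K bound zero pi_gt3 in \<open>auto intro!: holomorphic_intros\<close>)
    also have "\<dots> = zorder (\<lambda>p. Z (s, t) - p) (Z (s, t))" unfolding zero by simp
    also have "\<dots> = 1"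
      by (rule zorder_eqI[where S = UNIV and g = "\<lambda>_. - 1"]) auto
    also have "params s t \<inter> ball 0 (K t) = params s t" using bound by auto
    finally show ?case by (simp add: param_count_def)
  qed
qed

lemma param_count_eq_1:
  assumes a: "(s, a) \<in> X_bar" "a < t"
  shows "param_count s t = 1"
proof -
  obtain b where b: "param_count s b = 1" "a < b"
    using eventually_happens'[OF _ eventually_conj[OF param_count_large[OF a(1)] eventually_gt_at_top[of a]]] by auto
  have "param_count s t = param_count s b"
  proof (rule connected_local_const[of "{a<..}"])
    show "\<forall>x\<in>{a<..}. \<forall>\<^sub>F y in at x within {a<..}. param_count s x = param_count s y"
    proof
      fix x assume "x \<in> {a<..}"
      then have "\<forall>\<^sub>F y in nhds x. param_count s y = param_count s x" by (intro param_count_locally_constant[OF a(1)]) simp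
      then show "\<forall>\<^sub>F y in at x within {a<..}. param_count s x = param_count s y"
        unfolding eventually_at_filter by eventually_elim simp
    qed
  qed (use a(2) b(2) in auto)
  with b show ?thesis by simp
qed

text \<open>The zeros of the defect are isolated, so each has order at least 1; the orders add up to
  1, which leaves exactly one zero.\<close>

lemma ex1_param:
  assumes d: "0 < d" and st: "(s, t) \<in> Deep d"
  shows "\<exists>!\<kappa>. param \<kappa> s t"
proof -
  have fin: "finite (params s t)" by (rule params_finite[OF d st])
  have one: "(\<Sum>\<kappa>\<in>params s t. zorder (defect s t) \<kappa>) = 1"
    using param_count_eq_1[of s "t - d" t] d st by (simp add: param_count_def Deep_iff)
  have pos: "1 \<le> zorder (defect s t) \<kappa>" if \<kappa>: "\<kappa> \<in> params s t" for \<kappa>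
  proof -
    let ?A = "{\<kappa>. good (\<kappa>, s, t)}"
    have A: "open ?A" "\<kappa> \<in> ?A" using val_holomorphic(1)[OF d st] \<kappa> by (auto simp: params_iff)
    have "\<forall>\<^sub>F w in at \<kappa>. w \<in> ?A" using eventually_at_in_open'[OF A] .
    moreover have "\<forall>\<^sub>F w in at \<kappa>. w \<notin> params s t"
      using islimpt_finite[OF fin, of \<kappa>] by (simp add: islimpt_iff_eventually)
    ultimately have "\<forall>\<^sub>F w in at \<kappa>. defect s t w \<noteq> 0" by eventually_elim (simp add: params_iff)
    then have "\<exists>\<^sub>F w in at \<kappa>. defect s t w \<noteq> 0" by (rule eventually_frequently[rotated]) simp
    from zorder_pos_iff[OF defect_holomorphic[OF d st subset_refl] A this] \<kappa>
    show ?thesis by (simp add: params_iff)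
  qed
  have "int (card (params s t)) = (\<Sum>\<kappa>\<in>params s t. 1)" by simp
  also have "\<dots> \<le> (\<Sum>\<kappa>\<in>params s t. zorder (defect s t) \<kappa>)" by (intro sum_mono pos)
  finally have "card (params s t) \<le> 1" using one by simp
  moreover have "params s t \<noteq> {}" using one by auto
  ultimately have "card (params s t) = 1" using fin by (simp add: card_gt_0_iff le_antisym Suc_leI)
  then obtain \<kappa> where "params s t = {\<kappa>}" by (rule card_1_singletonE)
  then have "param w s t \<longleftrightarrow> w = \<kappa>" for w unfolding params_def by blast
  then show ?thesis by simp
qed

section \<open>The homeomorphism\<close>

text \<open>Replacing the first entry of \<open>sf i\<close> by that of \<open>s\<close> moves the value of \<open>g\<close> by \<open>2 \<pi> \<i> (s 0 - sf i 0)\<close>,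
  and by continuity the moved value still tends to \<open>w\<close>.\<close>

lemma address_tendsto_step:
  assumes d: "0 < d" and st: "(s, t) \<in> Deep d" and w: "gext \<kappa> (s, t) = Some w"
    and kf: "(kf \<longlongrightarrow> \<kappa>) Fl" and vf: "(vf \<longlongrightarrow> w) Fl"
    and ev: "\<forall>\<^sub>F i in Fl. (sf i, tf i) \<in> Deep d" "\<forall>\<^sub>F i in Fl. gext (kf i) (sf i, tf i) = Some (vf i)"
    and tail: "((\<lambda>i. drp 1 (sf i)) \<longlongrightarrow> drp 1 s) Fl" "((\<lambda>i. hgt (sf i) 1 (tf i)) \<longlongrightarrow> hgt s 1 t) Fl"
  shows "(sf \<longlongrightarrow> s) Fl" "(tf \<longlongrightarrow> t) Fl"
proof -
  have later: "\<forall>\<^sub>F i in Fl. sf i (Suc k) = s (Suc k)" for k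
    using tail(1) by (auto simp: tendsto_address_iff drp_apply)
  have exp_eq: "exp u = hgt a 1 u + 1 + 2 * pi * \<bar>real_of_int (a 1)\<bar>" for a u
    by (simp add: hgt_1 F_def del: One_nat_def)
  have "((\<lambda>i. hgt (sf i) 1 (tf i) + 1 + 2 * pi * \<bar>real_of_int (s 1)\<bar>) \<longlongrightarrow> exp t) Fl"
    unfolding exp_eq[of t s] by (intro tendsto_intros tail)
  moreover have "\<forall>\<^sub>F i in Fl. hgt (sf i) 1 (tf i) + 1 + 2 * pi * \<bar>real_of_int (s 1)\<bar> = exp (tf i)"
    using later[of 0]
  proof eventually_elim
    case (elim i)
    then show ?case using exp_eq[of "tf i" "sf i"] by (simp del: One_nat_def add: One_nat_def[symmetric])
  qed
  ultimately have "((\<lambda>i. exp (tf i)) \<longlongrightarrow> exp t) Fl" by (rule Lim_transform_eventually)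
  then have "((\<lambda>i. ln (exp (tf i))) \<longlongrightarrow> ln (exp t)) Fl" by (rule tendsto_ln) simp
  then show t: "(tf \<longlongrightarrow> t) Fl" by simp
  define af where "af i = (sf i)(0 := s 0)" for i
  have "\<forall>\<^sub>F i in Fl. af i k = s k" for k
    using later[of "k - 1"] by (cases k) (simp_all add: af_def)
  then have af: "(af \<longlongrightarrow> s) Fl" by (simp add: tendsto_address_iff)
  have deep: "\<forall>\<^sub>F i in Fl. (af i, tf i) \<in> Deep d"
    using ev(1) by eventually_elim (simp add: af_def Deep_iff X_bar_iff hgt_entry)
  have g: "good (\<kappa>, s, t)" "val (\<kappa>, s, t) = w" using val_eqI[OF w] by simp_all
  have "((\<lambda>i. val (kf i, af i, tf i)) \<longlongrightarrow> w) Fl"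
    using val_tendsto(2)[OF d st g(1) kf af t deep] g(2) by simp
  then have "((\<lambda>i. val (kf i, af i, tf i) - vf i) \<longlongrightarrow> w - w) Fl" by (intro tendsto_diff vf)
  then have "((\<lambda>i. norm (val (kf i, af i, tf i) - vf i)) \<longlongrightarrow> 0) Fl" by (simp add: tendsto_norm_zero)
  then have "\<forall>\<^sub>F i in Fl. norm (val (kf i, af i, tf i) - vf i) < 2 * pi"
    by (rule order_tendstoD(2)) simp
  then have "\<forall>\<^sub>F i in Fl. sf i 0 = s 0"
    using ev(2)
  proof eventually_elim
    case (elim i)
    have "val (kf i, af i, tf i) = vf i + 2 * of_real pi * \<i> * of_int (s 0 - sf i 0)"
      using val_eqI[OF gext_entry[OF elim(2), of "s 0"]] by (simp add: af_def)
    then have "val (kf i, af i, tf i) - vf i = 2 * of_real pi * \<i> * of_int (s 0 - sf i 0)" by simp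
    then have "norm (val (kf i, af i, tf i) - vf i) = 2 * pi * \<bar>real_of_int (s 0 - sf i 0)\<bar>"
      by (simp only: norm_mult norm_of_int) simp
    then have "\<bar>real_of_int (s 0 - sf i 0)\<bar> < 1" using elim(1) by simp
    then show ?case by linarith
  qed
  with later have "\<forall>\<^sub>F i in Fl. sf i k = s k" for k by (cases k) simp_all
  then show "(sf \<longlongrightarrow> s) Fl" by (simp add: tendsto_address_iff)
qed

text \<open>For each fixed \<open>n\<close> the \<open>n\<close>-th iterates converge. Imaginary
  parts then determine the entry at level \<open>n\<close>, as 3 pi / 4 + 3 pi / 4 + pi / 4 is below
  2 pi, and real parts the height up to 7. Once the entries agree, each backward step halves the
  difference of the heights, because the derivative of \<open>exp\<close> is at least 2 above height
  1.\<close>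

lemma address_tendsto_high:
  assumes K: "K > 2 * pi + 6" "norm \<kappa> < K" and d: "QK K \<le> d"
    and st: "(s, t) \<in> Deep d" and w: "gext \<kappa> (s, t) = Some w"
    and kf: "(kf \<longlongrightarrow> \<kappa>) Fl" and vf: "(vf \<longlongrightarrow> w) Fl"
    and ev: "\<forall>\<^sub>F i in Fl. (sf i, tf i) \<in> Deep d" "\<forall>\<^sub>F i in Fl. gext (kf i) (sf i, tf i) = Some (vf i)"
  shows "(sf \<longlongrightarrow> s) Fl" "(tf \<longlongrightarrow> t) Fl"
proof -
  have high: "Tall (QK K) (drp n a) (hgt a n u)" "1 \<le> hgt a n u" "(E k ^^ n) v = glim k (drp n a) (hgt a n u)"
    if "(a, u) \<in> Deep d" "gext k (a, u) = Some v" "norm k \<le> K" for a u k v n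
  proof -
    show T: "Tall (QK K) (drp n a) (hgt a n u)" by (rule Tall_drp[OF Deep_gext_glim(1)[OF K(1) that(3) d that(1)]])
    show "1 \<le> hgt a n u" using Tall_0[OF T] QK_pos(1)[of K] by linarith
    have "(drp n a, hgt a n u) \<in> X" by (rule X_drp[OF gext_X[OF that(2)]])
    from gext_glim[OF K(1) that(3) T this] gext_iter[OF that(2), of n]
    show "(E k ^^ n) v = glim k (drp n a) (hgt a n u)" by simp
  qed
  have evK: "\<forall>\<^sub>F i in Fl. norm (kf i) < K" by (rule order_tendstoD(2)[OF tendsto_norm[OF kf] K(2)])
  have near: "\<forall>\<^sub>F i in Fl. sf i n = s n \<and> \<bar>hgt (sf i) n (tf i) - hgt s n t\<bar> \<le> 7" for n
  proof -
    have "\<forall>\<^sub>F i in Fl. dist ((E (kf i) ^^ n) (vf i)) ((E \<kappa> ^^ n) w) < pi / 4"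
      by (rule tendstoD[OF tendsto_E_iter[OF kf vf]]) simp
    then show ?thesis using ev evK
    proof eventually_elim
      case (elim i)
      let ?u = "(E (kf i) ^^ n) (vf i)" and ?v = "(E \<kappa> ^^ n) w"
      note hi = high[OF elim(2,3) less_imp_le[OF elim(4)], of n] and h = high[OF st w less_imp_le[OF K(2)], of n]
      have uv: "norm (?u - ?v) < pi / 4" using elim(1) by (simp add: dist_norm)
      have im: "\<bar>Im ?u - Im ?v\<bar> < pi / 4" using abs_Im_le_cmod[of "?u - ?v"] uv by simp
      have re: "\<bar>Re ?u - Re ?v\<bar> < pi / 4" using abs_Re_le_cmod[of "?u - ?v"] uv by simp
      have "\<bar>Im ?u - 2 * pi * real_of_int (sf i n)\<bar> \<le> 3 * pi / 4"
        using glim_Im[OF K(1) less_imp_le[OF elim(4)] hi(1)] hi(3) by simp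
      moreover have "\<bar>Im ?v - 2 * pi * real_of_int (s n)\<bar> \<le> 3 * pi / 4"
        using glim_Im[OF K(1) less_imp_le[OF K(2)] h(1)] h(3) by simp
      ultimately have "\<bar>2 * pi * real_of_int (sf i n) - 2 * pi * real_of_int (s n)\<bar> < 2 * pi" using im by linarith
      then have "2 * pi * \<bar>real_of_int (sf i n - s n)\<bar> < 2 * pi * 1"
        by (simp add: abs_mult flip: right_diff_distrib)
      then have "\<bar>real_of_int (sf i n - s n)\<bar> < 1" using pi_gt_zero by (subst (asm) mult_less_cancel_left_pos) simp_all
      then have "sf i n = s n" by linarith
      moreover have "\<bar>Re ?u - hgt (sf i) n (tf i)\<bar> \<le> 3"
        using glim_Re[OF K(1) less_imp_le[OF elim(4)] hi(1)] hi(3) by simp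
      moreover have "\<bar>Re ?v - hgt s n t\<bar> \<le> 3"
        using glim_Re[OF K(1) less_imp_le[OF K(2)] h(1)] h(3) by simp
      ultimately show ?case using re pi_less_4 by linarith
    qed
  qed
  show "(sf \<longlongrightarrow> s) Fl" unfolding tendsto_address_iff
  proof
    show "\<forall>\<^sub>F i in Fl. sf i k = s k" for k using near[of k] by eventually_elim simp
  qed
  have contract: "\<bar>a - b\<bar> \<le> \<bar>exp a - exp b\<bar> / 2" if "1 \<le> a" "1 \<le> b" for a b :: real
  proof -
    have *: "y - x \<le> (exp y - exp x) / 2" if "1 \<le> x" "x \<le> y" for x y :: real
    proof -
      have "2 \<le> exp x" using exp_ge_add_one_self[of x] that by linarith
      then have "2 * (y - x) \<le> exp x * (y - x)" using that by (intro mult_right_mono) auto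
      also have "\<dots> \<le> exp x * (exp (y - x) - 1)"
        using exp_ge_add_one_self[of "y - x"] by (intro mult_left_mono) (linarith, simp)
      also have "\<dots> = exp y - exp x" by (simp add: right_diff_distrib flip: exp_add)
      finally show ?thesis by simp
    qed
    show ?thesis using *[of a b] *[of b a] that by (cases "a \<le> b") (auto simp: abs_if)
  qed
  have small: "\<forall>\<^sub>F i in Fl. \<bar>hgt (sf i) n (tf i) - hgt s n t\<bar> \<le> 7 / 2 ^ m" for m n
  proof (induction m arbitrary: n)
    case 0
    show ?case using near[of n] by eventually_elim simp
  next
    case (Suc m)
    show ?case using Suc[of "Suc n"] near[of "Suc n"] ev evK
    proof eventually_elim
      case (elim i)
      have "\<bar>hgt (sf i) n (tf i) - hgt s n t\<bar> \<le> \<bar>exp (hgt (sf i) n (tf i)) - exp (hgt s n t)\<bar> / 2"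
        by (rule contract) (use high(2)[OF elim(3,4) less_imp_le[OF elim(5)]] high(2)[OF st w less_imp_le[OF K(2)]] in auto)
      also have "exp (hgt (sf i) n (tf i)) - exp (hgt s n t) = hgt (sf i) (Suc n) (tf i) - hgt s (Suc n) t"
        using elim(2) by (simp add: hgt_Suc F_def)
      also have "\<bar>\<dots>\<bar> / 2 \<le> 7 / 2 ^ Suc m" using elim(1) by simp
      finally show ?case .
    qed
  qed
  show "(tf \<longlongrightarrow> t) Fl"
  proof (rule tendstoI)
    fix e :: real assume "0 < e"
    have "(\<lambda>m. 7 / 2 ^ m :: real) \<longlonglongrightarrow> 0" by real_asymp
    then obtain m where "7 / 2 ^ m < e"
      using order_tendstoD(2)[OF _ \<open>0 < e\<close>] eventually_happens'[OF sequentially_bot] by blast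
    then show "\<forall>\<^sub>F i in Fl. dist (tf i) t < e"
      using small[of 0 m] by (auto simp: dist_real_def elim: eventually_mono)
  qed
qed

text \<open>The value \<open>w\<close> need not be \<kappa>, so that the induction can pass to the
  image point with value \<open>E \<kappa> w\<close>; there the entries and the height are recovered
  before \<open>address_tendsto_step\<close> adds the first entry.\<close>

lemma address_tendsto:
  assumes "K > 2 * pi + 6" "norm \<kappa> < K" "QK K \<le> (F ^^ N) d" "0 < d" "(s, t) \<in> Deep d" "gext \<kappa> (s, t) = Some w"
    and "(kf \<longlongrightarrow> \<kappa>) Fl" "(vf \<longlongrightarrow> w) Fl"
    and "\<forall>\<^sub>F i in Fl. (sf i, tf i) \<in> Deep d" "\<forall>\<^sub>F i in Fl. gext (kf i) (sf i, tf i) = Some (vf i)"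
  shows "(sf \<longlongrightarrow> s) Fl \<and> (tf \<longlongrightarrow> t) Fl"
  using assms(3-)
proof (induction N arbitrary: d s t w sf tf vf)
  case 0
  then show ?case using address_tendsto_high[OF assms(1,2) _ 0(3,4,5,6,7,8)] by simp
next
  case (Suc N)
  note d = Suc.prems(2) and st = Suc.prems(3) and w = Suc.prems(4) and kf = Suc.prems(5) and vf = Suc.prems(6)
    and ev = Suc.prems(7,8)
  have "((\<lambda>i. drp 1 (sf i)) \<longlongrightarrow> drp 1 s) Fl \<and> ((\<lambda>i. hgt (sf i) 1 (tf i)) \<longlongrightarrow> hgt s 1 t) Fl"
  proof (rule Suc.IH)
    show "QK K \<le> (F ^^ N) (F d)" using Suc.prems(1) by (simp only: F_iter_Suc)
    show "0 < F d" using d by (simp add: F_def)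
    show "(drp 1 s, hgt s 1 t) \<in> Deep (F d)" using Deep_drp[OF st] d by simp
    show "gext \<kappa> (drp 1 s, hgt s 1 t) = Some (E \<kappa> w)" by (rule gext_step[OF w])
    show "((\<lambda>i. E (kf i) (vf i)) \<longlongrightarrow> E \<kappa> w) Fl" unfolding E_def by (intro tendsto_intros kf vf)
    show "\<forall>\<^sub>F i in Fl. (drp 1 (sf i), hgt (sf i) 1 (tf i)) \<in> Deep (F d)"
      using ev(1) by eventually_elim (rule Deep_drp[OF _ less_imp_le[OF d]])
    show "\<forall>\<^sub>F i in Fl. gext (kf i) (drp 1 (sf i), hgt (sf i) 1 (tf i)) = Some (E (kf i) (vf i))"
      using ev(2) by eventually_elim (rule gext_step)
  qed (rule kf)
  then show ?case using address_tendsto_step[OF d st w kf vf ev] by simp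
qed

section \<open>Injectivity of G and continuity in both directions\<close>

lemma G_param:
  assumes "0 < d" "(s, t) \<in> Deep d"
  shows "param (G (s, t)) s t" "param \<kappa> s t \<Longrightarrow> \<kappa> = G (s, t)"
proof -
  have eq: "G (s, t) = (THE \<kappa>. param \<kappa> s t)" by (simp add: G_def g_map_eq param_def)
  show "param (G (s, t)) s t" unfolding eq by (rule theI'[OF ex1_param[OF assms]])
  show "param \<kappa> s t \<Longrightarrow> \<kappa> = G (s, t)" unfolding eq by (rule the1_equality[symmetric, OF ex1_param[OF assms]])
qed

text \<open>Two points with the same parameter \<kappa> are both mapped to \<kappa> by the injective
  map \<open>gext \<kappa>\<close>.\<close>

lemma G_inj: "0 < d \<Longrightarrow> inj_on G (Deep d)"
proof (rule inj_onI)
  fix p q assume d: "0 < d" "p \<in> Deep d" "q \<in> Deep d" and eq: "G p = G q"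
  obtain s t s' t' where pq: "p = (s, t)" "q = (s', t')" by fastforce
  have "gext (G p) p = Some (G p)" "gext (G p) q = Some (G p)"
    using G_param(1)[OF d(1), of s t] G_param(1)[OF d(1), of s' t'] d eq by (auto simp: pq param_def)
  then show "p = q" using gext_inj unfolding pq by blast
qed

lemma G_inverse_tendsto:
  assumes d: "0 < d" and p: "p \<in> Deep d" and lim: "((\<lambda>i. G (pf i)) \<longlongrightarrow> G p) Fl" and ev: "\<forall>\<^sub>F i in Fl. pf i \<in> Deep d"
  shows "(pf \<longlongrightarrow> p) Fl"
proof -
  obtain s t where st: "p = (s, t)" by fastforce
  define \<kappa> where "\<kappa> = G p"
  define K where "K = norm \<kappa> + 2 * pi + 7"
  have K: "K > 2 * pi + 6" "norm \<kappa> < K" using pi_gt3 norm_ge_zero[of \<kappa>] unfolding K_def by linarith+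
  obtain N where N: "QK K \<le> (F ^^ N) d" using F_iter_reaches[OF d] .
  have self: "gext (G q) q = Some (G q)" if "q \<in> Deep d" for q
    using G_param(1)[OF d, of "fst q" "snd q"] that by (simp add: param_def)
  have "((\<lambda>i. fst (pf i)) \<longlongrightarrow> s) Fl \<and> ((\<lambda>i. snd (pf i)) \<longlongrightarrow> t) Fl"
  proof (rule address_tendsto[OF K N d])
    show "(s, t) \<in> Deep d" "gext \<kappa> (s, t) = Some \<kappa>" using p self[OF p] by (simp_all add: st \<kappa>_def)
    show "((\<lambda>i. G (pf i)) \<longlongrightarrow> \<kappa>) Fl" "((\<lambda>i. G (pf i)) \<longlongrightarrow> \<kappa>) Fl" using lim by (simp_all add: \<kappa>_def)
    show "\<forall>\<^sub>F i in Fl. (fst (pf i), snd (pf i)) \<in> Deep d" using ev by simp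
    show "\<forall>\<^sub>F i in Fl. gext (G (pf i)) (fst (pf i), snd (pf i)) = Some (G (pf i))"
      using ev by eventually_elim (simp add: self)
  qed
  then have "((\<lambda>i. (fst (pf i), snd (pf i))) \<longlongrightarrow> (s, t)) Fl" by (intro tendsto_Pair) auto
  then show ?thesis by (simp add: st)
qed

text \<open>If \<open>G\<close> stayed away from \<open>G p\<close> along points tending to
  \<open>p\<close>, its values would still be bounded there, since the first entries are eventually
  that of \<open>p\<close>. They would have a cluster point, a second parameter for
  \<open>p\<close>, contradicting uniqueness.\<close>

lemma G_continuous_on:
  assumes d: "0 < d"
  shows "continuous_on (Deep d) G"
  unfolding continuous_on_def
proof (intro ballI tendstoI, rule ccontr)
  fix p e assume p: "p \<in> Deep d" and e: "0 < (e::real)" and not: "\<not> (\<forall>\<^sub>F q in at p within Deep d. dist (G q) (G p) < e)"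
  obtain s t where st: "p = (s, t)" by fastforce
  define Fl where "Fl = inf (at p within Deep d) (principal {q. e \<le> dist (G q) (G p)})"
  have nontriv: "Fl \<noteq> bot"
    using not unfolding Fl_def trivial_limit_def eventually_inf_principal by (simp add: not_le)
  have le: "Fl \<le> at p within Deep d" by (simp add: Fl_def)
  have id: "((\<lambda>q. q) \<longlongrightarrow> p) Fl" by (rule tendsto_mono[OF le tendsto_ident_at])
  have s: "(fst \<longlongrightarrow> s) Fl" and t: "(snd \<longlongrightarrow> t) Fl" using tendsto_fst[OF id] tendsto_snd[OF id] by (simp_all add: st)
  have deep: "\<forall>\<^sub>F q in Fl. q \<in> Deep d"
    by (rule filter_leD[OF le]) (simp add: eventually_at_filter)
  have far: "\<forall>\<^sub>F q in Fl. e \<le> dist (G q) (G p)" by (simp add: Fl_def eventually_inf_principal)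
  obtain R1 where R1: "\<And>\<kappa> a u. (a, u) \<in> Deep d \<Longrightarrow> \<bar>real_of_int (a 0)\<bar> \<le> \<bar>real_of_int (s 0)\<bar> \<Longrightarrow>
      param \<kappa> a u \<Longrightarrow> norm \<kappa> \<le> R1 + 4 * u"
    using param_bounded[OF d] by metis
  have s0: "\<forall>\<^sub>F q in Fl. fst q 0 = s 0" using s by (simp add: tendsto_address_iff)
  have t1: "\<forall>\<^sub>F q in Fl. snd q < t + 1" by (rule order_tendstoD(2)[OF t]) simp
  obtain \<kappa> where \<kappa>: "\<kappa> \<in> cball 0 (R1 + 4 * (t + 1)) - ball (G p) e" "param \<kappa> s t"
  proof (rule param_cluster[OF d _ nontriv s t])
    show "(s, t) \<in> Deep d" using p by (simp add: st)
    show "\<forall>\<^sub>F q in Fl. (fst q, snd q) \<in> Deep d" using deep by simp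
    show "\<forall>\<^sub>F q in Fl. param (G q) (fst q) (snd q)"
      using deep by eventually_elim (use G_param(1)[OF d] in auto)
    show "compact (cball 0 (R1 + 4 * (t + 1)) - ball (G p) e)" by (intro compact_diff compact_cball) auto
    show "\<forall>\<^sub>F q in Fl. G q \<in> cball 0 (R1 + 4 * (t + 1)) - ball (G p) e"
      using deep far s0 t1
    proof eventually_elim
      case (elim q)
      have "param (G q) (fst q) (snd q)" using G_param(1)[OF d, of "fst q" "snd q"] elim(1) by simp
      then have "norm (G q) \<le> R1 + 4 * snd q" using R1[of "fst q" "snd q"] elim by simp
      then show ?case using elim by (auto simp: dist_commute)
    qed
  qed
  then have "\<kappa> = G p" using G_param(2)[OF d, of s t] p by (simp add: st)
  then show False using \<kappa>(1) e by simp
qed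

text \<open>A strict lexicographic inequality is decided by finitely many entries, so the order rays
  are open in the product topology. Conversely every cylinder around an address contains an order
  interval around it.\<close>

lemma address_topology_eq: "address_topology = euclidean"
proof (rule topology_eq[THEN iffD2], intro allI iffI)
  have cyl: "\<forall>\<^sub>F a in nhds s. \<forall>k\<in>{..n}. a k = s k" for s :: address and n
    using tendsto_address_iff[of "\<lambda>a. a" s "nhds s"] by (intro eventually_ball_finite) (auto simp: filterlim_ident)
  fix U :: "address set"
  { assume "openin address_topology U"
    then have "generate_topology_on (range (\<lambda>a. {s. less_fun s a}) \<union> range (\<lambda>a. {s. less_fun a s})) U"
      unfolding address_topology_def openin_topology_generated_by_iff .
    then have "open U"
    proof induction
      case (Basis V)
      have agree: "\<exists>n. \<forall>b. (\<forall>k\<in>{..n}. b k = s k) \<longrightarrow> b \<in> V" if sV: "s \<in> V" for s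
        using Basis
      proof (elim UnE imageE)
        fix a assume V: "V = {s. less_fun s a}"
        then obtain n where "s n < a n" "\<And>k. k < n \<Longrightarrow> s k = a k" using sV unfolding less_fun_def by blast
        then show ?thesis unfolding V less_fun_def mem_Collect_eq by (intro exI[of _ n] allI impI) auto
      next
        fix a assume V: "V = {s. less_fun a s}"
        then obtain n where "a n < s n" "\<And>k. k < n \<Longrightarrow> a k = s k" using sV unfolding less_fun_def by blast
        then show ?thesis unfolding V less_fun_def mem_Collect_eq by (intro exI[of _ n] allI impI) auto
      qed
      have "\<exists>W. open W \<and> s \<in> W \<and> W \<subseteq> V" if "s \<in> V" for s
      proof -
        obtain n where n: "\<And>b. \<forall>k\<in>{..n}. b k = s k \<Longrightarrow> b \<in> V" using agree[OF \<open>s \<in> V\<close>] by metis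
        obtain W where W: "open W" "s \<in> W" "\<And>b. b \<in> W \<Longrightarrow> \<forall>k\<in>{..n}. b k = s k"
          using cyl[of n s] unfolding eventually_nhds by metis
        then have "W \<subseteq> V" by (intro subsetI n)
        with W show ?thesis by metis
      qed
      then show ?case by (subst open_subopen) blast
    qed auto
    then show "openin euclidean U" by simp }
  { assume "openin euclidean U"
    then have U: "open U" by simp
    show "openin address_topology U"
    proof (subst openin_subopen, intro ballI)
      fix s assume s: "s \<in> U"
      obtain n where n: "\<And>b. \<forall>k\<le>n. b k = s k \<Longrightarrow> b \<in> U"
      proof (rule ccontr)
        assume "\<not> thesis"
        then have "\<forall>n. \<exists>b. (\<forall>k\<le>n. b k = s k) \<and> b \<notin> U" using that by blast
        then obtain b where b: "\<And>n k. k \<le> n \<Longrightarrow> b n k = s k" "\<And>n. b n \<notin> U" by metis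
        have "b \<longlonglongrightarrow> s"
          unfolding tendsto_address_iff
        proof
          show "\<forall>\<^sub>F n in sequentially. b n k = s k" for k
            using eventually_ge_at_top[of k] by eventually_elim (rule b(1))
        qed
        from topological_tendstoD[OF this U s] b(2) show False by simp
      qed
      \<comment> \<open>The bounds differ from \<open>s\<close> only at the index after
        \<open>n\<close>, so whatever lies between them agrees with \<open>s\<close> up to and
        including \<open>n\<close>.\<close>
      let ?l = "s(Suc n := s (Suc n) - 1)" and ?u = "s(Suc n := s (Suc n) + 1)"
      have "openin address_topology {a. less_fun ?l a}" "openin address_topology {a. less_fun a ?u}"
        unfolding address_topology_def by (auto intro!: topology_generated_by_Basis)
      then have "openin address_topology ({a. less_fun ?l a} \<inter> {a. less_fun a ?u})" by (rule openin_Int)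
      moreover have "s \<in> {a. less_fun ?l a} \<inter> {a. less_fun a ?u}"
        unfolding less_fun_def by (auto intro!: exI[of _ "Suc n"])
      moreover have "a \<in> U" if l: "less_fun ?l a" and u: "less_fun a ?u" for a
      proof -
        obtain k where k: "?l k < a k" "\<And>j. j < k \<Longrightarrow> ?l j = a j" using l unfolding less_fun_def by blast
        obtain m where m: "a m < ?u m" "\<And>j. j < m \<Longrightarrow> a j = ?u j" using u unfolding less_fun_def by blast
        have "n < k"
        proof (rule ccontr)
          assume "\<not> n < k"
          then show False using k m k(2)[of m] m(2)[of k] by (cases m k rule: linorder_cases) (auto split: if_splits)
        qed
        then have "\<forall>j\<le>n. a j = s j" using k(2) by (metis fun_upd_other le_less_trans less_Suc_eq_le less_irrefl)
        then show ?thesis by (rule n)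
      qed
      ultimately show "\<exists>T. openin address_topology T \<and> s \<in> T \<and> T \<subseteq> U" by blast
    qed }
qed

text \<open>Half of \<epsilon> is given away so that a point of the fibre slightly above the infimum
  \<open>t_min s\<close> can be used, without knowing that the infimum is attained.\<close>

lemma Z_eps_Deep:
  assumes "\<epsilon> > 0"
  shows "Z_eps \<epsilon> \<subseteq> Deep (\<epsilon> / 2)"
proof clarify
  fix s t assume "(s, t) \<in> Z_eps \<epsilon>"
  then have fin: "t_min s < \<infinity>" and t: "t_min s + ereal \<epsilon> \<le> ereal t" by (auto simp: Z_eps_def exp_bounded_def)
  have "0 \<le> t_min s" unfolding t_min_def by (rule INF_greatest) (auto simp: X_bar_def)
  with fin obtain r where r: "t_min s = ereal r" by (cases "t_min s") auto
  have "t_min s < ereal (r + \<epsilon> / 2)" using assms by (simp add: r)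
  then obtain a where "(s, a) \<in> X_bar" "a < r + \<epsilon> / 2" unfolding t_min_def INF_less_iff by auto
  moreover have "r + \<epsilon> \<le> t" using t by (simp add: r)
  ultimately show "(s, t) \<in> Deep (\<epsilon> / 2)" by (intro Deep_line[of s a]) (auto simp: field_simps)
qed

theorem corollary11p3:
  fixes \<epsilon> :: real
  assumes "\<epsilon> > 0"
  shows "homeomorphic_map
           (subtopology (prod_topology address_topology euclideanreal) (Z_eps \<epsilon>))
           (subtopology euclidean (G ` Z_eps \<epsilon>)) G"
proof -
  define d where "d = \<epsilon> / 2"
  let ?S = "Z_eps \<epsilon>" and ?h = "inv_into (Z_eps \<epsilon>) G"
  have d: "0 < d" and S: "?S \<subseteq> Deep d" using assms Z_eps_Deep by (auto simp: d_def)
  have inj: "inj_on G ?S" by (rule inj_on_subset[OF G_inj[OF d] S])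
  have "continuous_on ?S G" by (rule continuous_on_subset[OF G_continuous_on[OF d] S])
  moreover have "continuous_on (G ` ?S) ?h"
    unfolding continuous_on_def
  proof clarify
    fix s t assume p: "(s, t) \<in> ?S"
    have ev: "\<forall>\<^sub>F x in at (G (s, t)) within G ` ?S. x \<in> G ` ?S" by (simp add: eventually_at_filter)
    have "(?h \<longlongrightarrow> (s, t)) (at (G (s, t)) within G ` ?S)"
    proof (rule G_inverse_tendsto[OF d])
      show "(s, t) \<in> Deep d" using p S by blast
      show "((\<lambda>x. G (?h x)) \<longlongrightarrow> G (s, t)) (at (G (s, t)) within G ` ?S)"
        by (rule Lim_transform_eventually[OF tendsto_ident_at])
          (use ev in eventually_elim, simp add: f_inv_into_f)
      show "\<forall>\<^sub>F x in at (G (s, t)) within G ` ?S. ?h x \<in> Deep d"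
        using ev by eventually_elim (rule subsetD[OF S inv_into_into])
    qed
    then show "(?h \<longlongrightarrow> ?h (G (s, t))) (at (G (s, t)) within G ` ?S)"
      by (simp add: inv_into_f_f[OF inj p])
  qed
  ultimately have "homeomorphic_maps (top_of_set ?S) (top_of_set (G ` ?S)) G ?h"
    unfolding homeomorphic_maps_def continuous_map_in_subtopology continuous_map_iff_continuous
    using inj by (auto simp: inv_into_f_f f_inv_into_f inv_into_into)
  then show ?thesis
    unfolding address_topology_eq prod_topology_euclidean homeomorphic_map_maps by blast
qed

end
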